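(* We have $\mathcal U_0^{(0)}=p_1$, and for $k\ge1$, $$\mathcal U_k^{(0)}=\sum_{j=1}^k\frac1{k+1}\binom{k+1}{j}\sum p_{a_1}\cdots p_{a_j}\,p_{b_1}^\perp\cdots p_{b_{k+1-j}}^\perp,$$ where the inner summation ranges over all positive integers $a_1,\ldots,a_j,b_1,\ldots,b_{k+1-j}$ subject to the restriction $$a_1+\cdots+a_j=b_1+\cdots+b_{k+1-j}+1.$$
   Context: $p_1,p_2,\ldots$ are the power sum symmetric functions (acting by multiplication), $p_i^\perp=i\,\partial/\partial p_i$, $p_\gamma=p_{\gamma_1}p_{\gamma_2}\cdots$ and $p_\alpha^\perp=p_{\alpha_1}^\perp p_{\alpha_2}^\perp\cdots$ for partitions $\gamma,\alpha$; $l(\alpha)$ is the number of parts of $\alpha$. The base field has characteristic $0$, and $s_\lambda$ are the Schur functions. The content of a cell $\Box$ in row $i$, column $j$ of the diagram of a partition is $c(\Box)=j-i$, and $\mu=\lambda+\Box$ means that $\lambda,\mu$ are partitions and the diagram of $\mu$ is that of $\lambda$ with the single cell $\Box$ added. For $k\ge0$, $\mathcal U_k$ is the linear operator on symmetric functions defined by $\mathcal U_k\,s_\lambda=\sum_{\Box:\ \mu=\lambda+\Box}c(\Box)^ks_\mu$ for all partitions $\lambda$, the sum being over all ways to add a cell to $\lambda$, with $0^0=1$. The operator $\mathcal U_k$ is written (uniquely) as a possibly infinite linear combination of normally ordered monomials $p_\gamma p_\alpha^\perp$; only terms with $l(\gamma)+l(\alpha)=k+1-2h$ for integers $h\ge0$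 occur, and $\mathcal U_k^{(h)}$ denotes the sum of the terms with $l(\gamma)+l(\alpha)=k+1-2h$, so that $\mathcal U_k=\sum_{h\ge0}\mathcal U_k^{(h)}$. In particular $\mathcal U_k^{(0)}$ is the part of total degree $k+1$. *)

theory Defs
  imports "HOL-Library.Poly_Mapping" "Jordan_Normal_Form.Determinant"
begin

text \<open>
  Over a field of characteristic 0 the ring of symmetric functions is the polynomial ring in the
  algebraically independent power sums, and this is how it is represented: a monomial is a finitely
  supported exponent function, a polynomial a finitely supported function on monomials. To have
  no superfluous variable, exponent index \<open>i\<close> belongs to the power sum of degree \<open>i + 1\<close>.
\<close>

type_synonym 'a symfun = "(nat \<Rightarrow>\<^sub>0 nat) \<Rightarrow>\<^sub>0 'a"

definition smul :: "'a::field_char_0 \<Rightarrow> 'a symfun \<Rightarrow> 'a symfun" where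
  "smul c f = Poly_Mapping.single 0 c * f"

lemma vector_space_smul: "vector_space (smul :: 'a::field_char_0 \<Rightarrow> _)"
  by unfold_locales
    (simp_all add: smul_def algebra_simps single_add mult_single flip: mult.assoc)

text \<open>Meaningful for \<open>i \<ge> 1\<close> only.\<close>

definition power_sum :: "nat \<Rightarrow> 'a::field_char_0 symfun" where
  "power_sum i = Poly_Mapping.single (Poly_Mapping.single (i - 1) 1) 1"

definition partial :: "nat \<Rightarrow> 'a::field_char_0 symfun \<Rightarrow> 'a symfun" where
  "partial v f = (\<Sum>m\<in>Poly_Mapping.keys f.
     Poly_Mapping.single (m - Poly_Mapping.single v 1)
       (of_nat (Poly_Mapping.lookup m v) * Poly_Mapping.lookup f m))"

definition power_sum_perp :: "nat \<Rightarrow> 'a::field_char_0 symfun \<Rightarrow> 'a symfun" where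
  "power_sum_perp i f = smul (of_nat i) (partial (i - 1) f)"

lemma power_sum_perp_power_sum:
  assumes "i \<ge> 1" "j \<ge> 1"
  shows "power_sum_perp i (power_sum j :: 'a::field_char_0 symfun) = (if i = j then of_nat i else 0)"
  using assms
  by (auto simp: power_sum_perp_def power_sum_def partial_def smul_def mult_single lookup_single
      when_def simp flip: single_of_nat)

definition power_sums :: "nat list \<Rightarrow> 'a::field_char_0 symfun" where
  "power_sums as = prod_list (map power_sum as)"

definition power_sums_perp :: "nat list \<Rightarrow> 'a::field_char_0 symfun \<Rightarrow> 'a symfun" where
  "power_sums_perp bs = foldr power_sum_perp bs"

subsection \<open>Partitions and Schur functions\<close>

definition is_partition :: "nat list \<Rightarrow> bool" where
  "is_partition la \<longleftrightarrow> sorted_wrt (\<ge>) la \<and> 0 \<notin> set la"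

text \<open>Rows and columns are numbered from 0, which does not change contents.\<close>

definition diagram :: "nat list \<Rightarrow> (nat \<times> nat) set" where
  "diagram la = {(i, j). i < length la \<and> j < la ! i}"

definition content :: "nat \<times> nat \<Rightarrow> int" where
  "content b = int (snd b) - int (fst b)"

definition adds_cell :: "nat list \<Rightarrow> nat \<times> nat \<Rightarrow> nat list \<Rightarrow> bool" where
  "adds_cell la b mu \<longleftrightarrow> is_partition la \<and> is_partition mu \<and>
     b \<notin> diagram la \<and> diagram mu = insert b (diagram la)"

text \<open>
  The complete homogeneous symmetric functions in terms of the power sums, by Newton's identity
  \<open>n h\<^sub>n = p\<^sub>1 h\<^sub>n\<^sub>-\<^sub>1 + \<dots> + p\<^sub>n h\<^sub>0\<close>.
\<close>

fun complete_hom :: "nat \<Rightarrow> 'a::field_char_0 symfun" where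
  "complete_hom 0 = 1"
| "complete_hom (Suc n) =
     smul (1 / of_nat (Suc n)) (\<Sum>i\<le>n. power_sum (Suc i) * complete_hom (n - i))"

definition complete_hom_int :: "int \<Rightarrow> 'a::field_char_0 symfun" where
  "complete_hom_int n = (if n < 0 then 0 else complete_hom (nat n))"

text \<open>The Schur function as the Jacobi--Trudi determinant \<open>det (h (la\<^sub>i - i + j))\<close>.\<close>

definition schur :: "nat list \<Rightarrow> 'a::field_char_0 symfun" where
  "schur la = det (mat (length la) (length la)
     (\<lambda>(i, j). complete_hom_int (int (la ! i) - int i + int j)))"

subsection \<open>Infinite sums of operators and normal ordering\<close>

text \<open>
  A possibly infinite sum of operators makes sense if, on each symmetric function, only finitely
  many summands do not vanish; \<open>op_sum\<close> is junk when this fails.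
\<close>

definition op_sum :: "('i \<Rightarrow> 'a symfun \<Rightarrow> 'a symfun) \<Rightarrow> 'i set \<Rightarrow> 'a::field_char_0 symfun \<Rightarrow> 'a symfun" where
  "op_sum F I f = (\<Sum>i\<in>{i \<in> I. F i f \<noteq> 0}. F i f)"

definition has_op_sum ::
  "('i \<Rightarrow> 'a symfun \<Rightarrow> 'a symfun) \<Rightarrow> 'i set \<Rightarrow> ('a::field_char_0 symfun \<Rightarrow> 'a symfun) \<Rightarrow> bool" where
  "has_op_sum F I T \<longleftrightarrow> (\<forall>f. finite {i \<in> I. F i f \<noteq> 0}) \<and> T = op_sum F I"

definition normal_term ::
  "(nat list \<times> nat list \<Rightarrow> 'a) \<Rightarrow> nat list \<times> nat list \<Rightarrow> 'a::field_char_0 symfun \<Rightarrow> 'a symfun" where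
  "normal_term c = (\<lambda>(ga, al) f. smul (c (ga, al)) (power_sums ga * power_sums_perp al f))"

definition partition_pairs :: "(nat list \<times> nat list) set" where
  "partition_pairs = {(ga, al). is_partition ga \<and> is_partition al}"

definition normal_coeffs ::
  "('a::field_char_0 symfun \<Rightarrow> 'a symfun) \<Rightarrow> nat list \<times> nat list \<Rightarrow> 'a" where
  "normal_coeffs T = (THE c. (\<forall>x. x \<notin> partition_pairs \<longrightarrow> c x = 0) \<and>
     has_op_sum (normal_term c) partition_pairs T)"

subsection \<open>The operators \<open>U\<^sub>k\<close>\<close>

definition U_op :: "nat \<Rightarrow> 'a::field_char_0 symfun \<Rightarrow> 'a symfun" where
  "U_op k = (THE T. Vector_Spaces.linear smul smul T \<and>
     (\<forall>la. is_partition la \<longrightarrow>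
        T (schur la) = (\<Sum>(b, mu)\<in>{(b, mu). adds_cell la b mu}. smul (of_int (content b) ^ k) (schur mu))))"

text \<open>The condition on lengths is \<open>l(ga) + l(al) = k + 1 - 2h\<close>, without truncated subtraction.\<close>

definition U_part :: "nat \<Rightarrow> nat \<Rightarrow> 'a::field_char_0 symfun \<Rightarrow> 'a symfun" where
  "U_part k h = op_sum (normal_term (normal_coeffs (U_op k)))
     {(ga, al) \<in> partition_pairs. length ga + length al + 2 * h = k + 1}"

end

theory Submission
  imports Defs
begin

text \<open>
  Write \<open>a\<^sub>n\<close> for multiplication by \<open>p\<^sub>n\<close> if \<open>n > 0\<close>, for \<open>p\<^sub>-\<^sub>n\<^sup>\<bottom>\<close> if \<open>n < 0\<close>, put \<open>a\<^sub>0 = 0\<close>, and let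
  \<open>V m s\<close> be the coefficient of \<open>z\<^sup>s\<close> in the normally ordered power \<open>:(\<Sum>\<^sub>n a\<^sub>n z\<^sup>n)\<^sup>m:\<close>. By the
  binomial theorem the right-hand side of the theorem is \<open>V (k + 1) 1 / (k + 1)\<close>. The proof has
  three parts.

  \<^item> The operators \<open>U\<^sub>k\<close> are iterated commutators. The cut-and-join operator \<open>D = V 3 0 / 6\<close> multiplies
  \<open>s\<^sub>\<lambda>\<close> by the sum of the contents of \<open>\<lambda>\<close> (\<open>cut_join_schur\<close>). Adding a cell changes this
  eigenvalue by the content of the cell, so commuting with \<open>D\<close> turns \<open>U\<^sub>k\<close> into \<open>U\<^sub>k\<^sub>+\<^sub>1\<close>; and \<open>U\<^sub>0\<close> is
  multiplication by \<open>p\<^sub>1\<close>, by Pieri's rule (\<open>pieri\<close>). Since the Schur functions span, \<open>U\<^sub>k\<close> is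
  the \<open>k\<close>-fold commutator of \<open>D\<close> with \<open>p\<^sub>1\<close> (\<open>U_op_eq\<close>). Both facts about Schur functions follow
  by induction on the number of rows from Bernstein's operators \<open>B\<^sub>n\<close>, which satisfy
  \<open>s\<^sub>(\<^sub>n\<^sub>,\<^sub>\<lambda>\<^sub>) = B\<^sub>n s\<^sub>\<lambda>\<close> (\<open>schur_Cons\<close>) and have simple commutators with all \<open>a\<^sub>u\<close>, hence with \<open>D\<close>
  (\<open>cubic_bernstein\<close>).

  \<^item> Commutators with \<open>D\<close> have a simple leading term. Say that an operator has order less than \<open>n\<close>
  if all its \<open>n\<close>-fold commutators with operators \<open>a\<^sub>u\<close> vanish. Up to lower order,
  \<open>[D, V m s]\<close> is \<open>m s / (m + 1)\<close> times \<open>V (m + 1) s\<close>: with \<open>\<phi> = \<Sum> a\<^sub>n z\<^sup>n\<close> and \<open>\<theta> = z d/dz\<close> this says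
  that \<open>D\<close> acts by the derivation \<open>\<phi> \<mapsto> \<phi> \<theta>\<phi>\<close>, which maps \<open>\<phi>\<^sup>m\<close> to \<open>m / (m + 1)\<close> times
  \<open>\<theta>(\<phi>\<^sup>m\<^sup>+\<^sup>1)\<close>. The proof never expands these infinite sums. It only uses
  \<open>[a\<^sub>u, V m s] = - u m V (m - 1) (s + u)\<close> (\<open>normal_power_commute\<close>) and the Jacobi identity: after
  one commutator with \<open>a\<^sub>u\<close> the claim for \<open>m\<close> becomes the claim for \<open>m - 1\<close>. It follows that
  \<open>U\<^sub>k\<close> equals \<open>V (k + 1) 1 / (k + 1)\<close> up to order less than \<open>k + 1\<close> (\<open>ad_cut_join_leading_term\<close>).

  \<^item> The order controls the normally ordered expansion. Every linear operator has exactly one such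
  expansion (\<open>normal_ordering_exists\<close>, \<open>normal_coeffs_eqI\<close>), and up to a non-zero factor the
  coefficient of \<open>p\<^sub>\<gamma> p\<^sub>\<alpha>\<^sup>\<bottom>\<close> is the constant term of an \<open>(l(\<gamma>) + l(\<alpha>))\<close>-fold commutator with
  operators \<open>a\<^sub>u\<close>, applied to \<open>1\<close>. So operators of order less than \<open>n\<close> contribute nothing in
  degrees \<open>\<ge> n\<close>, and \<open>V m s\<close> contributes in degree \<open>m\<close> only (\<open>op_sum_normal_coeffs_leading\<close>).
\<close>

section \<open>Symmetric functions as polynomials in the power sums\<close>

subsection \<open>Linear operators\<close>
interpretation symfun: vector_space "smul :: 'a::field_char_0 \<Rightarrow> 'a symfun \<Rightarrow> 'a symfun"
  by (rule vector_space_smul)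

interpretation symfun_op: vector_space_pair
  "smul :: 'a::field_char_0 \<Rightarrow> 'a symfun \<Rightarrow> 'a symfun" smul ..

abbreviation lin :: "('a::field_char_0 symfun \<Rightarrow> 'a symfun) \<Rightarrow> bool" where
  "lin \<equiv> Vector_Spaces.linear smul smul"

lemma linI:
  assumes "\<And>f g. T (f + g) = T f + T g" "\<And>c f. T (smul c f) = smul c (T f)"
  shows "lin T"
  using assms vector_space_smul by (simp add: Vector_Spaces.linear_iff)

lemmas lin_add = symfun_op.linear_add
  and lin_diff = symfun_op.linear_diff
  and lin_smul = symfun_op.linear_scale
  and lin_zero = symfun_op.linear_0
  and lin_uminus = symfun_op.linear_neg
  and lin_sum = symfun_op.linear_sum

lemma smul_mult_left [simp]: "smul c f * g = smul c (f * g)"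
  and smul_mult_right [simp]: "f * smul c g = smul c (f * g)"
  by (simp_all add: smul_def algebra_simps)

lemma smul_of_int: "smul (of_int k) f = of_int k * f"
  and smul_of_nat: "smul (of_nat n) f = of_nat n * f"
  and smul_numeral: "smul (numeral w) f = numeral w * f"
  by (simp_all add: smul_def)

lemma lin_of_int: "lin T \<Longrightarrow> T (of_int k * f) = of_int k * T f"
  and lin_of_nat: "lin T \<Longrightarrow> T (of_nat n * f) = of_nat n * T f"
  and lin_numeral: "lin T \<Longrightarrow> T (numeral w * f) = numeral w * T f"
  by (simp_all add: lin_smul flip: smul_of_int smul_of_nat smul_numeral)

lemma of_nat_mult_eq_0D:
  assumes "of_nat n * (f :: 'a::field_char_0 symfun) = 0" "n \<noteq> 0" shows "f = 0"
  using assms by (metis of_nat_eq_0_iff smul_of_nat symfun.scale_eq_0_iff)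

lemma lin_ident: "lin (\<lambda>f. f)"
  and lin_const_0: "lin (\<lambda>f. 0)"
  and lin_mult: "lin ((*) g)"
  by (auto intro!: linI simp: algebra_simps)

lemma lin_plus: "lin S \<Longrightarrow> lin T \<Longrightarrow> lin (\<lambda>f. S f + T f)"
  and lin_minus: "lin S \<Longrightarrow> lin T \<Longrightarrow> lin (\<lambda>f. S f - T f)"
  and lin_scale: "lin T \<Longrightarrow> lin (\<lambda>f. smul c (T f))"
  and lin_comp: "lin S \<Longrightarrow> lin T \<Longrightarrow> lin (\<lambda>f. S (T f))"
  and lin_times: "lin T \<Longrightarrow> lin (\<lambda>f. g * T f)"
  by (auto intro!: linI simp: lin_add lin_smul algebra_simps symfun.scale_right_distrib
      symfun.scale_right_diff_distrib symfun.scale_left_commute)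

lemma lin_family_sum: "(\<And>i. i \<in> I \<Longrightarrow> lin (T i)) \<Longrightarrow> lin (\<lambda>f. \<Sum>i\<in>I. T i f)"
  by (auto intro!: linI simp: lin_add lin_smul sum.distrib symfun.scale_sum_right)

subsection \<open>Induction over the ring\<close>

lemma symfun_eq_sum_monomials:
  "f = (\<Sum>m\<in>Poly_Mapping.keys f. Poly_Mapping.single m (Poly_Mapping.lookup f m))"
  by (rule poly_mapping_eqI)
    (auto simp: lookup_sum lookup_single when_def in_keys_iff intro!: sum.neutral)

lemma symfun_induct_monomials [case_names monomial add]:
  assumes "\<And>m c. P (Poly_Mapping.single m c)" "\<And>f g. P f \<Longrightarrow> P g \<Longrightarrow> P (f + g)"
  shows "P (f :: 'a::field_char_0 symfun)"
proof -
  have "P (\<Sum>m\<in>A. Poly_Mapping.single m (c m))" if "finite A" for A c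
    using that
  proof (induction A)
    case empty
    then show ?case using assms(1)[of 0 0] by simp
  qed (simp add: assms)
  from this[of "Poly_Mapping.keys f" "Poly_Mapping.lookup f"] show ?thesis
    by (simp flip: symfun_eq_sum_monomials)
qed

lemma power_sum_times_monomial:
  "k \<ge> 1 \<Longrightarrow> power_sum k * Poly_Mapping.single m c =
     Poly_Mapping.single (m + Poly_Mapping.single (k - 1) 1) c"
  by (simp add: power_sum_def mult_single add.commute)

text \<open>
  Linear identities between operators are checked by this rule, so that only the behaviour on \<open>1\<close> and
  the commutation with power sums have to be known.
\<close>
lemma symfun_induct [case_names one power_sum smul add]:
  assumes one: "P 1"
    and power_sum: "\<And>k f. k \<ge> 1 \<Longrightarrow> P f \<Longrightarrow> P (power_sum k * f)"
    and smul: "\<And>c f. P f \<Longrightarrow> P (smul c f)"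
    and add: "\<And>f g. P f \<Longrightarrow> P g \<Longrightarrow> P (f + g)"
  shows "P (f :: 'a::field_char_0 symfun)"
proof (induction f rule: symfun_induct_monomials)
  case (monomial m c)
  have step: "P (Poly_Mapping.single (m + Poly_Mapping.single v n) 1)"
    if "P (Poly_Mapping.single m 1)" for m v n
  proof (induction n)
    case (Suc n)
    from power_sum[OF _ Suc, of "Suc v"] show ?case
      by (simp add: power_sum_times_monomial add.assoc flip: single_add)
  qed (use that in simp)
  have "P (Poly_Mapping.single m 1)"
  proof (induction m rule: update_induct)
    case const
    show ?case using one by simp
  next
    case (update f a b)
    then have "Poly_Mapping.update a b f = f + Poly_Mapping.single a b"
      by (intro poly_mapping_eqI)
        (auto simp: lookup_update lookup_add lookup_single when_def in_keys_iff)
    with update step show ?case by simp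
  qed
  from smul[OF this, of c] show ?case by (simp add: smul_def mult_single)
qed (rule add)

subsection \<open>Derivations\<close>

lemma partial_superset:
  assumes "finite A" "Poly_Mapping.keys f \<subseteq> A"
  shows "partial v f = (\<Sum>m\<in>A. Poly_Mapping.single (m - Poly_Mapping.single v 1)
       (of_nat (Poly_Mapping.lookup m v) * Poly_Mapping.lookup f m))"
  unfolding partial_def using assms
  by (intro sum.mono_neutral_left) (auto simp: in_keys_iff)

lemma lookup_smul [simp]: "Poly_Mapping.lookup (smul c f) m = c * Poly_Mapping.lookup f m"
  unfolding smul_def mult_map_scale_conv_mult[symmetric] by (simp add: Poly_Mapping.map.rep_eq when_def)

lemma smul_single: "smul c (Poly_Mapping.single m d) = Poly_Mapping.single m (c * d)"
  by (simp add: smul_def mult_single)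

lemma lin_partial: "lin (partial v)"
proof (rule linI)
  fix f g :: "'a symfun"
  let ?A = "Poly_Mapping.keys f \<union> Poly_Mapping.keys g"
  have "Poly_Mapping.keys (f + g) \<subseteq> ?A" by (rule keys_add)
  then show "partial v (f + g) = partial v f + partial v g"
    by (simp add: partial_superset[of ?A] lookup_add ring_distribs single_add flip: sum.distrib)
next
  fix c and f :: "'a symfun"
  note eq = lookup_smul[of c f]
  then have "Poly_Mapping.keys (smul c f) \<subseteq> Poly_Mapping.keys f"
    by (auto simp: in_keys_iff)
  then show "partial v (smul c f) = smul c (partial v f)"
    by (simp add: partial_superset[of "Poly_Mapping.keys f"] symfun.scale_sum_right smul_single mult_ac)
qed

lemma partial_single: "partial v (Poly_Mapping.single m c) =
    Poly_Mapping.single (m - Poly_Mapping.single v 1) (of_nat (Poly_Mapping.lookup m v) * c)"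
  by (subst partial_superset[of "{m}"]) auto

lemma lookup_partial: "Poly_Mapping.lookup (partial v f) m =
    of_nat (Poly_Mapping.lookup m v + 1) * Poly_Mapping.lookup f (m + Poly_Mapping.single v 1)"
proof (induction f rule: symfun_induct_monomials)
  case (monomial m' c)
  have "m' - Poly_Mapping.single v 1 = m \<longleftrightarrow> m' = m + Poly_Mapping.single v 1"
    if "Poly_Mapping.lookup m' v \<noteq> 0"
    using that
    by (auto simp: poly_mapping_eq_iff fun_eq_iff lookup_add lookup_minus lookup_single when_def)
  then show ?case
    by (auto simp: partial_single lookup_single when_def lookup_add)
qed (simp add: lin_add[OF lin_partial] lookup_add ring_distribs)

lemma partial_power_sum_mult:
  assumes "k \<ge> 1"
  shows "partial v (power_sum k * f) = power_sum k * partial v f + (if v = k - 1 then f else 0)"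
proof (induction f rule: symfun_induct_monomials)
  case (monomial m c)
  have *: "m + Poly_Mapping.single (k-1) 1 - Poly_Mapping.single v 1 =
      m - Poly_Mapping.single v 1 + Poly_Mapping.single (k-1) 1"
    if "v = k - 1 \<longrightarrow> Poly_Mapping.lookup m v \<noteq> 0"
    using that by (intro poly_mapping_eqI) (auto simp: lookup_add lookup_minus lookup_single when_def)
  show ?case
  proof (cases "v = k - 1 \<and> Poly_Mapping.lookup m v = 0")
    case True
    then show ?thesis using assms
      by (auto simp: power_sum_times_monomial partial_single lookup_add)
  next
    case False
    have **: "m - Poly_Mapping.single (k-1) 1 + Poly_Mapping.single (k-1) 1 = m"
      if "v = k - 1"
      using that False
      by (intro poly_mapping_eqI) (auto simp: lookup_add lookup_minus lookup_single when_def)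
    from False show ?thesis using assms * **
      by (auto simp: power_sum_times_monomial partial_single lookup_add lookup_single
          ring_distribs single_add)
  qed
qed (auto simp: lin_add[OF lin_partial] algebra_simps)

lemma lin_power_sum_perp: "lin (power_sum_perp k)"
  unfolding power_sum_perp_def[abs_def] by (intro lin_scale lin_partial)

lemma partial_one [simp]: "partial v 1 = 0"
  using partial_single[of v 0 1] by simp

lemma power_sum_perp_one [simp]: "power_sum_perp k 1 = 0"
  by (simp add: power_sum_perp_def)

lemma power_sum_perp_power_sum_mult:
  assumes "k \<ge> 1" "r \<ge> 1"
  shows "power_sum_perp r (power_sum k * f) =
    power_sum k * power_sum_perp r f + (if r = k then of_nat k * f else 0)"
  using assms
  by (auto simp: power_sum_perp_def partial_power_sum_mult symfun.scale_right_distrib smul_of_nat)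

lemma power_sum_perp_mult:
  assumes "r \<ge> 1"
  shows "power_sum_perp r (f * g) = power_sum_perp r f * g + f * power_sum_perp r g"
proof (induction f rule: symfun_induct)
  case (power_sum k f)
  then show ?case using assms
    by (simp add: power_sum_perp_power_sum_mult mult.assoc ring_distribs)
qed (simp_all add: lin_add[OF lin_power_sum_perp] lin_smul[OF lin_power_sum_perp]
    symfun.scale_right_distrib ring_distribs)

lemma power_sum_perp_commute:
  assumes "r \<ge> 1" "k \<ge> 1"
  shows "power_sum_perp r (power_sum_perp k f) = power_sum_perp k (power_sum_perp r f)"
proof (induction f rule: symfun_induct)
  case (power_sum j f)
  then show ?case using assms
    by (simp add: power_sum_perp_power_sum_mult lin_add[OF lin_power_sum_perp]
        lin_of_nat[OF lin_power_sum_perp] lin_zero[OF lin_power_sum_perp])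
qed (simp_all add: lin_add[OF lin_power_sum_perp] lin_smul[OF lin_power_sum_perp]
    lin_zero[OF lin_power_sum_perp])

text \<open>
  Characteristic 0 enters here: the exponent produced by differentiating a monomial is invertible.
\<close>
lemma power_sum_perp_zero_imp_constant:
  assumes "\<And>r. r \<ge> 1 \<Longrightarrow> power_sum_perp r f = 0"
  shows "f = smul (Poly_Mapping.lookup f 0) 1"
proof (rule poly_mapping_eqI)
  fix m
  show "Poly_Mapping.lookup f m = Poly_Mapping.lookup (smul (Poly_Mapping.lookup f 0) 1) m"
  proof (cases "m = 0")
    case False
    then obtain v where v: "Poly_Mapping.lookup m v \<noteq> 0"
      by (metis lookup_zero poly_mapping_eqI)
    define m' where "m' = m - Poly_Mapping.single v 1"
    have m: "m' + Poly_Mapping.single v 1 = m"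
      unfolding m'_def using v
      by (intro poly_mapping_eqI) (auto simp: lookup_add lookup_minus lookup_single when_def)
    have "partial v f = 0"
      using assms[of "Suc v"] of_nat_neq_0[of v, where 'a = 'a] by (simp add: power_sum_perp_def)
    then have "Poly_Mapping.lookup f m = 0"
      using lookup_partial[of v f m'] of_nat_neq_0[of "Poly_Mapping.lookup m' v", where 'a = 'a]
      by (simp add: m[simplified])
    then show ?thesis using False by (simp add: lookup_one)
  qed simp
qed

lemma lin_power_sums_perp: "lin (power_sums_perp bs)"
  by (induction bs)
    (auto simp: power_sums_perp_def[abs_def] lin_ident id_def comp_def intro: lin_comp lin_power_sum_perp)

lemma power_sums_perp_Nil [simp]: "power_sums_perp [] f = f"
  and power_sums_perp_Cons: "power_sums_perp (b # bs) f = power_sum_perp b (power_sums_perp bs f)"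
  by (simp_all add: power_sums_perp_def)

lemma power_sums_Nil [simp]: "power_sums [] = 1"
  and power_sums_Cons: "power_sums (a # as) = power_sum a * power_sums as"
  by (simp_all add: power_sums_def)

lemma power_sums_perp_commute:
  assumes "r \<ge> 1" "\<forall>b\<in>set bs. b \<ge> 1"
  shows "power_sum_perp r (power_sums_perp bs f) = power_sums_perp bs (power_sum_perp r f)"
  using assms by (induction bs) (simp_all add: power_sums_perp_Cons power_sum_perp_commute)

subsection \<open>Filtration by degree\<close>

text \<open>
  The grading in which \<open>p\<^sub>k\<close> has degree \<open>k\<close>. Being generated by the same operations as the ring, the
  filtration can be used by rule induction, without looking at monomials. It serves to show that the
  infinite sums of operators below are locally finite.
\<close>
inductive weight_le :: "nat \<Rightarrow> 'a::field_char_0 symfun \<Rightarrow> bool" where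
  one: "weight_le d 1"
| power_sum: "weight_le d f \<Longrightarrow> k \<ge> 1 \<Longrightarrow> weight_le (d + k) (power_sum k * f)"
| smul: "weight_le d f \<Longrightarrow> weight_le d (smul c f)"
| add: "weight_le d f \<Longrightarrow> weight_le d g \<Longrightarrow> weight_le d (f + g)"

lemma weight_le_mono: "weight_le d f \<Longrightarrow> d \<le> e \<Longrightarrow> weight_le e f"
proof (induction arbitrary: e rule: weight_le.induct)
  case (power_sum d f k)
  then have "weight_le (e - k) f" by auto
  with weight_le.power_sum[OF this, of k] power_sum.hyps power_sum.prems show ?case by simp
qed (auto intro: weight_le.intros)

lemma weight_le_zero [simp]: "weight_le d 0"
  using weight_le.smul[OF weight_le.one, of d 0] by simp

lemma weight_le_uminus: "weight_le d f \<Longrightarrow> weight_le d (- f)"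
  using weight_le.smul[of d f "-1"] by simp

lemma weight_le_exists: "\<exists>d. weight_le d f"
proof (induction f rule: symfun_induct)
  case (power_sum k f)
  then show ?case using weight_le.power_sum by blast
next
  case (add f g)
  then obtain d e where "weight_le d f" "weight_le e g" by auto
  then have "weight_le (max d e) f" "weight_le (max d e) g"
    by (auto intro: weight_le_mono)
  then show ?case by (auto intro: weight_le.add)
qed (auto intro: weight_le.intros)

lemma weight_le_power_sum_perp:
  assumes "weight_le d f" "r \<ge> 1"
  shows "(r \<le> d \<longrightarrow> weight_le (d - r) (power_sum_perp r f)) \<and> (d < r \<longrightarrow> power_sum_perp r f = 0)"
  using assms(1)
proof (induction rule: weight_le.induct)
  case (power_sum d f k)
  have *: "power_sum_perp r (power_sum k * f) =
      power_sum k * power_sum_perp r f + (if r = k then of_nat k * f else 0)"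
    using assms power_sum by (simp add: power_sum_perp_power_sum_mult)
  have "weight_le (d + k - r) (power_sum k * power_sum_perp r f)" if "r \<le> d"
    using weight_le.power_sum[of "d - r" "power_sum_perp r f" k] power_sum that by simp
  moreover have "weight_le d (of_nat k * f)" using power_sum
    by (metis smul_of_nat weight_le.smul)
  ultimately show ?case using power_sum
    by (cases "r \<le> d") (auto simp: * intro: weight_le.add)
qed (auto simp: lin_add[OF lin_power_sum_perp] lin_smul[OF lin_power_sum_perp]
    intro: weight_le.intros)

lemma weight_le_power_sums_perp:
  assumes "weight_le d f" "\<forall>b\<in>set bs. b \<ge> 1"
  shows "(sum_list bs \<le> d \<longrightarrow> weight_le (d - sum_list bs) (power_sums_perp bs f)) \<and>
    (d < sum_list bs \<longrightarrow> power_sums_perp bs f = 0)"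
  using assms(2)
proof (induction bs)
  case (Cons b bs)
  show ?case
  proof (cases "sum_list bs \<le> d")
    case True
    with Cons have "weight_le (d - sum_list bs) (power_sums_perp bs f)" by simp
    from weight_le_power_sum_perp[OF this, of b] Cons.prems True show ?thesis
      by (auto simp: power_sums_perp_Cons add.commute less_diff_conv le_diff_conv2)
  next
    case False
    with Cons show ?thesis by (auto simp: power_sums_perp_Cons lin_zero[OF lin_power_sum_perp])
  qed
qed (use assms in auto)

section \<open>The Heisenberg algebra and normally ordered powers\<close>

definition heis :: "int \<Rightarrow> 'a::field_char_0 symfun \<Rightarrow> 'a symfun" where
  "heis u f = (if u > 0 then power_sum (nat u) * f
     else if u < 0 then power_sum_perp (nat (- u)) f else 0)"

lemma lin_heis: "lin (heis u)"
  by (cases u "0::int" rule: linorder_cases)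
    (auto simp: heis_def[abs_def] lin_mult lin_power_sum_perp lin_const_0)

lemma heis_0 [simp]: "heis 0 f = 0"
  by (simp add: heis_def)

lemma heis_int: "n \<ge> 1 \<Longrightarrow> heis (int n) f = power_sum n * f"
  and heis_minus_int: "n \<ge> 1 \<Longrightarrow> heis (- int n) f = power_sum_perp n f"
  by (simp_all add: heis_def)

lemma int_cases_signed:
  obtains (pos) r where "r \<ge> 1" "u = int r" | (neg) r where "r \<ge> 1" "u = - int r" | (zero) "u = 0"
proof (cases u "0 :: int" rule: linorder_cases)
  case less
  with neg[of "nat (- u)"] show ?thesis by simp
next
  case greater
  with pos[of "nat u"] show ?thesis by simp
qed (use zero in simp)

lemma heis_commute:
  "heis u (heis v f) = heis v (heis u f) - (if u + v = 0 then of_int u * f else 0)"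
proof (cases u rule: int_cases_signed)
  case u: (pos r)
  show ?thesis
    using u by (cases v rule: int_cases_signed)
      (simp_all add: heis_int heis_minus_int power_sum_perp_power_sum_mult mult.left_commute)
next
  case u: (neg r)
  show ?thesis
  proof (cases v rule: int_cases_signed)
    case v: (neg t)
    then show ?thesis
      using u power_sum_perp_commute[OF u(1) v(1)] by (simp add: heis_minus_int)
  qed (use u in \<open>simp_all add: heis_int heis_minus_int power_sum_perp_power_sum_mult
    lin_zero[OF lin_power_sum_perp]\<close>)
qed (simp add: lin_zero[OF lin_heis])

lemma symfun_induct_heis [case_names one heis smul add]:
  assumes "P 1" "\<And>u f. u > 0 \<Longrightarrow> P f \<Longrightarrow> P (heis u f)"
    "\<And>c f. P f \<Longrightarrow> P (smul c f)" "\<And>f g. P f \<Longrightarrow> P g \<Longrightarrow> P (f + g)"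
  shows "P f"
proof (induction f rule: symfun_induct)
  case (power_sum k f)
  with assms(2)[of "int k" f] show ?case by (simp add: heis_int)
qed (use assms in auto)

lemma lookup_0_power_sum_mult [simp]:
  assumes "k \<ge> 1" shows "Poly_Mapping.lookup (power_sum k * f) 0 = 0"
proof (induction f rule: symfun_induct_monomials)
  case (monomial m c)
  have "m + Poly_Mapping.single (k - 1) 1 \<noteq> 0"
    by (metis add_is_0 lookup_add lookup_single_eq lookup_zero zero_neq_one)
  then show ?case using assms by (simp add: power_sum_times_monomial lookup_single)
qed (simp add: ring_distribs lookup_add)

subsection \<open>Truncated sums of normally ordered monomials\<close>

definition pos_lists :: "nat \<Rightarrow> nat \<Rightarrow> nat list set" where
  "pos_lists N n = {xs. length xs = n \<and> set xs \<subseteq> {1..N}}"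

lemma finite_pos_lists [simp]: "finite (pos_lists N n)"
  using finite_lists_length_eq[of "{1..N}" n] by (simp add: pos_lists_def conj_commute)

lemma pos_lists_0 [simp]: "pos_lists N 0 = {[]}"
  by (auto simp: pos_lists_def)

lemma sum_pos_lists_Suc:
  "(\<Sum>xs\<in>pos_lists N (Suc n). g xs) = (\<Sum>i=1..N. \<Sum>xs\<in>pos_lists N n. g (i # xs))"
proof -
  have "pos_lists N (Suc n) = (\<lambda>(i, xs). i # xs) ` ({1..N} \<times> pos_lists N n)"
    by (auto simp: pos_lists_def image_iff length_Suc_conv)
  moreover have "inj_on (\<lambda>(i, xs). i # xs) ({1..N} \<times> pos_lists N n)"
    by (auto simp: inj_on_def)
  ultimately show ?thesis
    by (simp add: sum.reindex sum.cartesian_product case_prod_unfold comp_def)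
qed

lemma lin_if: "lin S \<Longrightarrow> lin T \<Longrightarrow> lin (\<lambda>f. if b then S f else T f)"
  by (cases b) simp_all

text \<open>
  The restriction of an infinite sum to parts of size at most \<open>N\<close>. Truncated sums are finite, so they
  can be computed by splitting off a part, and on a given \<open>f\<close> the full sum agrees with all truncations
  for large \<open>N\<close>. Commuting with \<open>p\<^sub>u\<close> or \<open>p\<^sub>u\<^sup>\<bottom>\<close> only removes a part equal to \<open>u\<close>, so the commutation
  rules already hold for truncations with \<open>N \<ge> u\<close>.
\<close>
definition trunc_sum ::
  "nat \<Rightarrow> nat \<Rightarrow> nat \<Rightarrow> int \<Rightarrow> 'a::field_char_0 symfun \<Rightarrow> 'a symfun" where
  "trunc_sum N j l s f = (\<Sum>as\<in>pos_lists N j. \<Sum>bs\<in>pos_lists N l.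
     if int (sum_list as) = int (sum_list bs) + s then power_sums as * power_sums_perp bs f else 0)"

lemma lin_trunc_sum: "lin (trunc_sum N j l s)"
  unfolding trunc_sum_def[abs_def]
  by (intro lin_family_sum lin_if lin_times lin_power_sums_perp lin_const_0)

lemma trunc_sum_0_0: "trunc_sum N 0 0 s f = (if s = 0 then f else 0)"
  by (simp add: trunc_sum_def)

lemma trunc_sum_Suc_left:
  "trunc_sum N (Suc j) l s f = (\<Sum>i=1..N. power_sum i * trunc_sum N j l (s - int i) f)"
  unfolding trunc_sum_def sum_pos_lists_Suc
  by (auto simp: sum_distrib_left power_sums_Cons mult.assoc algebra_simps
      if_distrib[of "(*) _"] intro!: sum.cong)

lemma trunc_sum_Suc_right:
  "trunc_sum N j (Suc l) s f = (\<Sum>i=1..N. trunc_sum N j l (s + int i) (power_sum_perp i f))"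
proof -
  have "trunc_sum N j (Suc l) s f = (\<Sum>as\<in>pos_lists N j. \<Sum>i=1..N. \<Sum>bs\<in>pos_lists N l.
     if int (sum_list as) = int (sum_list bs) + (s + int i)
     then power_sums as * power_sums_perp bs (power_sum_perp i f) else 0)"
    unfolding trunc_sum_def sum_pos_lists_Suc
    by (intro sum.cong refl)
      (auto simp: power_sums_perp_Cons power_sums_perp_commute pos_lists_def subset_eq algebra_simps)
  also have "\<dots> = (\<Sum>i=1..N. trunc_sum N j l (s + int i) (power_sum_perp i f))"
    unfolding trunc_sum_def by (rule sum.swap)
  finally show ?thesis .
qed

text \<open>
  Moving \<open>p\<^sub>u\<^sup>\<bottom>\<close> through a product \<open>p\<^sub>a\<^sub>1 \<dots> p\<^sub>a\<^sub>j\<close> replaces one factor \<open>p\<^sub>u\<close> by \<open>u\<close>; each of the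
  \<open>j\<close> positions gives the same sum over the remaining parts.
\<close>
lemma trunc_sum_perp_commute:
  assumes "u \<ge> 1" "u \<le> N"
  shows "power_sum_perp u (trunc_sum N j l s f) = trunc_sum N j l s (power_sum_perp u f) +
    of_nat (u * j) * trunc_sum N (j - 1) l (s - int u) f"
proof (induction j arbitrary: s)
  case 0
  show ?case
    unfolding trunc_sum_def using assms
    by (auto simp: lin_sum[OF lin_power_sum_perp] lin_zero[OF lin_power_sum_perp]
        if_distrib[of "power_sum_perp u"] power_sums_perp_commute pos_lists_def subset_eq
        intro!: sum.cong)
next
  case (Suc j)
  have 1: "power_sum_perp u (power_sum i * trunc_sum N j l (s - int i) f) =
      power_sum i * trunc_sum N j l (s - int i) (power_sum_perp u f) +
      of_nat (u * j) * (power_sum i * trunc_sum N (j - 1) l (s - int u - int i) f) +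
      (if i = u then of_nat u * trunc_sum N j l (s - int u) f else 0)"
    if "i \<in> {1..N}" for i
    using that assms
    by (auto simp: power_sum_perp_power_sum_mult Suc algebra_simps)
  have 2: "of_nat (u * j) * (\<Sum>i=1..N. power_sum i * trunc_sum N (j - 1) l (s - int u - int i) f) =
      of_nat (u * j) * trunc_sum N j l (s - int u) f"
    by (cases j) (simp_all add: trunc_sum_Suc_left)
  have "power_sum_perp u (trunc_sum N (Suc j) l s f) =
      (\<Sum>i=1..N. power_sum_perp u (power_sum i * trunc_sum N j l (s - int i) f))"
    by (simp add: trunc_sum_Suc_left lin_sum[OF lin_power_sum_perp])
  also have "\<dots> = (\<Sum>i=1..N. power_sum i * trunc_sum N j l (s - int i) (power_sum_perp u f) +
      of_nat (u * j) * (power_sum i * trunc_sum N (j - 1) l (s - int u - int i) f) +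
      (if i = u then of_nat u * trunc_sum N j l (s - int u) f else 0))"
    by (intro sum.cong refl 1)
  also have "\<dots> = trunc_sum N (Suc j) l s (power_sum_perp u f) +
      of_nat (u * j) * trunc_sum N j l (s - int u) f + of_nat u * trunc_sum N j l (s - int u) f"
    unfolding sum.distrib sum_distrib_left[symmetric] 2
    using assms by (simp add: trunc_sum_Suc_left)
  finally show ?case by (simp add: algebra_simps)
qed

lemma trunc_sum_power_sum_commute:
  assumes "u \<ge> 1" "u \<le> N"
  shows "power_sum u * trunc_sum N j l s f = trunc_sum N j l s (power_sum u * f) -
    of_nat (u * l) * trunc_sum N j (l - 1) (s + int u) f"
proof (induction j arbitrary: s)
  case 0
  show ?case
  proof (induction l arbitrary: s f)
    case 0
    show ?case by (simp add: trunc_sum_0_0)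
  next
    case (Suc l)
    note T = lin_trunc_sum[of N 0 l]
    have 1: "trunc_sum N 0 l (s + int i) (power_sum_perp i (power_sum u * f)) =
        power_sum u * trunc_sum N 0 l (s + int i) (power_sum_perp i f) +
        of_nat (u * l) * trunc_sum N 0 (l - 1) (s + int u + int i) (power_sum_perp i f) +
        (if i = u then of_nat u * trunc_sum N 0 l (s + int u) f else 0)"
      if "i \<in> {1..N}" for i
    proof -
      have "trunc_sum N 0 l (s + int i) (power_sum_perp i (power_sum u * f)) =
          trunc_sum N 0 l (s + int i) (power_sum u * power_sum_perp i f) +
          (if i = u then of_nat u * trunc_sum N 0 l (s + int u) f else 0)"
        using that assms
        by (simp add: power_sum_perp_power_sum_mult lin_add[OF T] lin_of_nat[OF T] lin_zero[OF T])
      with Suc[of "s + int i" "power_sum_perp i f"] show ?thesis by (simp add: algebra_simps)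
    qed
    have 2: "of_nat (u * l) *
        (\<Sum>i=1..N. trunc_sum N 0 (l - 1) (s + int u + int i) (power_sum_perp i f)) =
        of_nat (u * l) * trunc_sum N 0 l (s + int u) f"
      by (cases l) (simp_all add: trunc_sum_Suc_right)
    have "trunc_sum N 0 (Suc l) s (power_sum u * f) =
        (\<Sum>i=1..N. power_sum u * trunc_sum N 0 l (s + int i) (power_sum_perp i f) +
        of_nat (u * l) * trunc_sum N 0 (l - 1) (s + int u + int i) (power_sum_perp i f) +
        (if i = u then of_nat u * trunc_sum N 0 l (s + int u) f else 0))"
      unfolding trunc_sum_Suc_right by (intro sum.cong refl 1)
    also have "\<dots> = power_sum u * trunc_sum N 0 (Suc l) s f +
      of_nat (u * l) * trunc_sum N 0 l (s + int u) f + of_nat u * trunc_sum N 0 l (s + int u) f"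
      unfolding sum.distrib sum_distrib_left[symmetric] 2
      using assms by (simp add: trunc_sum_Suc_right)
    finally show ?case by (simp add: algebra_simps)
  qed
next
  case (Suc j)
  have "power_sum u * trunc_sum N (Suc j) l s f =
      (\<Sum>i=1..N. power_sum i * (power_sum u * trunc_sum N j l (s - int i) f))"
    by (simp add: trunc_sum_Suc_left sum_distrib_left mult.left_commute)
  also have "\<dots> = trunc_sum N (Suc j) l s (power_sum u * f) -
    of_nat (u * l) * trunc_sum N (Suc j) (l - 1) (s + int u) f"
    unfolding Suc trunc_sum_Suc_left
    by (simp add: right_diff_distrib sum_subtractf sum_distrib_left mult.left_commute
        algebra_simps)
  finally show ?case .
qed

subsection \<open>The full sums\<close>

definition normal_sum :: "nat \<Rightarrow> nat \<Rightarrow> int \<Rightarrow> 'a::field_char_0 symfun \<Rightarrow> 'a symfun" where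
  "normal_sum j l s = op_sum (\<lambda>(as, bs) g. power_sums as * power_sums_perp bs g)
     {(as, bs). length as = j \<and> length bs = l \<and> (\<forall>a\<in>set as. a \<ge> 1) \<and> (\<forall>b\<in>set bs. b \<ge> 1) \<and>
        int (sum_list as) = int (sum_list bs) + s}"

text \<open>
  If the term of \<open>(as, bs)\<close> does not vanish on an \<open>f\<close> of degree \<open>d\<close>, then the parts of \<open>bs\<close> sum up to at
  most \<open>d\<close>, and those of \<open>as\<close> to at most \<open>d + s\<close>.
\<close>
lemma normal_sum_eq_trunc_sum:
  assumes f: "weight_le d f" and N: "N \<ge> d + nat \<bar>s\<bar>"
  shows "normal_sum j l s f = trunc_sum N j l s f"
proof -
  let ?I = "{(as, bs). length as = j \<and> length bs = l \<and> (\<forall>a\<in>set as. a \<ge> 1) \<and>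
    (\<forall>b\<in>set bs. b \<ge> 1) \<and> int (sum_list as) = int (sum_list bs) + s}"
  let ?F = "\<lambda>(as, bs). power_sums as * power_sums_perp bs f"
  have le: "x \<le> sum_list xs" if "x \<in> set xs" for x and xs :: "nat list"
    using that by (intro member_le_sum_list) auto
  have supp: "as \<in> pos_lists N j \<and> bs \<in> pos_lists N l"
    if I: "(as, bs) \<in> ?I" and nz: "?F (as, bs) \<noteq> 0" for as bs
  proof -
    have "power_sums_perp bs f \<noteq> 0" using nz by auto
    then have bs: "sum_list bs \<le> d"
      using weight_le_power_sums_perp[OF f, of bs] I by force
    then have as: "sum_list as \<le> N" using I N by auto
    have "x \<le> N" if "x \<in> set as" for x using le[OF that] as by simp
    moreover have "x \<le> N" if "x \<in> set bs" for x using le[OF that] bs N by simp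
    ultimately show ?thesis using I by (auto simp: pos_lists_def)
  qed
  have "normal_sum j l s f = sum ?F {i \<in> ?I. ?F i \<noteq> 0}"
    by (simp add: normal_sum_def op_sum_def case_prod_unfold)
  also have "\<dots> = sum ?F {i \<in> pos_lists N j \<times> pos_lists N l.
      int (sum_list (fst i)) = int (sum_list (snd i)) + s}"
  proof (rule sum.mono_neutral_left)
    show "{i \<in> ?I. ?F i \<noteq> 0} \<subseteq> {i \<in> pos_lists N j \<times> pos_lists N l.
      int (sum_list (fst i)) = int (sum_list (snd i)) + s}"
      using supp by auto
    show "finite {i \<in> pos_lists N j \<times> pos_lists N l.
      int (sum_list (fst i)) = int (sum_list (snd i)) + s}"
      by simp
  qed (auto simp: pos_lists_def)
  also have "\<dots> = trunc_sum N j l s f"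
    by (simp add: trunc_sum_def sum.cartesian_product case_prod_unfold sum.inter_filter)
  finally show ?thesis .
qed

lemma eventually_normal_sum:
  "eventually (\<lambda>N. normal_sum j l s f = trunc_sum N j l s f) sequentially"
proof -
  obtain d where "weight_le d f" using weight_le_exists by blast
  from eventually_ge_at_top[of "d + nat \<bar>s\<bar>"] show ?thesis
    by eventually_elim (rule normal_sum_eq_trunc_sum[OF \<open>weight_le d f\<close>])
qed

lemma lin_normal_sum: "lin (normal_sum j l s)"
proof (rule linI)
  fix f g :: "'a symfun"
  have "eventually (\<lambda>N. normal_sum j l s (f + g) = normal_sum j l s f + normal_sum j l s g) sequentially"
    using eventually_normal_sum[of j l s "f + g"] eventually_normal_sum[of j l s f]
      eventually_normal_sum[of j l s g]
    by eventually_elim (simp add: lin_add[OF lin_trunc_sum])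
  then show "normal_sum j l s (f + g) = normal_sum j l s f + normal_sum j l s g" by simp
next
  fix c and f :: "'a symfun"
  have "eventually (\<lambda>N. normal_sum j l s (smul c f) = smul c (normal_sum j l s f)) sequentially"
    using eventually_normal_sum[of j l s "smul c f"] eventually_normal_sum[of j l s f]
    by eventually_elim (simp add: lin_smul[OF lin_trunc_sum])
  then show "normal_sum j l s (smul c f) = smul c (normal_sum j l s f)" by simp
qed

lemma normal_sum_perp_commute:
  assumes "u \<ge> 1"
  shows "power_sum_perp u (normal_sum j l s f) = normal_sum j l s (power_sum_perp u f) +
    of_nat (u * j) * normal_sum (j - 1) l (s - int u) f"
proof -
  have "eventually (\<lambda>N. power_sum_perp u (normal_sum j l s f) =
      normal_sum j l s (power_sum_perp u f) +
      of_nat (u * j) * normal_sum (j - 1) l (s - int u) f) sequentially"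
    using eventually_normal_sum[of j l s f] eventually_normal_sum[of j l s "power_sum_perp u f"]
      eventually_normal_sum[of "j - 1" l "s - int u" f] eventually_ge_at_top[of u]
    by eventually_elim (simp only: trunc_sum_perp_commute assms)
  then show ?thesis by simp
qed

lemma normal_sum_power_sum_commute:
  assumes "u \<ge> 1"
  shows "power_sum u * normal_sum j l s f = normal_sum j l s (power_sum u * f) -
    of_nat (u * l) * normal_sum j (l - 1) (s + int u) f"
proof -
  have "eventually (\<lambda>N. power_sum u * normal_sum j l s f = normal_sum j l s (power_sum u * f) -
      of_nat (u * l) * normal_sum j (l - 1) (s + int u) f) sequentially"
    using eventually_normal_sum[of j l s f] eventually_normal_sum[of j l s "power_sum u * f"]
      eventually_normal_sum[of j "l - 1" "s + int u" f] eventually_ge_at_top[of u]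
    by eventually_elim (simp only: trunc_sum_power_sum_commute assms)
  then show ?thesis by simp
qed

lemma power_sums_perp_one:
  assumes "\<forall>b\<in>set bs. b \<ge> 1" shows "power_sums_perp bs 1 = (if bs = [] then 1 else 0)"
  using assms by (induction bs) (auto simp: power_sums_perp_Cons lin_zero[OF lin_power_sum_perp])

lemma normal_sum_one: "l > 0 \<Longrightarrow> normal_sum j l s 1 = 0"
  unfolding normal_sum_def op_sum_def
  by (intro sum.neutral) (auto simp: power_sums_perp_one split: if_splits)

lemma lookup_0_normal_sum:
  assumes "j > 0" shows "Poly_Mapping.lookup (normal_sum j l s f) 0 = 0"
proof -
  have *: "Poly_Mapping.lookup (power_sums as * g) 0 = 0"
    if "length as = j" "\<forall>a\<in>set as. 1 \<le> a" for as g
    using that \<open>j > 0\<close> by (cases as) (auto simp: power_sums_Cons mult.assoc)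
  then show ?thesis unfolding normal_sum_def op_sum_def lookup_sum
    by (intro sum.neutral) auto
qed

lemma sum_list_eq_0_pos: "\<forall>a\<in>set xs. a \<ge> (1::nat) \<Longrightarrow> sum_list xs = 0 \<longleftrightarrow> xs = []"
  by (cases xs) auto

lemma normal_sum_0_left:
  assumes "l > 0" "s \<ge> 0" shows "normal_sum 0 l s f = 0"
proof -
  have "{(as, bs). length as = 0 \<and> length bs = l \<and> (\<forall>a\<in>set as. a \<ge> 1) \<and> (\<forall>b\<in>set bs. b \<ge> 1) \<and>
      int (sum_list as) = int (sum_list bs) + s} = {}"
    using assms sum_list_eq_0_pos by fastforce
  note empty = this
  show ?thesis unfolding normal_sum_def op_sum_def empty by simp
qed

lemma normal_sum_0_right:
  assumes "j > 0" shows "normal_sum j 0 0 f = 0"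
proof -
  have "{(as, bs). length as = j \<and> length bs = 0 \<and> (\<forall>a\<in>set as. a \<ge> 1) \<and> (\<forall>b\<in>set bs. b \<ge> 1) \<and>
      int (sum_list as) = int (sum_list bs) + 0} = {}"
    using assms sum_list_eq_0_pos by fastforce
  note empty = this
  show ?thesis unfolding normal_sum_def op_sum_def empty by simp
qed

lemma normal_sum_negative:
  assumes "weight_le d f" "int d + s < 0"
  shows "normal_sum j l s f = 0"
  unfolding normal_sum_def op_sum_def
proof (intro sum.neutral ballI, clarify)
  fix as bs
  assume bs: "\<forall>b\<in>set bs. 1 \<le> b" and eq: "int (sum_list as) = int (sum_list bs) + s"
  have "\<not> sum_list bs \<le> d" using eq assms(2) by linarith
  then show "power_sums as * power_sums_perp bs f = 0"
    using weight_le_power_sums_perp[OF assms(1) bs] by simp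
qed

text \<open>
  The coefficient of \<open>z\<^sup>s\<close> in \<open>:(P + Q)\<^sup>m:\<close>, where \<open>P = \<Sum> p\<^sub>i z\<^sup>i\<close>, \<open>Q = \<Sum> p\<^sub>i\<^sup>\<bottom> z\<^sup>-\<^sup>i\<close> and normal ordering puts
  all factors \<open>P\<close> to the left.
\<close>
definition normal_power :: "nat \<Rightarrow> int \<Rightarrow> 'a::field_char_0 symfun \<Rightarrow> 'a symfun" where
  "normal_power m s f = (\<Sum>j\<le>m. of_nat (m choose j) * normal_sum j (m - j) s f)"

lemma lin_normal_power: "lin (normal_power m s)"
  unfolding normal_power_def[abs_def]
  by (intro lin_family_sum) (auto intro!: lin_times lin_normal_sum)

lemma normal_power_0: "normal_power 0 s f = (if s = 0 then f else 0)"
proof -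
  have "eventually (\<lambda>N. normal_power 0 s f = (if s = 0 then f else 0)) sequentially"
    using eventually_normal_sum[of 0 0 s f]
    by eventually_elim (simp add: normal_power_def trunc_sum_0_0)
  then show ?thesis by simp
qed

lemma normal_power_1: "normal_power 1 s f = heis s f"
proof -
  have "eventually (\<lambda>N. normal_power 1 s f = heis s f) sequentially"
    using eventually_normal_sum[of 1 0 s f] eventually_normal_sum[of 0 1 s f]
      eventually_ge_at_top[of "nat \<bar>s\<bar>"]
  proof eventually_elim
    case (elim N)
    have 1: "trunc_sum N 1 0 s f = (\<Sum>i=1..N. if nat s = i then power_sum (nat s) * f else 0)"
      unfolding One_nat_def trunc_sum_Suc_left trunc_sum_0_0 by (intro sum.cong) auto
    have 2: "trunc_sum N 0 1 s f = (\<Sum>i=1..N. if nat (-s) = i then power_sum_perp (nat (-s)) f else 0)"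
      unfolding One_nat_def trunc_sum_Suc_right trunc_sum_0_0 by (intro sum.cong) auto
    have "normal_power 1 s f = trunc_sum N 0 1 s f + trunc_sum N 1 0 s f"
      by (simp add: normal_power_def elim[simplified])
    also have "\<dots> = heis s f"
      unfolding 1 2 using elim(3) by (auto simp: heis_def)
    finally show ?case .
  qed
  then show ?thesis by simp
qed

text \<open>
  Commuting with \<open>a\<^sub>u\<close> contracts it with any one of the \<open>m\<close> factors. All later computations with
  \<open>normal_power\<close> rest on this formula.
\<close>
lemma normal_power_commute:
  "heis u (normal_power m s f) =
     normal_power m s (heis u f) - of_int (u * int m) * normal_power (m - 1) (s + u) f"
proof (cases m)
  case 0
  then show ?thesis by (simp add: normal_power_0 lin_zero[OF lin_heis])
next
  case (Suc n)
  show ?thesis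
  proof (cases u rule: int_cases_signed)
    case (pos r)
    note r = pos(1) and u = pos(2)
    have c: "of_nat (m choose j) * (power_sum r * normal_sum j (m - j) s f) =
        of_nat (m choose j) * normal_sum j (m - j) s (power_sum r * f) -
        of_nat r * of_nat m * (of_nat (n choose j) * normal_sum j (n - j) (s + u) f)" for j
    proof -
      have nat_eq: "(m choose j) * (r * (m - j)) = r * (m * (n choose j))"
        using binomial_absorb_comp[of m j] Suc by (simp add: mult_ac)
      have "of_nat (m choose j) * (power_sum r * normal_sum j (m - j) s f) =
          of_nat (m choose j) * normal_sum j (m - j) s (power_sum r * f) -
          of_nat ((m choose j) * (r * (m - j))) * normal_sum j (m - j - 1) (s + int r) f"
        unfolding normal_sum_power_sum_commute[OF r] right_diff_distrib of_nat_mult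
        by (simp only: mult.assoc)
      then show ?thesis unfolding nat_eq of_nat_mult u by (simp add: Suc mult.assoc)
    qed
    have *: "(\<Sum>j\<le>m. of_nat (n choose j) * normal_sum j (n - j) (s + u) f) = normal_power n (s + u) f"
      by (simp add: normal_power_def Suc)
    have "heis u (normal_power m s f) =
        (\<Sum>j\<le>m. of_nat (m choose j) * (power_sum r * normal_sum j (m - j) s f))"
      by (simp add: u heis_int[OF r] normal_power_def sum_distrib_left mult.left_commute)
    also have "\<dots> = normal_power m s (heis u f) - of_nat r * of_nat m * normal_power n (s + u) f"
      unfolding c sum_subtractf sum_distrib_left[symmetric] *
      by (simp add: normal_power_def[of m] heis_int[OF r] u)
    finally show ?thesis by (simp add: u Suc)
  next
    case (neg r)
    note r = neg(1) and u = neg(2)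
    have c: "of_nat (m choose j) * power_sum_perp r (normal_sum j (m - j) s f) =
        of_nat (m choose j) * normal_sum j (m - j) s (power_sum_perp r f) +
        of_nat r * (of_nat (j * (m choose j)) * normal_sum (j - 1) (m - j) (s + u) f)" for j
      by (simp add: normal_sum_perp_commute[OF r] u algebra_simps)
    have "(\<Sum>j\<le>m. of_nat (j * (m choose j)) * normal_sum (j - 1) (m - j) (s + u) f) =
        (\<Sum>j\<le>n. of_nat (Suc j * (Suc n choose Suc j)) * normal_sum j (n - j) (s + u) f)"
      unfolding Suc by (subst sum.atMost_Suc_shift) simp
    also have "\<dots> = of_nat m * normal_power n (s + u) f"
      by (simp only: Suc_times_binomial normal_power_def Suc sum_distrib_left of_nat_mult mult.assoc)
    finally have *: "(\<Sum>j\<le>m. of_nat (j * (m choose j)) * normal_sum (j - 1) (m - j) (s + u) f) =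
        of_nat m * normal_power n (s + u) f" .
    have "heis u (normal_power m s f) =
        (\<Sum>j\<le>m. of_nat (m choose j) * power_sum_perp r (normal_sum j (m - j) s f))"
      by (simp add: u heis_minus_int[OF r] normal_power_def lin_sum[OF lin_power_sum_perp]
          lin_of_nat[OF lin_power_sum_perp])
    also have "\<dots> = normal_power m s (heis u f) + of_nat r * (of_nat m * normal_power n (s + u) f)"
      unfolding c sum.distrib *[symmetric]
      by (simp add: normal_power_def[of m] heis_minus_int[OF r] u sum_distrib_left del: of_nat_mult)
    finally show ?thesis by (simp add: u Suc)
  qed (simp add: lin_zero[OF lin_normal_power])
qed

lemma lookup_0_normal_power_one:
  assumes "m \<ge> 1" shows "Poly_Mapping.lookup (normal_power m s 1) 0 = 0"
proof -
  have "Poly_Mapping.lookup (normal_sum j (m - j) s 1) 0 = 0" if "j \<le> m" for j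
    using assms that by (cases "j = 0") (auto simp: normal_sum_one lookup_0_normal_sum)
  then show ?thesis
    by (auto simp: normal_power_def lookup_sum simp flip: smul_of_nat intro!: sum.neutral)
qed

lemma lookup_0_normal_power:
  assumes "m \<ge> 1" "s \<ge> 0" shows "Poly_Mapping.lookup (normal_power m s f) 0 = 0"
proof -
  have "Poly_Mapping.lookup (normal_sum j (m - j) s f) 0 = 0" if "j \<le> m" for j
    using assms that by (cases "j = 0") (auto simp: normal_sum_0_left lookup_0_normal_sum)
  then show ?thesis
    by (auto simp: normal_power_def lookup_sum simp flip: smul_of_nat intro!: sum.neutral)
qed

lemma normal_power_0_one:
  assumes "m \<ge> 1" shows "normal_power m 0 1 = 0"
proof -
  have "normal_sum j (m - j) 0 1 = 0" if "j \<le> m" for j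
    using assms that by (cases "j = m") (auto simp: normal_sum_one normal_sum_0_right)
  then show ?thesis by (auto simp: normal_power_def intro!: sum.neutral)
qed

lemma normal_power_negative: "weight_le d f \<Longrightarrow> int d + s < 0 \<Longrightarrow> normal_power m s f = 0"
  by (auto simp: normal_power_def normal_sum_negative intro!: sum.neutral)

section \<open>Commutators and the order filtration\<close>

definition commutator ::
  "('a::field_char_0 symfun \<Rightarrow> 'a symfun) \<Rightarrow> ('a symfun \<Rightarrow> 'a symfun) \<Rightarrow> 'a symfun \<Rightarrow> 'a symfun" where
  "commutator S T f = S (T f) - T (S f)"

lemma lin_commutator: "lin S \<Longrightarrow> lin T \<Longrightarrow> lin (commutator S T)"
  unfolding commutator_def[abs_def] by (intro lin_minus lin_comp[of S T] lin_comp[of T S])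

lemma commutator_jacobi:
  assumes "lin R" "lin S" "lin T"
  shows "commutator R (commutator S T) =
    (\<lambda>f. commutator (commutator R S) T f + commutator S (commutator R T) f)"
  by (simp add: fun_eq_iff commutator_def assms[THEN lin_diff])

lemma commutator_plus: "lin S \<Longrightarrow> commutator S (\<lambda>f. T f + R f) = (\<lambda>f. commutator S T f + commutator S R f)"
  and commutator_scale: "lin S \<Longrightarrow> commutator S (\<lambda>f. smul c (T f)) = (\<lambda>f. smul c (commutator S T f))"
  and commutator_const_0: "lin S \<Longrightarrow> commutator S (\<lambda>f. 0) = (\<lambda>f. 0)"
  and commutator_scale_left: "lin T \<Longrightarrow> commutator (\<lambda>f. smul c (S f)) T = (\<lambda>f. smul c (commutator S T f))"
  by (simp_all add: fun_eq_iff commutator_def lin_add lin_smul lin_zero symfun.scale_right_diff_distrib)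

lemma commutator_heis_normal_power:
  "commutator (heis u) (normal_power m s) =
    (\<lambda>f. smul (of_int (- u * int m)) (normal_power (m - 1) (s + u) f))"
  by (simp only: fun_eq_iff commutator_def normal_power_commute smul_of_int) simp

text \<open>
  For normally ordered operators the order is the largest total number of factors \<open>p\<^sub>i\<close> and \<open>p\<^sub>i\<^sup>\<bottom>\<close> in a
  term. Defining it by commutators makes it available before any expansion is known, and properties
  of commutators follow by induction from the Jacobi identity.
\<close>
primrec order_lt :: "nat \<Rightarrow> ('a::field_char_0 symfun \<Rightarrow> 'a symfun) \<Rightarrow> bool" where
  "order_lt 0 T \<longleftrightarrow> T = (\<lambda>f. 0)"
| "order_lt (Suc n) T \<longleftrightarrow> lin T \<and> (\<forall>u. order_lt n (commutator (heis u) T))"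

lemma order_lt_SucI:
  "lin T \<Longrightarrow> (\<And>u. order_lt n (commutator (heis u) T)) \<Longrightarrow> order_lt (Suc n) T"
  by simp

lemma order_lt_const_0: "order_lt n (\<lambda>f. 0)"
  by (induction n) (simp_all add: lin_const_0 commutator_const_0[OF lin_heis])

lemma order_lt_plus: "order_lt n S \<Longrightarrow> order_lt n T \<Longrightarrow> order_lt n (\<lambda>f. S f + T f)"
  by (induction n arbitrary: S T) (auto simp: lin_plus commutator_plus[OF lin_heis])

lemma order_lt_scale: "order_lt n T \<Longrightarrow> order_lt n (\<lambda>f. smul c (T f))"
  by (induction n arbitrary: T) (auto simp: lin_scale commutator_scale[OF lin_heis])

lemma order_lt_commutator_heis: "order_lt n T \<Longrightarrow> order_lt (n - 1) (commutator (heis u) T)"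
  by (cases n) (simp_all add: commutator_const_0[OF lin_heis])

text \<open>
  A contraction removes one factor from each of the two operators, so commuting with an operator of order
  \<open>m\<close> raises the order by at most \<open>m - 2\<close>.
\<close>
lemma order_lt_commutator_quadratic:
  "order_lt n T \<Longrightarrow> order_lt n (commutator (normal_power 2 t) T)"
proof (induction n arbitrary: T)
  case 0
  then show ?case by (simp add: commutator_const_0[OF lin_normal_power])
next
  case (Suc n)
  then have T: "lin T" by simp
  have "order_lt n (commutator (heis u) (commutator (normal_power 2 t) T))" for u
  proof -
    have V: "normal_power (2 - 1) s = (heis s :: 'a symfun \<Rightarrow> _)" for s
      by (simp add: fun_eq_iff normal_power_1[simplified])
    have "order_lt n (\<lambda>f. smul (of_int (- u * int 2)) (commutator (heis (t + u)) T f) +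
      commutator (normal_power 2 t) (commutator (heis u) T) f)"
      using Suc by (intro order_lt_plus order_lt_scale Suc.IH) auto
    then show ?thesis
      unfolding commutator_jacobi[OF lin_heis lin_normal_power T]
        commutator_heis_normal_power commutator_scale_left[OF T] V .
  qed
  with T show ?case by (simp add: lin_commutator lin_normal_power)
qed

lemma order_lt_commutator_cubic:
  "order_lt n T \<Longrightarrow> order_lt (Suc n) (commutator (normal_power 3 t) T)"
proof (induction n arbitrary: T)
  case 0
  then show ?case by (simp add: commutator_const_0 lin_normal_power lin_heis lin_const_0)
next
  case (Suc n)
  then have T: "lin T" by simp
  have "order_lt (Suc n) (commutator (heis u) (commutator (normal_power 3 t) T))" for u
  proof -
    have V: "normal_power (3 - 1) s = (normal_power 2 s :: 'a symfun \<Rightarrow> _)" for s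
      by simp
    have "order_lt (Suc n) (\<lambda>f. smul (of_int (- u * int 3)) (commutator (normal_power 2 (t + u)) T f) +
      commutator (normal_power 3 t) (commutator (heis u) T) f)"
      using Suc by (intro order_lt_plus order_lt_scale Suc.IH order_lt_commutator_quadratic) auto
    then show ?thesis
      unfolding commutator_jacobi[OF lin_heis lin_normal_power T]
        commutator_heis_normal_power commutator_scale_left[OF T] V .
  qed
  then show ?case using T by (subst order_lt.simps) (simp add: lin_commutator lin_normal_power del: order_lt.simps)
qed

text \<open>
  Classically, \<open>V 2 t / 2\<close> acts on \<open>\<phi>(z)\<close> by the derivation \<open>z\<^sup>-\<^sup>t (\<theta> - t)\<close>. Applied to \<open>\<phi>\<^sup>m\<close> this gives
  \<open>z\<^sup>-\<^sup>t (\<theta> - m t) \<phi>\<^sup>m\<close>, whose coefficient at \<open>z\<^sup>s\<close> is that of \<open>\<phi>\<^sup>m\<close> at \<open>z\<^sup>s\<^sup>+\<^sup>t\<close>, times \<open>s + t - m t\<close>. The error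
  term for \<open>m\<close> has commutator \<open>- u m\<close> times the error term for \<open>m - 1\<close> with \<open>a\<^sub>u\<close>, and for \<open>m = 0\<close> it is
  zero.
\<close>
lemma commutator_quadratic_normal_power:
  "order_lt m (\<lambda>f. commutator (normal_power 2 t) (normal_power m s) f -
     of_int (2 * (s + t - int m * t)) * normal_power m (s + t) f)"
proof (induction m arbitrary: s)
  case 0
  show ?case
    by (cases "t = - s")
      (auto simp: fun_eq_iff commutator_def normal_power_0 lin_zero[OF lin_normal_power] add_eq_0_iff)
next
  case (Suc m)
  let ?E = "\<lambda>m s (f :: 'a symfun). commutator (normal_power 2 t) (normal_power m s) f -
     of_int (2 * (s + t - int m * t)) * normal_power m (s + t) f"
  note lins = lin_diff[OF lin_normal_power] lin_of_int[OF lin_normal_power]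
    lin_diff[OF lin_heis] lin_of_int[OF lin_heis]
  have "commutator (heis u) (?E (Suc m) s) = (\<lambda>f. smul (of_int (- u * int (Suc m))) (?E m (s + u) f))" for u
  proof (rule ext)
    fix f :: "'a symfun"
    have V1: "normal_power (Suc 0) v = (heis v :: 'a symfun \<Rightarrow> _)" for v
      by (simp add: fun_eq_iff normal_power_1[simplified])
    show "commutator (heis u) (?E (Suc m) s) f = smul (of_int (- u * int (Suc m))) (?E m (s + u) f)"
      by (simp only: commutator_def normal_power_commute lins smul_of_int)
        (simp add: V1 normal_power_commute algebra_simps)
  qed
  note bracket = this
  have "lin (?E (Suc m) s)"
    by (intro lin_minus lin_times lin_commutator lin_normal_power)
  then show ?case
    by (rule order_lt_SucI) (unfold bracket, rule order_lt_scale[OF Suc])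
qed

text \<open>
  The factor \<open>6\<close> clears the denominator of \<open>D = V 3 0 / 6\<close>. The commutator of the error term with \<open>a\<^sub>u\<close> is a
  combination of the error term for \<open>m - 1\<close> and of the error term of the quadratic commutator with
  \<open>V 2 u\<close>, because \<open>[a\<^sub>u, V 3 0]\<close> is a multiple of \<open>V 2 u\<close>.
\<close>
lemma commutator_cubic_normal_power:
  "order_lt (Suc m) (\<lambda>f. of_nat (Suc m) * commutator (normal_power 3 0) (normal_power m s) f -
     of_int (6 * int m * s) * normal_power (Suc m) s f)"
proof (induction m arbitrary: s)
  case 0
  have "(\<lambda>f. of_nat (Suc 0) * commutator (normal_power 3 0) (normal_power 0 s) f -
     of_int (6 * int 0 * s) * normal_power (Suc 0) s f) = (\<lambda>f. 0 :: 'a symfun)"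
    by (auto simp: fun_eq_iff commutator_def normal_power_0 lin_zero[OF lin_normal_power])
  then show ?case by (simp only: order_lt_const_0)
next
  case (Suc m)
  let ?E = "\<lambda>m s (f :: 'a symfun). of_nat (Suc m) * commutator (normal_power 3 0) (normal_power m s) f -
     of_int (6 * int m * s) * normal_power (Suc m) s f"
  let ?Q = "\<lambda>m t s (f :: 'a symfun). commutator (normal_power 2 t) (normal_power m s) f -
     of_int (2 * (s + t - int m * t)) * normal_power m (s + t) f"
  note lins = lin_diff[OF lin_normal_power] lin_of_int[OF lin_normal_power]
    lin_diff[OF lin_heis] lin_of_int[OF lin_heis] lin_of_nat[OF lin_heis]
  have "commutator (heis u) (?E (Suc m) s) =
     (\<lambda>f. smul (of_int (- u * int (m + 2))) (?E m (s + u) f + smul 3 (?Q (Suc m) u s f)))" for u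
  proof (rule ext)
    fix f :: "'a symfun"
    show "commutator (heis u) (?E (Suc m) s) f =
        smul (of_int (- u * int (m + 2))) (?E m (s + u) f + smul 3 (?Q (Suc m) u s f))"
      by (simp only: commutator_def normal_power_commute lins smul_of_int smul_numeral)
        (simp add: algebra_simps)
  qed
  note bracket = this
  have "lin (?E (Suc m) s)"
    by (intro lin_minus lin_times lin_commutator lin_normal_power)
  then show ?case
    by (rule order_lt_SucI)
      (unfold bracket, intro order_lt_scale order_lt_plus Suc commutator_quadratic_normal_power)
qed

text \<open>
  Written out, this is \<open>\<Sum> (p\<^sub>i p\<^sub>j p\<^sub>i\<^sub>+\<^sub>j\<^sup>\<bottom> + p\<^sub>i\<^sub>+\<^sub>j p\<^sub>i\<^sup>\<bottom> p\<^sub>j\<^sup>\<bottom>) / 2\<close> over all \<open>i, j \<ge> 1\<close>.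
\<close>
definition cut_join :: "'a::field_char_0 symfun \<Rightarrow> 'a symfun" where
  "cut_join f = smul (1 / 6) (normal_power 3 0 f)"

lemma lin_cut_join: "lin cut_join"
  unfolding cut_join_def[abs_def] by (intro lin_scale lin_normal_power)

definition ad_cut_join :: "nat \<Rightarrow> 'a::field_char_0 symfun \<Rightarrow> 'a symfun" where
  "ad_cut_join k = (commutator cut_join ^^ k) (heis 1)"

lemma ad_cut_join_0: "ad_cut_join 0 = heis 1"
  and ad_cut_join_Suc: "ad_cut_join (Suc k) = commutator cut_join (ad_cut_join k)"
  by (simp_all add: ad_cut_join_def)

lemma lin_ad_cut_join: "lin (ad_cut_join k)"
  by (induction k) (simp_all add: ad_cut_join_0 ad_cut_join_Suc lin_heis lin_commutator lin_cut_join)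

lemma ad_cut_join_leading_term:
  "order_lt (Suc k) (\<lambda>f. ad_cut_join k f - smul (1 / of_nat (Suc k)) (normal_power (Suc k) 1 f))"
proof (induction k)
  case 0
  have "(\<lambda>f. ad_cut_join 0 f - smul (1 / of_nat (Suc 0)) (normal_power (Suc 0) 1 f)) =
      (\<lambda>f. 0 :: 'a symfun)"
    by (simp add: ad_cut_join_0 fun_eq_iff normal_power_1[simplified])
  then show ?case by (simp only: order_lt_const_0)
next
  case (Suc k)
  let ?R = "\<lambda>f. ad_cut_join k f - smul (1 / of_nat (Suc k)) (normal_power (Suc k) 1 f)"
  let ?E = "\<lambda>f. of_nat (Suc (Suc k)) * commutator (normal_power 3 0) (normal_power (Suc k) 1) f -
     of_int (6 * int (Suc k) * 1) * normal_power (Suc (Suc k)) 1 f"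
  let ?c = "1 / (6 * of_nat (Suc k) * of_nat (Suc (Suc k))) :: 'a"
  have "ad_cut_join (Suc k) f - smul (1 / of_nat (Suc (Suc k))) (normal_power (Suc (Suc k)) 1 f) =
      smul (1 / 6) (commutator (normal_power 3 0) ?R f) + smul ?c (?E f)" for f
  proof -
    let ?W = "normal_power (Suc (Suc k)) 1 f"
    have 1: "ad_cut_join (Suc k) f = smul (1/6) (commutator (normal_power 3 0) (ad_cut_join k) f)"
      by (simp add: ad_cut_join_Suc cut_join_def commutator_def lin_smul[OF lin_ad_cut_join]
          symfun.scale_right_diff_distrib)
    have 2: "commutator (normal_power 3 0) ?R f = commutator (normal_power 3 0) (ad_cut_join k) f -
        smul (1 / of_nat (Suc k)) (commutator (normal_power 3 0) (normal_power (Suc k) 1) f)"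
      by (simp add: commutator_def lin_diff[OF lin_normal_power] lin_smul[OF lin_normal_power]
          symfun.scale_right_diff_distrib)
    have of_int_6: "of_int (6 * int (Suc k)) = (6 * of_nat (Suc k) :: 'a)"
      by (simp only: of_int_mult of_int_of_nat_eq of_int_numeral)
    have 3: "smul ?c (?E f) =
        smul (1 / (6 * of_nat (Suc k))) (commutator (normal_power 3 0) (normal_power (Suc k) 1) f) -
        smul (1 / of_nat (Suc (Suc k))) ?W"
      by (simp add: symfun.scale_right_diff_distrib of_int_6 del: of_nat_Suc of_int_mult
          flip: smul_of_nat smul_of_int)
    show ?thesis unfolding 1 2 3 by (simp add: symfun.scale_right_diff_distrib)
  qed
  moreover have "order_lt (Suc (Suc k)) (\<lambda>f. smul (1 / 6) (commutator (normal_power 3 0) ?R f) + smul ?c (?E f))"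
    by (intro order_lt_plus order_lt_scale order_lt_commutator_cubic Suc
        commutator_cubic_normal_power)
  ultimately show ?case by (simp del: order_lt.simps)
qed

section \<open>Normally ordered expansions\<close>

subsection \<open>Partitions and normally ordered monomials\<close>

lemma is_partition_eqI:
  assumes "is_partition xs" "is_partition ys" "mset xs = mset ys"
  shows "xs = ys"
proof -
  have "sorted (rev xs)" "sorted (rev ys)"
    using assms(1,2) by (simp_all add: is_partition_def sorted_wrt_rev)
  then have "rev xs = rev ys"
    using assms(3) by (metis mset_rev properties_for_sort)
  then show ?thesis by simp
qed

lemma is_partition_rev_sort: "\<forall>a\<in>set as. a \<ge> 1 \<Longrightarrow> is_partition (rev (sort as))"
proof -
  assume "\<forall>a\<in>set as. a \<ge> 1"
  then have "0 \<notin> set (rev (sort as))" by auto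
  moreover have "sorted_wrt (\<ge>) (rev (sort as))" unfolding sorted_wrt_rev by (rule sorted_sort)
  ultimately show ?thesis unfolding is_partition_def by blast
qed

lemma sorted_wrt_remove1: "sorted_wrt P xs \<Longrightarrow> sorted_wrt P (remove1 k xs)"
proof (induction xs)
  case (Cons a xs)
  then show ?case using set_remove1_subset[of k xs] by auto
qed simp

lemma is_partition_remove1:
  assumes "is_partition xs" shows "is_partition (remove1 k xs)"
  unfolding is_partition_def
proof
  show "sorted_wrt (\<ge>) (remove1 k xs)"
    by (rule sorted_wrt_remove1) (use assms in \<open>simp add: is_partition_def\<close>)
  show "0 \<notin> set (remove1 k xs)"
    using assms set_remove1_subset[of k xs] unfolding is_partition_def by blast
qed

lemma Suc_length_remove1: "k \<in> set xs \<Longrightarrow> Suc (length (remove1 k xs)) = length xs"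
  by (induction xs) auto

lemma is_partition_ge_1: "is_partition xs \<Longrightarrow> \<forall>a\<in>set xs. a \<ge> 1"
  by (auto simp: is_partition_def Suc_le_eq intro: ccontr)

lemma power_sums_mset_eq: "mset as = mset bs \<Longrightarrow> power_sums as = power_sums bs"
  unfolding power_sums_def by (metis mset_map prod_mset_prod_list)

lemma power_sum_perp_power_sums_perp_remove1:
  assumes "k \<in> set bs" "\<forall>b\<in>set bs. b \<ge> 1"
  shows "power_sum_perp k (power_sums_perp (remove1 k bs) f) = power_sums_perp bs f"
  using assms
proof (induction bs)
  case (Cons b bs)
  then show ?case
    using power_sum_perp_commute[of k b "power_sums_perp (remove1 k bs) f"]
    by (auto simp: power_sums_perp_Cons)
qed simp

lemma power_sums_perp_power_sum_mult:
  assumes "k \<ge> 1" "\<forall>b\<in>set bs. b \<ge> 1"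
  shows "power_sums_perp bs (power_sum k * f) = power_sum k * power_sums_perp bs f +
    of_nat (k * count_list bs k) * power_sums_perp (remove1 k bs) f"
  using assms(2)
proof (induction bs)
  case (Cons b bs)
  from Cons have IH: "power_sums_perp bs (power_sum k * f) = power_sum k * power_sums_perp bs f +
      of_nat (k * count_list bs k) * power_sums_perp (remove1 k bs) f" by simp
  have *: "power_sums_perp (b # bs) (power_sum k * f) =
      power_sum k * power_sums_perp (b # bs) f + (if b = k then of_nat k * power_sums_perp bs f else 0) +
      of_nat (k * count_list bs k) * power_sum_perp b (power_sums_perp (remove1 k bs) f)"
    unfolding power_sums_perp_Cons IH lin_add[OF lin_power_sum_perp] lin_of_nat[OF lin_power_sum_perp]
    using assms(1) Cons.prems by (simp add: power_sum_perp_power_sum_mult)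
  show ?case
  proof (cases "b = k")
    case True
    have "of_nat (count_list bs k) * power_sum_perp b (power_sums_perp (remove1 k bs) f) =
        of_nat (count_list bs k) * power_sums_perp bs f"
      using power_sum_perp_power_sums_perp_remove1[of k bs f] Cons.prems True
      by (cases "k \<in> set bs") (auto simp: count_list_0_iff)
    with * show ?thesis using True by (simp add: algebra_simps)
  next
    case False
    then show ?thesis unfolding * by (simp add: power_sums_perp_Cons)
  qed
qed simp

lemma power_sum_perp_power_sums:
  assumes "k \<ge> 1" "\<forall>a\<in>set as. a \<ge> 1"
  shows "power_sum_perp k (power_sums as) = of_nat (k * count_list as k) * power_sums (remove1 k as)"
  using assms(2)
proof (induction as)
  case (Cons a as)
  have "of_nat (count_list as k) * (power_sum k * power_sums (remove1 k as)) =
      of_nat (count_list as k) * (power_sums as :: 'a symfun)"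
  proof (cases "k \<in> set as")
    case True
    then have "mset (k # remove1 k as) = mset as" by simp
    from power_sums_mset_eq[OF this, where 'a = 'a] show ?thesis by (simp add: power_sums_Cons)
  qed (simp add: count_list_0_iff)
  with Cons assms show ?case
    by (auto simp: power_sums_Cons power_sum_perp_power_sum_mult algebra_simps)
qed simp

definition normal_monomial :: "nat list \<Rightarrow> nat list \<Rightarrow> 'a::field_char_0 symfun \<Rightarrow> 'a symfun" where
  "normal_monomial ga al f = power_sums ga * power_sums_perp al f"

text \<open>
  Commutators with \<open>a\<^sub>k\<close> and \<open>a\<^sub>-\<^sub>k\<close> remove a factor \<open>p\<^sub>k\<^sup>\<bottom>\<close> and \<open>p\<^sub>k\<close>, respectively, from a normally
  ordered monomial, and they are non-zero exactly if this factor occurs. So a given monomial can be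
  taken apart completely.
\<close>
lemma commutator_power_sum_normal_monomial:
  assumes "k \<ge> 1" "is_partition al"
  shows "commutator (heis (int k)) (normal_monomial ga al) f =
    smul (- of_nat (k * count_list al k)) (normal_monomial ga (remove1 k al) f)"
  unfolding commutator_def normal_monomial_def heis_int[OF assms(1)]
    power_sums_perp_power_sum_mult[OF assms(1) is_partition_ge_1[OF assms(2)]]
  by (simp add: distrib_left mult.left_commute del: of_nat_mult flip: smul_of_nat)

lemma commutator_perp_normal_monomial:
  assumes "k \<ge> 1" "is_partition ga" "is_partition al"
  shows "commutator (heis (- int k)) (normal_monomial ga al) f =
    smul (of_nat (k * count_list ga k)) (normal_monomial (remove1 k ga) al f)"
  unfolding commutator_def normal_monomial_def heis_minus_int[OF assms(1)]
    power_sum_perp_mult[OF assms(1)] power_sum_perp_power_sums[OF assms(1) is_partition_ge_1[OF assms(2)]]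
    power_sums_perp_commute[OF assms(1) is_partition_ge_1[OF assms(3)]]
  by (simp del: of_nat_mult flip: smul_of_nat)

subsection \<open>Locally finite sums\<close>

lemma op_sum_eq_sum:
  assumes "finite A" "A \<subseteq> I" "\<And>i. i \<in> I \<Longrightarrow> i \<notin> A \<Longrightarrow> F i f = 0"
  shows "op_sum F I f = (\<Sum>i\<in>A. F i f)"
  unfolding op_sum_def using assms by (intro sum.mono_neutral_left) auto

lemma has_op_sumD:
  assumes "has_op_sum F I R" "finite A" "A \<subseteq> I" "{i \<in> I. F i f \<noteq> 0} \<subseteq> A"
  shows "R f = (\<Sum>i\<in>A. F i f)"
  using assms by (simp add: has_op_sum_def) (rule op_sum_eq_sum, auto)

lemma has_op_sum_commutator:
  assumes "has_op_sum F I R" "lin S"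
  shows "has_op_sum (\<lambda>i. commutator S (F i)) I (commutator S R)"
  unfolding has_op_sum_def
proof (intro conjI allI ext)
  fix f
  let ?A = "{i \<in> I. F i f \<noteq> 0} \<union> {i \<in> I. F i (S f) \<noteq> 0}"
  have fin: "finite ?A" using assms(1) by (auto simp: has_op_sum_def)
  have zero: "commutator S (F i) f = 0" if "i \<in> I" "i \<notin> ?A" for i
    using that by (auto simp: commutator_def lin_zero[OF assms(2)])
  then have "{i \<in> I. commutator S (F i) f \<noteq> 0} \<subseteq> ?A" by blast
  then show "finite {i \<in> I. commutator S (F i) f \<noteq> 0}" using fin finite_subset by blast
  have "R f = (\<Sum>i\<in>?A. F i f)" "R (S f) = (\<Sum>i\<in>?A. F i (S f))"
    using fin by (auto intro!: has_op_sumD[OF assms(1)])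
  then have "commutator S R f = (\<Sum>i\<in>?A. commutator S (F i) f)"
    by (simp only: commutator_def lin_sum[OF assms(2)] sum_subtractf)
  also have "\<dots> = op_sum (\<lambda>i. commutator S (F i)) I f"
    by (rule op_sum_eq_sum[symmetric]) (use fin zero in auto)
  finally show "commutator S R f = op_sum (\<lambda>i. commutator S (F i)) I f" .
qed

lemma has_op_sum_normal_term_diff:
  assumes "has_op_sum (normal_term c) I R" "has_op_sum (normal_term d) I T"
  shows "has_op_sum (normal_term (\<lambda>x. c x - d x)) I (\<lambda>f. R f - T f)"
  unfolding has_op_sum_def
proof (intro conjI allI ext)
  fix f
  let ?A = "{i \<in> I. normal_term c i f \<noteq> 0} \<union> {i \<in> I. normal_term d i f \<noteq> 0}"
  have fin: "finite ?A" using assms by (auto simp: has_op_sum_def)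
  have eq: "normal_term (\<lambda>x. c x - d x) i f = normal_term c i f - normal_term d i f" for i
    by (cases i) (simp add: normal_term_def symfun.scale_left_diff_distrib)
  then have zero: "normal_term (\<lambda>x. c x - d x) i f = 0" if "i \<in> I" "i \<notin> ?A" for i
    using that by auto
  then have "{i \<in> I. normal_term (\<lambda>x. c x - d x) i f \<noteq> 0} \<subseteq> ?A" by blast
  then show "finite {i \<in> I. normal_term (\<lambda>x. c x - d x) i f \<noteq> 0}" using fin finite_subset by blast
  have "R f = (\<Sum>i\<in>?A. normal_term c i f)" "T f = (\<Sum>i\<in>?A. normal_term d i f)"
    using fin by (auto intro!: has_op_sumD[OF assms(1)] has_op_sumD[OF assms(2)])
  then have "R f - T f = (\<Sum>i\<in>?A. normal_term (\<lambda>x. c x - d x) i f)"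
    by (simp only: eq sum_subtractf)
  also have "\<dots> = op_sum (normal_term (\<lambda>x. c x - d x)) I f"
    by (rule op_sum_eq_sum[symmetric]) (use fin zero in auto)
  finally show "R f - T f = op_sum (normal_term (\<lambda>x. c x - d x)) I f" .
qed

subsection \<open>Coefficients from iterated commutators\<close>

fun iter_commutator ::
  "int list \<Rightarrow> ('a::field_char_0 symfun \<Rightarrow> 'a symfun) \<Rightarrow> 'a symfun \<Rightarrow> 'a symfun" where
  "iter_commutator [] R = R"
| "iter_commutator (u # us) R = iter_commutator us (commutator (heis u) R)"

lemma iter_commutator_scale:
  "iter_commutator us (\<lambda>f. smul c (T f)) = (\<lambda>f. smul c (iter_commutator us T f))"
  by (induction us arbitrary: T) (simp_all add: commutator_scale[OF lin_heis])

lemma iter_commutator_order_lt: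
  "order_lt n R \<Longrightarrow> n \<le> length us \<Longrightarrow> iter_commutator us R = (\<lambda>f. 0)"
proof (induction us arbitrary: n R)
  case (Cons u us)
  then have "n - 1 \<le> length us" by auto
  with Cons.IH[OF order_lt_commutator_heis[OF Cons.prems(1)]] show ?case by simp
qed auto

lemma lookup_iter_commutator_normal_power:
  "length us < m \<Longrightarrow> Poly_Mapping.lookup (iter_commutator us (normal_power m s) 1) 0 = 0"
proof (induction us arbitrary: m s)
  case (Cons u us)
  then show ?case
    by (simp add: commutator_heis_normal_power iter_commutator_scale del: of_int_mult of_int_minus)
qed (simp add: lookup_0_normal_power_one)

lemma order_lt_normal_power: "order_lt (Suc m) (normal_power m s)"
proof (induction m arbitrary: s)
  case 0
  show ?case by (simp add: lin_normal_power commutator_heis_normal_power)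
next
  case (Suc m)
  show ?case
    by (rule order_lt_SucI[OF lin_normal_power], unfold commutator_heis_normal_power,
        rule order_lt_scale) (simp add: Suc del: order_lt.simps)
qed

lemma lookup_normal_monomial_one:
  assumes "is_partition ga" "is_partition al"
  shows "Poly_Mapping.lookup (normal_monomial ga al 1) 0 = (if ga = [] \<and> al = [] then 1 else 0)"
  using assms[THEN is_partition_ge_1]
  by (cases ga) (auto simp: normal_monomial_def power_sums_perp_one power_sums_Cons)

lemma remove1_inject_partition:
  assumes "is_partition xs" "is_partition ys" "k \<in> set xs" "k \<in> set ys" "remove1 k xs = remove1 k ys"
  shows "xs = ys"
proof (rule is_partition_eqI)
  have "mset (k # remove1 k xs) = mset (k # remove1 k ys)" using assms(5) by simp
  then show "mset xs = mset ys" using assms(3,4) by simp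
qed (use assms in auto)

text \<open>
  The commutators that take apart the monomial of \<open>i0\<close> leave a multiple of the identity from this term,
  while every other term either vanishes or keeps a factor and has no constant term on \<open>1\<close>. The
  index set stays the same in the induction: an index loses its coefficient when its monomial lacks
  the removed factor. Such an index may collide with another one, which is why injectivity is only
  required where the coefficients are non-zero.
\<close>
lemma nonzero_coefficient_iter_commutator:
  fixes c :: "'i \<Rightarrow> 'a::field_char_0"
  assumes "has_op_sum (\<lambda>i f. smul (c i) (normal_monomial (g i) (h i) f)) I R"
    and "inj_on (\<lambda>i. (g i, h i)) {i \<in> I. c i \<noteq> 0}"
    and "\<And>i. i \<in> I \<Longrightarrow> is_partition (g i) \<and> is_partition (h i)"
    and "i0 \<in> I" "c i0 \<noteq> 0"
  shows "\<exists>us. length us = length (g i0) + length (h i0) \<and>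
    Poly_Mapping.lookup (iter_commutator us R 1) 0 \<noteq> 0"
  using assms
proof (induction "length (g i0) + length (h i0)" arbitrary: c g h R)
  case 0
  let ?F = "\<lambda>i f. smul (c i) (normal_monomial (g i) (h i) f)"
  let ?A = "insert i0 {i \<in> I. ?F i 1 \<noteq> 0}"
  have fin: "finite ?A" using "0.prems"(1) by (simp add: has_op_sum_def)
  have "R 1 = (\<Sum>i\<in>?A. ?F i 1)"
    by (rule has_op_sumD[OF "0.prems"(1) fin]) (use "0.prems"(4) in auto)
  then have "Poly_Mapping.lookup (R 1) 0 = (\<Sum>i\<in>?A. Poly_Mapping.lookup (?F i 1) 0)"
    by (simp only: lookup_sum)
  also have "\<dots> = (\<Sum>i\<in>?A. if i = i0 then c i0 else 0)"
  proof (rule sum.cong[OF refl])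
    fix i assume "i \<in> ?A"
    with "0.prems" have i: "i \<in> I" by auto
    show "Poly_Mapping.lookup (?F i 1) 0 = (if i = i0 then c i0 else 0)"
    proof (cases "c i = 0")
      case True
      then show ?thesis using "0.prems"(5) by auto
    next
      case False
      then have "i = i0 \<longleftrightarrow> (g i, h i) = (g i0, h i0)"
        using inj_onD[OF "0.prems"(2), of i i0] i "0.prems"(4,5) by auto
      then show ?thesis using "0.prems"(3)[OF i] "0.hyps"
        by (auto simp: lookup_normal_monomial_one)
    qed
  qed
  also have "\<dots> = c i0" using fin by simp
  finally show ?case using "0.hyps" "0.prems"(5) by (intro exI[of _ "[]"]) simp
next
  case (Suc n)
  have step: ?case
    if c': "c' i0 \<noteq> 0" "\<And>i. c' i \<noteq> 0 \<Longrightarrow> c i \<noteq> 0"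
      and inj: "inj_on (\<lambda>i. (g' i, h' i)) {i \<in> I. c' i \<noteq> 0}"
      and parts: "\<And>i. i \<in> I \<Longrightarrow> is_partition (g' i) \<and> is_partition (h' i)"
      and len: "Suc (length (g' i0) + length (h' i0)) = length (g i0) + length (h i0)"
      and com: "\<And>i f. i \<in> I \<Longrightarrow> commutator (heis u)
        (\<lambda>f. smul (c i) (normal_monomial (g i) (h i) f)) f = smul (c' i) (normal_monomial (g' i) (h' i) f)"
    for u c' g' h'
  proof -
    have "has_op_sum (\<lambda>i. commutator (heis u) (\<lambda>f. smul (c i) (normal_monomial (g i) (h i) f))) I
        (commutator (heis u) R)"
      by (rule has_op_sum_commutator[OF Suc.prems(1) lin_heis])
    then have "has_op_sum (\<lambda>i f. smul (c' i) (normal_monomial (g' i) (h' i) f)) I (commutator (heis u) R)"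
      by (simp add: has_op_sum_def op_sum_def fun_eq_iff com cong: conj_cong)
    from Suc.hyps(1)[OF _ this inj parts Suc.prems(4) c'(1)] Suc.hyps(2) len
    obtain us where "length us = length (g' i0) + length (h' i0)"
      "Poly_Mapping.lookup (iter_commutator us (commutator (heis u) R) 1) 0 \<noteq> 0" by auto
    then show ?thesis using len by (intro exI[of _ "u # us"]) simp
  qed
  have pos: "\<forall>a\<in>set (g i). a \<ge> 1" "\<forall>a\<in>set (h i). a \<ge> 1" if "i \<in> I" for i
    using Suc.prems(3)[OF that] is_partition_ge_1 by blast+
  have "g i0 \<noteq> [] \<or> h i0 \<noteq> []" using Suc.hyps(2) by auto
  then show ?case
  proof
    assume "g i0 \<noteq> []"
    then obtain k where k: "k \<in> set (g i0)" by (meson last_in_set)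
    with pos Suc.prems(4) have k1: "k \<ge> 1" by blast
    let ?c = "\<lambda>i. c i * of_nat (k * count_list (g i) k)"
    have mem: "?c i \<noteq> 0 \<longleftrightarrow> c i \<noteq> 0 \<and> k \<in> set (g i)" for i
      using k1 by (auto simp: count_list_0_iff simp flip: of_nat_mult)
    show ?thesis
    proof (rule step[of ?c "\<lambda>i. remove1 k (g i)" h "- int k"])
      show "inj_on (\<lambda>i. (remove1 k (g i), h i)) {i \<in> I. ?c i \<noteq> 0}"
        unfolding mem using Suc.prems(3)
        by (auto intro!: inj_onI inj_onD[OF Suc.prems(2)] dest: remove1_inject_partition)
      fix i f assume "i \<in> I"
      then show "commutator (heis (- int k)) (\<lambda>f. smul (c i) (normal_monomial (g i) (h i) f)) f =
          smul (?c i) (normal_monomial (remove1 k (g i)) (h i) f)"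
        using Suc.prems(3) k1
        by (simp add: commutator_scale[OF lin_heis] commutator_perp_normal_monomial del: of_nat_mult)
    qed (use mem[of i0] mem k Suc_length_remove1[OF k] Suc.prems in \<open>auto simp: is_partition_remove1 simp del: of_nat_mult\<close>)
  next
    assume "h i0 \<noteq> []"
    then obtain k where k: "k \<in> set (h i0)" by (meson last_in_set)
    with pos Suc.prems(4) have k1: "k \<ge> 1" by blast
    let ?c = "\<lambda>i. c i * - of_nat (k * count_list (h i) k)"
    have mem: "?c i \<noteq> 0 \<longleftrightarrow> c i \<noteq> 0 \<and> k \<in> set (h i)" for i
      using k1 by (auto simp: count_list_0_iff simp flip: of_nat_mult)
    show ?thesis
    proof (rule step[of ?c g "\<lambda>i. remove1 k (h i)" "int k"])
      show "inj_on (\<lambda>i. (g i, remove1 k (h i))) {i \<in> I. ?c i \<noteq> 0}"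
        unfolding mem using Suc.prems(3)
        by (auto intro!: inj_onI inj_onD[OF Suc.prems(2)] dest: remove1_inject_partition)
      fix i f assume "i \<in> I"
      then show "commutator (heis (int k)) (\<lambda>f. smul (c i) (normal_monomial (g i) (h i) f)) f =
          smul (?c i) (normal_monomial (g i) (remove1 k (h i)) f)"
        using Suc.prems(3) k1
        by (simp add: commutator_scale[OF lin_heis] commutator_power_sum_normal_monomial del: of_nat_mult)
    qed (use mem[of i0] mem k Suc_length_remove1[OF k] Suc.prems in \<open>auto simp: is_partition_remove1 simp del: of_nat_mult\<close>)
  qed
qed

lemma normal_term_eq: "normal_term c = (\<lambda>i f. smul (c i) (normal_monomial (fst i) (snd i) f))"
  by (auto simp: normal_term_def normal_monomial_def fun_eq_iff)

lemma normal_term_coefficient_zero: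
  assumes "has_op_sum (normal_term c) partition_pairs R" "(ga, al) \<in> partition_pairs"
    and "\<And>us. length us = length ga + length al \<Longrightarrow>
      Poly_Mapping.lookup (iter_commutator us R 1) 0 = 0"
  shows "c (ga, al) = 0"
proof (rule ccontr)
  assume "c (ga, al) \<noteq> 0"
  from nonzero_coefficient_iter_commutator[OF assms(1)[unfolded normal_term_eq] _ _ assms(2) this]
  show False using assms(3) by (auto simp: partition_pairs_def inj_on_def)
qed

lemma normal_term_order_lt:
  assumes "has_op_sum (normal_term c) partition_pairs R" "order_lt n R"
    "(ga, al) \<in> partition_pairs" "n \<le> length ga + length al"
  shows "c (ga, al) = 0"
  using assms(1,3)
  by (rule normal_term_coefficient_zero) (use assms in \<open>simp add: iter_commutator_order_lt[OF assms(2)]\<close>)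

text \<open>
  Fewer than \<open>m\<close> commutators turn \<open>V m s\<close> into a multiple of some \<open>V j r\<close> with \<open>j > 0\<close>, which has no constant
  term on \<open>1\<close>, and more than \<open>m\<close> commutators annihilate it.
\<close>
lemma normal_term_normal_power:
  assumes "has_op_sum (normal_term c) partition_pairs (\<lambda>f. smul a (normal_power m s f))"
    "(ga, al) \<in> partition_pairs" "length ga + length al \<noteq> m"
  shows "c (ga, al) = 0"
  using assms(1,2)
proof (rule normal_term_coefficient_zero)
  fix us :: "int list"
  assume len: "length us = length ga + length al"
  show "Poly_Mapping.lookup (iter_commutator us (\<lambda>f. smul a (normal_power m s f)) 1) 0 = 0"
  proof (cases "length us < m")
    case True
    then show ?thesis by (simp add: iter_commutator_scale lookup_iter_commutator_normal_power)
  next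
    case False
    with len assms(3) have "Suc m \<le> length us" by auto
    then show ?thesis
      by (simp add: iter_commutator_scale iter_commutator_order_lt[OF order_lt_normal_power])
  qed
qed

text \<open>
  Uniqueness is the case of order less than \<open>0\<close> for the difference of two expansions of the same operator.
\<close>
lemma normal_coeffs_eqI:
  assumes "has_op_sum (normal_term c) partition_pairs T" "\<And>x. x \<notin> partition_pairs \<Longrightarrow> c x = 0"
  shows "normal_coeffs T = c"
  unfolding normal_coeffs_def
proof (rule the_equality)
  fix d assume d: "(\<forall>x. x \<notin> partition_pairs \<longrightarrow> d x = 0) \<and> has_op_sum (normal_term d) partition_pairs T"
  then have diff: "has_op_sum (normal_term (\<lambda>x. d x - c x)) partition_pairs (\<lambda>f. T f - T f)"
    using has_op_sum_normal_term_diff assms(1) by blast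
  show "d = c"
  proof
    fix x
    show "d x = c x"
    proof (cases "x \<in> partition_pairs")
      case True
      with normal_term_order_lt[OF diff, of 0 "fst x" "snd x"] show ?thesis by simp
    next
      case False
      then show ?thesis using d assms(2)[of x] by (cases x) auto
    qed
  qed
qed (use assms in auto)


subsection \<open>Every linear operator has a normally ordered expansion\<close>

lemma symfun_induct_power_sums [case_names power_sums smul add]:
  assumes "\<And>as. \<forall>a\<in>set as. a \<ge> 1 \<Longrightarrow> P (power_sums as)"
    and "\<And>c f. P f \<Longrightarrow> P (smul c f)" "\<And>f g. P f \<Longrightarrow> P g \<Longrightarrow> P (f + g)"
  shows "P (f :: 'a::field_char_0 symfun)"
proof -
  have "\<forall>as. (\<forall>a\<in>set as. a \<ge> 1) \<longrightarrow> P (power_sums as * f)"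
  proof (induction f rule: symfun_induct)
    case (power_sum k f)
    show ?case
    proof (intro allI impI)
      fix as :: "nat list" assume "\<forall>a\<in>set as. a \<ge> 1"
      with power_sum have "P (power_sums (k # as) * f)" by simp
      then show "P (power_sums as * (power_sum k * f))" by (simp add: power_sums_Cons mult_ac)
    qed
  qed (use assms in \<open>auto simp: distrib_left\<close>)
  from this[rule_format, of "[]"] show ?thesis by simp
qed

lemma weight_le_power_sums:
  "\<forall>a\<in>set as. a \<ge> 1 \<Longrightarrow> weight_le (sum_list as) (power_sums as :: 'a::field_char_0 symfun)"
proof (induction as)
  case (Cons a as)
  then show ?case
    using weight_le.power_sum[of "sum_list as" "power_sums as :: 'a symfun" a]
    by (simp add: power_sums_Cons add.commute)
qed (simp add: weight_le.one)

text \<open>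
  With partitions ordered by length, the values of the operators \<open>p\<^sub>\<alpha>\<^sup>\<bottom>\<close> at the products \<open>p\<^sub>\<beta>\<close> form a
  triangular system; by the next lemma its diagonal is non-zero. This makes the recursion for \<open>left_coeff\<close> work.
\<close>
lemma power_sums_perp_power_sums_eq_0:
  assumes "\<forall>a\<in>set as. a \<ge> 1" "\<forall>b\<in>set bs. b \<ge> 1" "length bs \<le> length as" "mset as \<noteq> mset bs"
  shows "power_sums_perp as (power_sums bs :: 'a::field_char_0 symfun) = 0"
  using assms(2-4,1)
proof (induction bs arbitrary: as)
  case Nil
  then show ?case by (simp add: power_sums_perp_one)
next
  case (Cons k bs)
  have 1: "power_sums_perp as (power_sums bs :: 'a symfun) = 0"
    using Cons.prems by (intro Cons.IH) (auto dest: mset_eq_length)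
  have 2: "of_nat (k * count_list as k) * power_sums_perp (remove1 k as) (power_sums bs :: 'a symfun) = 0"
  proof (cases "k \<in> set as")
    case True
    then have "mset as = add_mset k (mset (remove1 k as))" by simp
    with Cons.prems(3) have "mset (remove1 k as) \<noteq> mset bs" by (metis mset.simps(2))
    then have "power_sums_perp (remove1 k as) (power_sums bs :: 'a symfun) = 0"
      using Cons.prems Suc_length_remove1[OF True] subsetD[OF set_remove1_subset[of k as]]
      by (intro Cons.IH) auto
    then show ?thesis by simp
  qed (simp add: count_list_0_iff)
  show ?case
    using Cons.prems 1 2 by (simp add: power_sums_Cons power_sums_perp_power_sum_mult)
qed

lemma power_sums_perp_power_sums_self:
  assumes "\<forall>a\<in>set as. a \<ge> 1"
  shows "\<exists>z. z \<noteq> 0 \<and> power_sums_perp as (power_sums as :: 'a::field_char_0 symfun) = smul z 1"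
  using assms
proof (induction as)
  case Nil
  show ?case by (intro exI[of _ 1]) simp
next
  case (Cons k as)
  then obtain z where z: "z \<noteq> 0" "power_sums_perp as (power_sums as :: 'a symfun) = smul z 1" by auto
  have "power_sums_perp (k # as) (power_sums as :: 'a symfun) = 0"
    using Cons.prems by (intro power_sums_perp_power_sums_eq_0) (auto dest: arg_cong[of _ _ size])
  then have "power_sums_perp (k # as) (power_sums (k # as) :: 'a symfun) =
      of_nat (k * count_list (k # as) k) * smul z 1"
    using Cons.prems z(2) power_sums_perp_power_sum_mult[of k "k # as" "power_sums as :: 'a symfun"]
    by (simp add: power_sums_Cons)
  also have "\<dots> = smul (of_nat (k * count_list (k # as) k) * z) 1"
    by (simp only: smul_of_nat[symmetric] symfun.scale_scale)
  finally have "power_sums_perp (k # as) (power_sums (k # as) :: 'a symfun) =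
      smul (of_nat (k * count_list (k # as) k) * z) 1" .
  moreover have "of_nat (k * count_list (k # as) k) * z \<noteq> 0"
    using Cons.prems z(1) by (simp only: mult_eq_0_iff of_nat_eq_0_iff) auto
  ultimately show ?case by blast
qed

definition partitions_upto :: "nat \<Rightarrow> nat list set" where
  "partitions_upto d = {al. is_partition al \<and> sum_list al \<le> d}"

lemma finite_partitions_upto: "finite (partitions_upto d)"
proof (rule finite_subset)
  show "partitions_upto d \<subseteq> {xs. set xs \<subseteq> {..d} \<and> length xs \<le> d}"
  proof
    fix al assume "al \<in> partitions_upto d"
    then have al: "\<forall>a\<in>set al. a \<ge> 1" "sum_list al \<le> d"
      by (simp_all add: partitions_upto_def) (use is_partition_ge_1 in force)
    have "length xs \<le> sum_list xs" if "\<forall>a\<in>set xs. a \<ge> 1" for xs :: "nat list"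
      using that by (induction xs) auto
    moreover have "a \<le> sum_list al" if "a \<in> set al" for a
      using that by (intro member_le_sum_list) auto
    ultimately show "al \<in> {xs. set xs \<subseteq> {..d} \<and> length xs \<le> d}" using al by fastforce
  qed
  show "finite {xs. set xs \<subseteq> {..d} \<and> length xs \<le> d}" by (rule finite_lists_length_le) simp
qed

text \<open>
  The symmetric function to the left of \<open>p\<^sub>\<beta>\<^sup>\<bottom>\<close> in the expansion of \<open>T\<close>. The value at \<open>\<beta>\<close> is forced by
  evaluating the expansion at \<open>p\<^sub>\<beta>\<close>, where only \<open>\<beta>\<close> and shorter partitions contribute.
\<close>
function left_coeff :: "('a::field_char_0 symfun \<Rightarrow> 'a symfun) \<Rightarrow> nat list \<Rightarrow> 'a symfun" where
  "left_coeff T be = smul (1 / Poly_Mapping.lookup (power_sums_perp be (power_sums be) :: 'a symfun) 0)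
     (T (power_sums be) -
       (\<Sum>al\<in>{al \<in> partitions_upto (sum_list be). length al < length be}.
          left_coeff T al * power_sums_perp al (power_sums be)))"
  by auto
termination by (relation "measure (length \<circ> snd)") auto

declare left_coeff.simps [simp del]

lemma left_coeff_expansion_power_sums:
  assumes T: "lin T" and be: "is_partition be" and d: "sum_list be \<le> d"
  shows "T (power_sums be) =
    (\<Sum>al\<in>partitions_upto d. left_coeff T al * power_sums_perp al (power_sums be))"
proof -
  let ?t = "\<lambda>al. left_coeff T al * power_sums_perp al (power_sums be)"
  let ?A = "{al \<in> partitions_upto (sum_list be). length al < length be}"
  obtain z where z: "z \<noteq> 0" "power_sums_perp be (power_sums be) = (smul z 1 :: 'a symfun)"
    using power_sums_perp_power_sums_self[OF is_partition_ge_1[OF be], where 'a = 'a] by blast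
  have "left_coeff T be = smul (1 / z) (T (power_sums be) - sum ?t ?A)"
    by (subst left_coeff.simps) (simp add: z)
  then have be_term: "?t be = T (power_sums be) - sum ?t ?A"
    using z by simp
  have fin: "finite ?A" using finite_partitions_upto[of "sum_list be"] by simp
  have "sum ?t (partitions_upto d) = sum ?t (insert be ?A)"
  proof (rule sum.mono_neutral_right)
    show "finite (partitions_upto d)" by (rule finite_partitions_upto)
    show "insert be ?A \<subseteq> partitions_upto d" using be d by (auto simp: partitions_upto_def)
    show "\<forall>al\<in>partitions_upto d - insert be ?A. ?t al = 0"
    proof
      fix al assume al: "al \<in> partitions_upto d - insert be ?A"
      then have part: "is_partition al" by (simp add: partitions_upto_def)
      note pos = is_partition_ge_1[OF part] is_partition_ge_1[OF be]
      have "power_sums_perp al (power_sums be) = (0 :: 'a symfun)"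
      proof (cases "length be \<le> length al")
        case True
        have "mset al \<noteq> mset be" using al is_partition_eqI[OF part be] by auto
        with True pos show ?thesis by (intro power_sums_perp_power_sums_eq_0)
      next
        case False
        with al have "sum_list be < sum_list al" by (auto simp: partitions_upto_def)
        with weight_le_power_sums_perp[OF weight_le_power_sums[OF pos(2)] pos(1)] show ?thesis by blast
      qed
      then show "?t al = 0" by simp
    qed
  qed
  also have "\<dots> = ?t be + sum ?t ?A" using fin by (subst sum.insert) auto
  finally show ?thesis using be_term by simp
qed

lemma left_coeff_expansion:
  assumes T: "lin T"
  shows "eventually (\<lambda>d. T f =
    (\<Sum>al\<in>partitions_upto d. left_coeff T al * power_sums_perp al f)) sequentially"
proof (induction f rule: symfun_induct_power_sums)
  case (power_sums as)
  have eq: "power_sums as = (power_sums (rev (sort as)) :: 'a symfun)"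
    by (rule power_sums_mset_eq) simp
  from eventually_ge_at_top[of "sum_list (rev (sort as))"] show ?case
    unfolding eq
    by eventually_elim (intro left_coeff_expansion_power_sums T is_partition_rev_sort power_sums)
next
  case (smul c f)
  then show ?case
    by eventually_elim (simp add: lin_smul[OF T] lin_smul[OF lin_power_sums_perp] symfun.scale_sum_right)
next
  case (add f g)
  then show ?case
    by eventually_elim (simp add: lin_add[OF T] lin_add[OF lin_power_sums_perp] distrib_left sum.distrib)
qed

lemma power_sums_span:
  "\<exists>c. finite {ga. c ga \<noteq> 0} \<and> (\<forall>ga. c ga \<noteq> 0 \<longrightarrow> is_partition ga) \<and>
    f = (\<Sum>ga\<in>{ga. c ga \<noteq> 0}. smul (c ga) (power_sums ga))"
proof (induction f rule: symfun_induct_power_sums)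
  case (power_sums as)
  have eq: "power_sums as = (power_sums (rev (sort as)) :: 'a symfun)"
    by (rule power_sums_mset_eq) simp
  show ?case using is_partition_rev_sort[OF power_sums]
    by (intro exI[of _ "\<lambda>ga. if ga = rev (sort as) then 1 else 0"]) (simp add: eq)
next
  case (smul a f)
  then obtain c where c: "finite {ga. c ga \<noteq> 0}" "\<And>ga. c ga \<noteq> 0 \<Longrightarrow> is_partition ga"
    "f = (\<Sum>ga\<in>{ga. c ga \<noteq> 0}. smul (c ga) (power_sums ga))" by auto
  have "smul a f = (\<Sum>ga\<in>{ga. c ga \<noteq> 0}. smul (a * c ga) (power_sums ga))"
    by (subst c(3)) (simp add: symfun.scale_sum_right)
  also have "\<dots> = (\<Sum>ga\<in>{ga. a * c ga \<noteq> 0}. smul (a * c ga) (power_sums ga))"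
    by (rule sum.mono_neutral_right[OF c(1)]) auto
  finally show ?case
    by (intro exI[of _ "\<lambda>ga. a * c ga"] conjI) (use c in auto)
next
  case (add f g)
  from add.IH(1) obtain c where c: "finite {ga. c ga \<noteq> 0}" "\<And>ga. c ga \<noteq> 0 \<Longrightarrow> is_partition ga"
      "f = (\<Sum>ga\<in>{ga. c ga \<noteq> 0}. smul (c ga) (power_sums ga))" by auto
  from add.IH(2) obtain d where d: "finite {ga. d ga \<noteq> 0}" "\<And>ga. d ga \<noteq> 0 \<Longrightarrow> is_partition ga"
      "g = (\<Sum>ga\<in>{ga. d ga \<noteq> 0}. smul (d ga) (power_sums ga))" by auto
  let ?U = "{ga. c ga \<noteq> 0} \<union> {ga. d ga \<noteq> 0}"
  have "f = (\<Sum>ga\<in>?U. smul (c ga) (power_sums ga))" "g = (\<Sum>ga\<in>?U. smul (d ga) (power_sums ga))"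
    unfolding c(3) d(3) using c(1) d(1) by (auto intro!: sum.mono_neutral_left)
  then have "f + g = (\<Sum>ga\<in>?U. smul (c ga + d ga) (power_sums ga))"
    by (simp add: symfun.scale_left_distrib sum.distrib)
  also have "\<dots> = (\<Sum>ga\<in>{ga. c ga + d ga \<noteq> 0}. smul (c ga + d ga) (power_sums ga))"
    using c(1) d(1) by (intro sum.mono_neutral_right) auto
  finally show ?case
  proof (intro exI[of _ "\<lambda>ga. c ga + d ga"] conjI)
    show "finite {ga. c ga + d ga \<noteq> 0}"
      by (rule finite_subset[of _ ?U]) (use c(1) d(1) in auto)
    show "\<forall>ga. c ga + d ga \<noteq> 0 \<longrightarrow> is_partition ga" using c(2) d(2) by force
  qed
qed

lemma normal_ordering_exists:
  fixes T :: "'a::field_char_0 symfun \<Rightarrow> 'a symfun"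
  assumes T: "lin T"
  obtains c where "\<And>x. x \<notin> partition_pairs \<Longrightarrow> c x = 0" "has_op_sum (normal_term c) partition_pairs T"
proof -
  obtain C :: "nat list \<Rightarrow> nat list \<Rightarrow> 'a" where C: "\<And>al. finite {ga. C al ga \<noteq> 0}" "\<And>al ga. C al ga \<noteq> 0 \<Longrightarrow> is_partition ga"
      "\<And>al. left_coeff T al = (\<Sum>ga\<in>{ga. C al ga \<noteq> 0}. smul (C al ga) (power_sums ga))"
  proof -
    have "\<forall>al. \<exists>c. finite {ga. c ga \<noteq> 0} \<and> (\<forall>ga. c ga \<noteq> 0 \<longrightarrow> is_partition ga) \<and>
        left_coeff T al = (\<Sum>ga\<in>{ga. c ga \<noteq> 0}. smul (c ga) (power_sums ga))"
      by (intro allI power_sums_span)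
    from choice[OF this] show ?thesis using that by blast
  qed
  define c where "c x = (if x \<in> partition_pairs then C (snd x) (fst x) else 0)" for x
  have "has_op_sum (normal_term c) partition_pairs T"
    unfolding has_op_sum_def
  proof (intro conjI allI ext)
    fix f :: "'a symfun"
    obtain d0 where d0: "weight_le d0 f" using weight_le_exists by blast
    have "eventually (\<lambda>d. d0 \<le> d \<and> T f =
        (\<Sum>al\<in>partitions_upto d. left_coeff T al * power_sums_perp al f)) sequentially"
      by (intro eventually_conj eventually_ge_at_top left_coeff_expansion T)
    then obtain d where d: "d0 \<le> d"
        "T f = (\<Sum>al\<in>partitions_upto d. left_coeff T al * power_sums_perp al f)"
      by (auto dest: eventually_happens)
    let ?S = "Sigma (partitions_upto d) (\<lambda>al. {ga. C al ga \<noteq> 0})"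
    let ?A = "(\<lambda>(al, ga). (ga, al)) ` ?S"
    have inj: "inj_on (\<lambda>(al, ga). (ga, al)) ?S" by (auto simp: inj_on_def)
    have fin: "finite ?A" by (intro finite_imageI finite_SigmaI finite_partitions_upto C(1))
    have sub: "?A \<subseteq> partition_pairs" using C(2) by (auto simp: partitions_upto_def partition_pairs_def)
    have zero: "normal_term c x f = 0" if x: "x \<in> partition_pairs" "x \<notin> ?A" for x
    proof (cases x)
      case (Pair ga al)
      with x have "C al ga = 0 \<or> d < sum_list al" "is_partition al"
        by (auto simp: partitions_upto_def partition_pairs_def image_iff)
      moreover have "power_sums_perp al f = 0" if "d < sum_list al"
        using weight_le_power_sums_perp[OF d0 is_partition_ge_1[OF \<open>is_partition al\<close>]] d(1) that by simp
      ultimately show ?thesis using Pair by (auto simp: normal_term_def c_def)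
    qed
    then have "{x \<in> partition_pairs. normal_term c x f \<noteq> 0} \<subseteq> ?A" by blast
    then show "finite {x \<in> partition_pairs. normal_term c x f \<noteq> 0}" using fin finite_subset by blast
    have "T f = (\<Sum>al\<in>partitions_upto d. \<Sum>ga\<in>{ga. C al ga \<noteq> 0}.
        smul (C al ga) (power_sums ga * power_sums_perp al f))"
      unfolding d(2) C(3) by (simp add: sum_distrib_right)
    also have "\<dots> = (\<Sum>(al, ga)\<in>?S. smul (C al ga) (power_sums ga * power_sums_perp al f))"
      by (rule sum.Sigma) (use finite_partitions_upto C(1) in auto)
    also have "\<dots> = (\<Sum>x\<in>?A. normal_term c x f)"
      unfolding sum.reindex[OF inj] using sub
      by (intro sum.cong refl) (auto simp: normal_term_def c_def subset_iff image_iff)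
    also have "\<dots> = op_sum (normal_term c) partition_pairs f"
      by (rule op_sum_eq_sum[symmetric]) (use fin sub zero in auto)
    finally show "T f = op_sum (normal_term c) partition_pairs f" .
  qed
  then show ?thesis using that[of c] by (simp add: c_def)
qed

text \<open>
  The coefficients of \<open>T\<close> and of its leading term agree in degree \<open>m\<close>, and the leading term has no
  coefficients in other degrees.
\<close>
lemma op_sum_normal_coeffs_leading:
  assumes T: "lin T" and lead: "order_lt m (\<lambda>f. T f - smul a (normal_power m s f))"
  shows "op_sum (normal_term (normal_coeffs T))
      {(ga, al) \<in> partition_pairs. length ga + length al = m} = (\<lambda>f. smul a (normal_power m s f))"
proof -
  let ?V = "\<lambda>f. smul a (normal_power m s f)"
  let ?I = "{(ga, al) \<in> partition_pairs. length ga + length al = m}"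
  obtain d where d: "\<And>x. x \<notin> partition_pairs \<Longrightarrow> d x = 0" "has_op_sum (normal_term d) partition_pairs T"
    using normal_ordering_exists[OF T] by blast
  obtain c where c: "\<And>x. x \<notin> partition_pairs \<Longrightarrow> c x = 0" "has_op_sum (normal_term c) partition_pairs ?V"
    using normal_ordering_exists[OF lin_scale[OF lin_normal_power]] by blast
  have nd: "normal_coeffs T = d" using d by (intro normal_coeffs_eqI)
  have dc: "d x = c x" if "x \<in> ?I" for x
    using that normal_term_order_lt[OF has_op_sum_normal_term_diff[OF d(2) c(2)] lead, of "fst x" "snd x"]
    by auto
  have c0: "c x = 0" if "x \<in> partition_pairs" "x \<notin> ?I" for x
    using that normal_term_normal_power[OF c(2), of "fst x" "snd x"] by (cases x) auto
  have eq2: "normal_term (normal_coeffs T) x f = normal_term c x f" if "x \<in> ?I" for x f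
    using dc[OF that] by (simp only: normal_term_eq nd)
  have eq1: "{x \<in> ?I. normal_term (normal_coeffs T) x f \<noteq> 0} =
      {x \<in> partition_pairs. normal_term c x f \<noteq> 0}" for f
  proof (intro Collect_cong)
    fix x
    show "(x \<in> ?I \<and> normal_term (normal_coeffs T) x f \<noteq> 0) =
      (x \<in> partition_pairs \<and> normal_term c x f \<noteq> 0)"
    proof (cases "x \<in> ?I")
      case True
      then show ?thesis using eq2[OF True] by auto
    next
      case False
      have "normal_term c x f = 0" if "x \<in> partition_pairs"
        using c0[OF that False] by (simp add: normal_term_eq)
      with False show ?thesis by blast
    qed
  qed
  have "op_sum (normal_term (normal_coeffs T)) ?I f = op_sum (normal_term c) partition_pairs f" for f
  proof -
    have "op_sum (normal_term (normal_coeffs T)) ?I f =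
        (\<Sum>x\<in>{x \<in> ?I. normal_term (normal_coeffs T) x f \<noteq> 0}. normal_term c x f)"
      unfolding op_sum_def by (intro sum.cong refl eq2) (erule CollectE, erule conjunct1)
    then show ?thesis unfolding eq1 op_sum_def .
  qed
  moreover have "op_sum (normal_term c) partition_pairs = ?V" using c(2) unfolding has_op_sum_def by simp
  ultimately show ?thesis by (simp add: fun_eq_iff)
qed

section \<open>Bernstein operators\<close>

subsection \<open>Complete homogeneous symmetric functions\<close>

abbreviation hh :: "int \<Rightarrow> 'a::field_char_0 symfun" where
  "hh \<equiv> complete_hom_int"

lemma hh_neg: "n < 0 \<Longrightarrow> hh n = 0"
  and hh_0 [simp]: "hh 0 = 1"
  by (simp_all add: complete_hom_int_def)

text \<open>
  With \<open>h\<^sub>n = 0\<close> for \<open>n < 0\<close>, Newton's identity holds for every integer \<open>n\<close> and every large enough range of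
  summation. This freedom avoids all case distinctions when indices are shifted.
\<close>
lemma newton_hh:
  assumes "n \<le> int N"
  shows "(\<Sum>r=1..N. power_sum r * hh (n - int r)) = of_int n * (hh n :: 'a::field_char_0 symfun)"
proof (cases "n \<le> 0")
  case True
  then show ?thesis by (cases "n = 0") (auto simp: hh_neg intro!: sum.neutral)
next
  case False
  define m where "m = nat (n - 1)"
  have n: "n = int (Suc m)" using False by (simp add: m_def)
  have "(\<Sum>r=1..N. power_sum r * hh (n - int r)) = (\<Sum>r=1..Suc m. power_sum r * (hh (n - int r) :: 'a symfun))"
    using assms by (intro sum.mono_neutral_right) (auto simp: n hh_neg)
  also have "\<dots> = (\<Sum>i\<le>m. power_sum (Suc i) * hh (n - int (Suc i)))"
    by (rule sum.reindex_bij_witness[of _ Suc "\<lambda>r. r - 1"]) auto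
  also have "\<dots> = (\<Sum>i\<le>m. power_sum (Suc i) * complete_hom (m - i))"
    by (intro sum.cong refl arg_cong2[of _ _ _ _ "(*)"])
      (auto simp: complete_hom_int_def n nat_diff_distrib' intro!: arg_cong[of _ _ complete_hom])
  also have "\<dots> = smul (of_nat (Suc m))
      (smul (1 / of_nat (Suc m)) (\<Sum>i\<le>m. power_sum (Suc i) * complete_hom (m - i)))"
    by (simp del: of_nat_Suc)
  also have "\<dots> = of_nat (Suc m) * complete_hom (Suc m)"
    by (simp only: complete_hom.simps smul_of_nat)
  also have "complete_hom (Suc m) = hh n"
    by (simp only: complete_hom_int_def n nat_int of_nat_less_0_iff if_False)
  finally show ?thesis by (simp only: n of_int_of_nat_eq)
qed

lemma hh_1: "hh 1 = power_sum 1"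
  using newton_hh[of 1 1, symmetric] by simp

lemma weight_le_hh: "weight_le n (hh (int n))"
proof (induction n rule: less_induct)
  case (less n)
  show ?case
  proof (cases "n = 0")
    case False
    have "weight_le n (\<Sum>r\<in>A. power_sum r * (hh (int n - int r) :: 'a symfun))"
      if "finite A" "A \<subseteq> {1..n}" for A
      using that
    proof (induction A rule: finite_induct)
      case (insert r A)
      have "weight_le (n - r) (hh (int n - int r) :: 'a symfun)"
        using less[of "n - r"] insert.prems False by (simp add: of_nat_diff)
      from weight_le.power_sum[OF this, of r] insert.prems
      have "weight_le n (power_sum r * hh (int n - int r) :: 'a symfun)" by simp
      with insert show ?case by (simp add: weight_le.add)
    qed simp
    from this[of "{1..n}"] have "weight_le n (of_int (int n) * hh (int n) :: 'a symfun)"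
      unfolding newton_hh[OF order_refl] by simp
    from weight_le.smul[OF this, of "1 / of_nat n"] False show ?thesis
      by (simp add: smul_of_nat[symmetric])
  qed (simp add: weight_le.one)
qed

lemma lookup_0_hh: "Poly_Mapping.lookup (hh n) 0 = (if n = 0 then 1 else 0)"
proof (cases "n > 0")
  case True
  have "Poly_Mapping.lookup (\<Sum>r=1..nat n. power_sum r * (hh (n - int r) :: 'a symfun)) 0 = 0"
    by (auto simp: lookup_sum)
  then have "Poly_Mapping.lookup (of_int n * hh n :: 'a symfun) 0 = 0"
    using newton_hh[of n "nat n", where 'a = 'a] True by simp
  then show ?thesis using True by (simp flip: smul_of_int)
qed (auto simp: hh_neg)

lemma power_sum_perp_hh:
  assumes "k \<ge> 1" shows "power_sum_perp k (hh n) = hh (n - int k)"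
proof (cases "n < 0")
  case True
  then show ?thesis by (simp add: hh_neg lin_zero[OF lin_power_sum_perp])
next
  case False
  define m where "m = nat n"
  have "power_sum_perp k (hh (int m)) = (hh (int m - int k) :: 'a symfun)"
  proof (induction m rule: less_induct)
    case (less m)
    show ?case
    proof (cases "m = 0")
      case True
      then show ?thesis using assms by (simp add: hh_neg)
    next
      case m: False
      have "of_nat m * power_sum_perp k (hh (int m)) =
          power_sum_perp k (\<Sum>r=1..m. power_sum r * (hh (int m - int r) :: 'a symfun))"
        by (subst newton_hh) (simp_all add: lin_of_nat[OF lin_power_sum_perp])
      also have "\<dots> = (\<Sum>r=1..m. power_sum r * hh (int m - int k - int r) +
          (if r = k then of_nat k * hh (int m - int k) else 0))"
        unfolding lin_sum[OF lin_power_sum_perp]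
      proof (rule sum.cong[OF refl])
        fix r assume r: "r \<in> {1..m}"
        then have "power_sum_perp k (hh (int m - int r)) = (hh (int m - int k - int r) :: 'a symfun)"
          using less[of "m - r"] m by (simp add: of_nat_diff algebra_simps)
        with r assms show "power_sum_perp k (power_sum r * (hh (int m - int r) :: 'a symfun)) =
            power_sum r * hh (int m - int k - int r) + (if r = k then of_nat k * hh (int m - int k) else 0)"
          by (simp add: power_sum_perp_power_sum_mult)
      qed
      also have "\<dots> = of_int (int m - int k) * hh (int m - int k) +
          (if k \<le> m then of_nat k * hh (int m - int k) else 0)"
        unfolding sum.distrib using assms newton_hh[of "int m - int k" m, where 'a = 'a] by simp
      also have "\<dots> = of_nat m * hh (int m - int k)"
        by (auto simp: hh_neg algebra_simps)
      finally have "of_nat m * (power_sum_perp k (hh (int m)) - (hh (int m - int k) :: 'a symfun)) = 0"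
        by (simp add: algebra_simps)
      from of_nat_mult_eq_0D[OF this m] show ?thesis by simp
    qed
  qed
  with False show ?thesis by (simp add: m_def)
qed

subsection \<open>Skewing by elementary symmetric functions\<close>

text \<open>
  This is \<open>(-1)\<^sup>n e\<^sub>n\<^sup>\<bottom>\<close>, defined by Newton's identity for elementary symmetric functions. As a polynomial
  in the \<open>p\<^sub>k\<^sup>\<bottom>\<close> it commutes with them and preserves every subspace that they preserve.
\<close>
fun elem_perp :: "nat \<Rightarrow> 'a::field_char_0 symfun \<Rightarrow> 'a symfun" where
  "elem_perp 0 f = f"
| "elem_perp (Suc n) f =
     smul (- 1 / of_nat (Suc n)) (\<Sum>i\<le>n. elem_perp (n - i) (power_sum_perp (Suc i) f))"

lemma lin_elem_perp: "lin (elem_perp n)"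
proof (induction n rule: less_induct)
  case (less n)
  show ?case
  proof (cases n)
    case 0
    have "elem_perp 0 = (\<lambda>f :: 'a symfun. f)" by (simp add: fun_eq_iff)
    with 0 lin_ident show ?thesis by metis
  next
    case (Suc m)
    have eq: "elem_perp n = (\<lambda>f :: 'a symfun. smul (- 1 / of_nat (Suc m)) (\<Sum>i\<le>m. elem_perp (m - i) (power_sum_perp (Suc i) f)))"
      by (simp add: fun_eq_iff Suc)
    show ?thesis unfolding eq
      by (intro lin_scale lin_family_sum lin_comp[OF less lin_power_sum_perp]) (simp add: Suc)
  qed
qed

lemma elem_perp_newton:
  "of_nat n * elem_perp n f = - (\<Sum>r=1..n. elem_perp (n - r) (power_sum_perp r f))"
proof (cases n)
  case (Suc m)
  have "(\<Sum>i\<le>m. elem_perp (m - i) (power_sum_perp (Suc i) f)) =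
      (\<Sum>r=1..n. elem_perp (n - r) (power_sum_perp r f))"
    by (rule sum.reindex_bij_witness[of _ "\<lambda>r. r - 1" Suc]) (auto simp: Suc)
  then show ?thesis
    by (simp add: Suc smul_of_nat[symmetric] del: of_nat_Suc)
qed simp

lemma elem_perp_commute:
  assumes "k \<ge> 1"
  shows "power_sum_perp k (elem_perp n f) = elem_perp n (power_sum_perp k f)"
proof (induction n arbitrary: f rule: less_induct)
  case (less n)
  then show ?case
    using assms
    by (cases n) (simp_all add: lin_smul[OF lin_power_sum_perp] lin_uminus[OF lin_power_sum_perp] lin_sum[OF lin_power_sum_perp]
        power_sum_perp_commute[of k])
qed

text \<open>
  The generating function \<open>\<Sum> w\<^sup>n (-1)\<^sup>n e\<^sub>n\<^sup>\<bottom>\<close> is the ring homomorphism \<open>p\<^sub>k \<mapsto> p\<^sub>k - w\<^sup>k\<close>; this is its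
  multiplicativity for a factor \<open>p\<^sub>k\<close>.
\<close>
lemma elem_perp_power_sum:
  assumes k: "k \<ge> 1"
  shows "elem_perp n (power_sum k * f) =
    power_sum k * elem_perp n f - (if k \<le> n then elem_perp (n - k) f else 0)"
proof (induction n arbitrary: f rule: less_induct)
  case (less n)
  show ?case
  proof (cases "n = 0")
    case True
    then show ?thesis using k by simp
  next
    case n: False
    have 1: "elem_perp (n - r) (power_sum_perp r (power_sum k * f)) =
        power_sum k * elem_perp (n - r) (power_sum_perp r f) -
        (if k + r \<le> n then elem_perp (n - k - r) (power_sum_perp r f) else 0) +
        (if r = k then of_nat k * elem_perp (n - k) f else 0)" if r: "r \<in> {1..n}" for r
    proof -
      have "elem_perp (n - r) (power_sum_perp r (power_sum k * f)) =
          elem_perp (n - r) (power_sum k * power_sum_perp r f) +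
          (if r = k then of_nat k * elem_perp (n - k) f else 0)"
        using k r by (simp add: power_sum_perp_power_sum_mult lin_add[OF lin_elem_perp]
            lin_of_nat[OF lin_elem_perp] lin_zero[OF lin_elem_perp])
      also have "elem_perp (n - r) (power_sum k * power_sum_perp r f) =
          power_sum k * elem_perp (n - r) (power_sum_perp r f) -
          (if k \<le> n - r then elem_perp (n - r - k) (power_sum_perp r f) else 0)"
        using r by (intro less) auto
      finally show ?thesis using r by (auto simp: diff_diff_left add.commute)
    qed
    have 2: "(\<Sum>r=1..n. if k + r \<le> n then elem_perp (n - k - r) (power_sum_perp r f) else 0) =
        - (if k \<le> n then of_nat (n - k) * elem_perp (n - k) f else 0)"
    proof -
      have "(\<Sum>r=1..n. if k + r \<le> n then elem_perp (n - k - r) (power_sum_perp r f) else 0) =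
          (\<Sum>r=1..n-k. elem_perp (n - k - r) (power_sum_perp r f))"
        by (rule sum.mono_neutral_cong_right) auto
      also have "\<dots> = - (of_nat (n - k) * elem_perp (n - k) f)"
        by (simp add: elem_perp_newton)
      finally show ?thesis by simp
    qed
    have "of_nat n * elem_perp n (power_sum k * f) =
        - (\<Sum>r=1..n. elem_perp (n - r) (power_sum_perp r (power_sum k * f)))"
      by (rule elem_perp_newton)
    also have "(\<Sum>r=1..n. elem_perp (n - r) (power_sum_perp r (power_sum k * f))) =
        (\<Sum>r=1..n. power_sum k * elem_perp (n - r) (power_sum_perp r f) -
        (if k + r \<le> n then elem_perp (n - k - r) (power_sum_perp r f) else 0) +
        (if r = k then of_nat k * elem_perp (n - k) f else 0))"
      by (rule sum.cong[OF refl 1])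
    also have "\<dots> = - (power_sum k * (of_nat n * elem_perp n f)) +
        (if k \<le> n then of_nat (n - k) * elem_perp (n - k) f else 0) +
        (if k \<le> n then of_nat k * elem_perp (n - k) f else 0)"
      unfolding sum.distrib sum_subtractf 2 elem_perp_newton using k
      by (simp add: sum_distrib_left)
    finally have "of_nat n * (elem_perp n (power_sum k * f) -
        (power_sum k * elem_perp n f - (if k \<le> n then elem_perp (n - k) f else 0))) = 0"
      by (auto simp: algebra_simps of_nat_diff)
    from of_nat_mult_eq_0D[OF this n] show ?thesis by simp
  qed
qed

lemma weight_le_elem_perp:
  assumes "weight_le d f"
  shows "(n \<le> d \<longrightarrow> weight_le (d - n) (elem_perp n f)) \<and> (d < n \<longrightarrow> elem_perp n f = 0)"
  using assms
proof (induction n arbitrary: d f rule: less_induct)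
  case (less n)
  show ?case
  proof (cases n)
    case 0
    then show ?thesis using less.prems by simp
  next
    case (Suc m)
    have 1: "(n \<le> d \<longrightarrow> weight_le (d - n) (elem_perp (m - i) (power_sum_perp (Suc i) f))) \<and>
        (d < n \<longrightarrow> elem_perp (m - i) (power_sum_perp (Suc i) f) = 0)" if "i \<le> m" for i
    proof (cases "Suc i \<le> d")
      case True
      with weight_le_power_sum_perp[OF less.prems, of "Suc i"]
      have "weight_le (d - Suc i) (power_sum_perp (Suc i) f)" by simp
      from less.IH[OF _ this, of "m - i"] that True show ?thesis by (auto simp: Suc)
    next
      case False
      with weight_le_power_sum_perp[OF less.prems, of "Suc i"] that show ?thesis
        by (simp add: lin_zero[OF lin_elem_perp] Suc)
    qed
    have "weight_le (d - n) (\<Sum>i\<in>A. elem_perp (m - i) (power_sum_perp (Suc i) f))"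
      if "n \<le> d" "finite A" "A \<subseteq> {..m}" for A
      using that(2,3) by (induction A rule: finite_induct) (use 1 that(1) in \<open>auto intro: weight_le.add\<close>)
    from this[OF _ finite_atMost order_refl]
    show ?thesis using 1
      by (auto simp: Suc intro!: weight_le_uminus weight_le.smul sum.neutral simp del: of_nat_Suc)
  qed
qed

subsection \<open>Bernstein operators and the Heisenberg algebra\<close>

text \<open>
  \<open>B\<^sub>n = \<Sum>\<^sub>i (-1)\<^sup>i h\<^sub>n\<^sub>+\<^sub>i e\<^sub>i\<^sup>\<bottom>\<close>. Summing over the support makes the definition total, and any longer range
  of summation gives the same value.
\<close>
definition bernstein :: "int \<Rightarrow> 'a::field_char_0 symfun \<Rightarrow> 'a symfun" where
  "bernstein n f = (\<Sum>i\<in>{i. elem_perp i f \<noteq> 0}. hh (n + int i) * elem_perp i f)"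

lemma bernstein_eq_sum:
  assumes "weight_le d f" "d \<le> N"
  shows "bernstein n f = (\<Sum>i\<le>N. hh (n + int i) * elem_perp i f)"
proof -
  have "i \<le> N" if "elem_perp i f \<noteq> 0" for i
    using weight_le_elem_perp[OF assms(1), of i] that assms(2) by (meson le_trans not_le_imp_less)
  then show ?thesis unfolding bernstein_def
    by (intro sum.mono_neutral_left) auto
qed

lemma eventually_bernstein:
  "eventually (\<lambda>N. bernstein n f = (\<Sum>i\<le>N. hh (n + int i) * elem_perp i f)) sequentially"
proof -
  obtain d where "weight_le d f" using weight_le_exists by blast
  from eventually_ge_at_top[of d] show ?thesis
    by eventually_elim (rule bernstein_eq_sum[OF \<open>weight_le d f\<close>])
qed

lemma lin_bernstein: "lin (bernstein n)"
proof (rule linI)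
  fix f g :: "'a symfun"
  have "eventually (\<lambda>N. bernstein n (f + g) = bernstein n f + bernstein n g) sequentially"
    using eventually_bernstein[of n "f + g"] eventually_bernstein[of n f] eventually_bernstein[of n g]
    by eventually_elim (simp add: lin_add[OF lin_elem_perp] distrib_left sum.distrib)
  then show "bernstein n (f + g) = bernstein n f + bernstein n g" by simp
next
  fix c and f :: "'a symfun"
  have "eventually (\<lambda>N. bernstein n (smul c f) = smul c (bernstein n f)) sequentially"
    using eventually_bernstein[of n "smul c f"] eventually_bernstein[of n f]
    by eventually_elim (simp add: lin_smul[OF lin_elem_perp] symfun.scale_sum_right)
  then show "bernstein n (smul c f) = smul c (bernstein n f)" by simp
qed

lemma bernstein_one: "bernstein n 1 = hh n"
  using bernstein_eq_sum[OF weight_le.one[of 0], of 0 n] by simp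

lemma bernstein_power_sum:
  assumes k: "k \<ge> 1"
  shows "bernstein n (power_sum k * f) = power_sum k * bernstein n f - bernstein (n + int k) f"
proof -
  obtain d where d: "weight_le d f" using weight_le_exists by blast
  have dk: "weight_le (d + k) (power_sum k * f)" by (rule weight_le.power_sum[OF d k])
  have "bernstein n (power_sum k * f) = (\<Sum>i\<le>d+k. hh (n + int i) * elem_perp i (power_sum k * f))"
    by (rule bernstein_eq_sum[OF dk]) simp
  also have "\<dots> = (\<Sum>i\<le>d+k. power_sum k * (hh (n + int i) * elem_perp i f)) -
      (\<Sum>i\<le>d+k. if k \<le> i then hh (n + int i) * elem_perp (i - k) f else 0)"
    by (simp add: elem_perp_power_sum[OF k] right_diff_distrib sum_subtractf mult.left_commute
        if_distrib[of "(*) _"] cong: if_cong)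
  also have "(\<Sum>i\<le>d+k. power_sum k * (hh (n + int i) * elem_perp i f)) = power_sum k * bernstein n f"
    by (subst bernstein_eq_sum[OF d, of "d + k"]) (simp_all add: sum_distrib_left)
  also have "(\<Sum>i\<le>d+k. if k \<le> i then hh (n + int i) * elem_perp (i - k) f else 0) =
      (\<Sum>i\<in>{k..d+k}. hh (n + int i) * elem_perp (i - k) f)"
    by (rule sum.mono_neutral_cong_right) auto
  also have "\<dots> = (\<Sum>i\<le>d. hh (n + int k + int i) * elem_perp i f)"
    by (rule sum.reindex_bij_witness[of _ "\<lambda>i. i + k" "\<lambda>i. i - k"]) (auto simp: algebra_simps of_nat_diff)
  also have "\<dots> = bernstein (n + int k) f"
    by (rule bernstein_eq_sum[OF d, symmetric]) simp
  finally show ?thesis .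
qed

lemma bernstein_perp:
  assumes k: "k \<ge> 1"
  shows "power_sum_perp k (bernstein n f) = bernstein n (power_sum_perp k f) + bernstein (n - int k) f"
proof -
  have "eventually (\<lambda>N. power_sum_perp k (bernstein n f) =
      bernstein n (power_sum_perp k f) + bernstein (n - int k) f) sequentially"
    using eventually_bernstein[of n f] eventually_bernstein[of n "power_sum_perp k f"]
      eventually_bernstein[of "n - int k" f]
    by eventually_elim
      (simp add: lin_sum[OF lin_power_sum_perp] power_sum_perp_mult[OF k] power_sum_perp_hh[OF k]
        elem_perp_commute[OF k] sum.distrib algebra_simps)
  then show ?thesis by simp
qed

text \<open>
  The generating function \<open>\<Sum> B\<^sub>n z\<^sup>n\<close> is an eigenvector for commuting with \<open>a\<^sub>u\<close>, with eigenvalue \<open>z\<^sup>-\<^sup>u\<close>.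
\<close>
lemma heis_bernstein:
  "heis u (bernstein n f) = bernstein n (heis u f) + (if u = 0 then 0 else bernstein (n + u) f)"
proof (cases u rule: int_cases_signed)
  case (pos r)
  then show ?thesis by (simp add: heis_int bernstein_power_sum)
next
  case (neg r)
  then show ?thesis by (simp add: heis_minus_int bernstein_perp)
qed (simp add: lin_zero[OF lin_bernstein])

subsection \<open>Commuting the quadratic and cubic operators past a Bernstein operator\<close>

lemma lookup_of_int_mult:
  "Poly_Mapping.lookup (of_int k * (f :: 'a::field_char_0 symfun)) m = of_int k * Poly_Mapping.lookup f m"
  unfolding smul_of_int[symmetric] by (rule lookup_smul)

lemma lookup_numeral_mult:
  "Poly_Mapping.lookup (numeral w * (f :: 'a::field_char_0 symfun)) m = numeral w * Poly_Mapping.lookup f m"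
  unfolding smul_numeral[symmetric] by (rule lookup_smul)

text \<open>
  A family of operators with the same commutators as the \<open>B\<^sub>n\<close> and with \<open>X\<^sub>n(1) = 0\<close> for small \<open>n\<close> is
  determined by the constant terms of its values at \<open>1\<close>: applying \<open>p\<^sub>r\<^sup>\<bottom>\<close> to \<open>X\<^sub>n(1)\<close> gives \<open>X\<^sub>n\<^sub>-\<^sub>r(1)\<close>, so that \<open>X\<^sub>n(1)\<close> vanishes by induction on \<open>n\<close>,
  and multiplication by power sums propagates this to all arguments. Identities for commutators with
  \<open>B\<^sub>n\<close> are proved by applying this to the difference of the two sides.
\<close>
lemma bernstein_family_zero:
  assumes lin: "\<And>n. lin (X n)"
    and comm: "\<And>u n f. u \<noteq> 0 \<Longrightarrow> heis u (X n f) = X n (heis u f) + X (n + u) f"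
    and small: "\<And>n. n < n0 \<Longrightarrow> X n 1 = 0"
    and const: "\<And>n. Poly_Mapping.lookup (X n 1) 0 = 0"
  shows "X n f = 0"
proof -
  have one: "X (n0 - 1 + int k) 1 = 0" for k
  proof (induction k rule: less_induct)
    case (less k)
    show ?case
    proof (cases "k = 0")
      case True
      then show ?thesis using small by simp
    next
      case False
      have "power_sum_perp r (X (n0 - 1 + int k) 1) = 0" if r: "r \<ge> 1" for r
      proof -
        have "power_sum_perp r (X (n0 - 1 + int k) 1) = X (n0 - 1 + int k - int r) 1"
          using comm[of "- int r" "n0 - 1 + int k" 1] r
          by (simp add: heis_minus_int lin_zero[OF lin])
        also have "\<dots> = 0"
        proof (cases "r \<le> k")
          case True
          then have eq: "n0 - 1 + int k - int r = n0 - 1 + int (k - r)" by simp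
          show ?thesis unfolding eq by (rule less) (use r False in auto)
        qed (simp add: small)
        finally show ?thesis .
      qed
      from power_sum_perp_zero_imp_constant[OF this] const show ?thesis by simp
    qed
  qed
  have X1: "X n 1 = 0" for n
  proof (cases "n < n0")
    case False
    then have "n = n0 - 1 + int (nat (n - n0 + 1))" by simp
    with one show ?thesis by metis
  qed (rule small)
  have "\<forall>n. X n f = 0"
  proof (induction f rule: symfun_induct_heis)
    case (heis u f)
    show ?case
    proof
      fix n
      show "X n (heis u f) = 0"
        using comm[of u n f] heis by (simp add: lin_zero[OF lin_heis])
    qed
  qed (simp_all add: X1 lin_smul[OF lin] lin_add[OF lin])
  then show ?thesis ..
qed

lemma normal_power_Suc_0: "normal_power (Suc 0) s f = heis s f"
  using normal_power_1[of s f] by simp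

lemma heis_bernstein_nonzero: "u \<noteq> 0 \<Longrightarrow> heis u (bernstein n f) = bernstein n (heis u f) + bernstein (n + u) f"
  by (simp add: heis_bernstein)

lemma normal_power_hh_negative: "n + s < 0 \<Longrightarrow> normal_power m s (hh n) = 0"
  using normal_power_negative[OF weight_le_hh[of "nat n"], of s m]
  by (cases "n < 0") (simp_all add: hh_neg lin_zero[OF lin_normal_power])

text \<open>
  \<open>V 2 0 / 2\<close> is the Euler operator \<open>\<Sum> p\<^sub>i p\<^sub>i\<^sup>\<bottom>\<close>, which multiplies homogeneous elements by their degree;
  \<open>B\<^sub>n\<close> raises the degree by \<open>n\<close>.
\<close>
lemma euler_bernstein:
  "normal_power 2 0 (bernstein n f) = bernstein n (normal_power 2 0 f) + of_int (2 * n) * bernstein n f"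
proof -
  let ?X = "\<lambda>n (f :: 'a symfun). normal_power 2 0 (bernstein n f) - bernstein n (normal_power 2 0 f) -
    of_int (2 * n) * bernstein n f"
  have "?X n f = 0"
  proof (rule bernstein_family_zero[of ?X 0])
    show "lin (?X n)" for n
      by (intro lin_minus lin_times lin_comp[of "normal_power 2 0" "bernstein n"]
          lin_comp[of "bernstein n" "normal_power 2 0"] lin_bernstein lin_normal_power)
    show "heis u (?X n f) = ?X n (heis u f) + ?X (n + u) f" if "u \<noteq> 0" for u n and f :: "'a symfun"
      by (simp only: lin_diff[OF lin_heis] lin_of_int[OF lin_heis] normal_power_commute
          heis_bernstein_nonzero[OF that] lin_diff[OF lin_bernstein] lin_of_int[OF lin_bernstein]
          lin_add[OF lin_normal_power])
        (simp add: normal_power_Suc_0 heis_bernstein_nonzero[OF that] algebra_simps)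
    show "?X n 1 = 0" if "n < 0" for n
      using that by (simp add: bernstein_one normal_power_0_one lin_zero[OF lin_bernstein] hh_neg
          lin_zero[OF lin_normal_power])
    show "Poly_Mapping.lookup (?X n 1) 0 = 0" for n
      by (simp add: bernstein_one normal_power_0_one lin_zero[OF lin_bernstein] lookup_minus
          lookup_0_normal_power lookup_0_hh lookup_of_int_mult del: of_int_mult)
  qed
  then show ?thesis by (simp add: algebra_simps)
qed

text \<open>
  This and the next lemma provide the two constant terms that have to be computed for the quadratic operators.
\<close>
lemma normal_power_2_one:
  assumes "r \<ge> 1"
  shows "normal_power 2 (int r) 1 = (\<Sum>i\<in>{1..<r}. power_sum i * power_sum (r - i))"
proof -
  have "eventually (\<lambda>N. normal_power 2 (int r) (1 :: 'a symfun) =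
      (\<Sum>i\<in>{1..<r}. power_sum i * power_sum (r - i))) sequentially"
    using eventually_normal_sum[of 2 0 "int r" "1 :: 'a symfun"] eventually_ge_at_top[of r]
  proof eventually_elim
    case (elim N)
    have inner: "trunc_sum N (Suc 0) 0 s (1 :: 'a symfun) = (if 1 \<le> s \<and> s \<le> int N then power_sum (nat s) else 0)" for s
    proof -
      have "trunc_sum N (Suc 0) 0 s (1 :: 'a symfun) = (\<Sum>j=1..N. if nat s = j then power_sum (nat s) else 0)"
        unfolding trunc_sum_Suc_left trunc_sum_0_0 by (intro sum.cong) auto
      then show ?thesis by auto
    qed
    have "trunc_sum N 2 0 (int r) (1 :: 'a symfun) = (\<Sum>i=1..N. if i < r then power_sum i * power_sum (r - i) else 0)"
      unfolding numeral_2_eq_2 trunc_sum_Suc_left[of N "Suc 0"] inner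
      using elim by (intro sum.cong) (auto simp: nat_diff_distrib')
    also have "\<dots> = (\<Sum>i\<in>{1..<r}. power_sum i * power_sum (r - i))"
      using elim by (intro sum.mono_neutral_cong_right) auto
    finally show ?case using elim
      by (simp add: normal_power_def numeral_2_eq_2 normal_sum_one)
  qed
  then show ?thesis by simp
qed

lemma lookup_0_normal_power_2_hh:
  assumes "r \<ge> 1"
  shows "Poly_Mapping.lookup (normal_power 2 (- int r) (hh n)) 0 =
    of_nat (r - 1) * Poly_Mapping.lookup (hh (n - int r) :: 'a::field_char_0 symfun) 0"
proof -
  have "eventually (\<lambda>N. normal_sum 0 2 (- int r) (hh n) =
      (of_nat (r - 1) * hh (n - int r) :: 'a symfun)) sequentially"
    using eventually_normal_sum[of 0 2 "- int r" "hh n :: 'a symfun"] eventually_ge_at_top[of r]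
  proof eventually_elim
    case (elim N)
    have inner: "trunc_sum N 0 (Suc 0) s (f :: 'a symfun) =
        (if 1 \<le> - s \<and> - s \<le> int N then power_sum_perp (nat (- s)) f else 0)" for s f
    proof -
      have "trunc_sum N 0 (Suc 0) s f = (\<Sum>j=1..N. if nat (- s) = j then power_sum_perp (nat (- s)) f else 0)"
        unfolding trunc_sum_Suc_right trunc_sum_0_0 by (intro sum.cong) auto
      then show ?thesis by auto
    qed
    have "trunc_sum N 0 2 (- int r) (hh n :: 'a symfun) = (\<Sum>i=1..N. if i < r then hh (n - int r) else 0)"
      unfolding numeral_2_eq_2 trunc_sum_Suc_right[of N 0 "Suc 0"] inner
      using elim by (intro sum.cong) (auto simp: power_sum_perp_hh)
    also have "\<dots> = (\<Sum>i\<in>{1..<r}. hh (n - int r))"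
      using elim by (intro sum.mono_neutral_cong_right) auto
    finally show ?case using elim by simp
  qed
  then have "Poly_Mapping.lookup (normal_sum 0 2 (- int r) (hh n :: 'a symfun)) 0 =
      of_nat (r - 1) * Poly_Mapping.lookup (hh (n - int r) :: 'a symfun) 0"
    by (simp flip: smul_of_nat)
  then show ?thesis
    by (simp add: normal_power_def numeral_2_eq_2 lookup_add lookup_0_normal_sum flip: smul_of_nat)
qed

lemma bernstein_power_sum_power_sum:
  assumes "i \<ge> 1" "j \<ge> 1"
  shows "bernstein n (power_sum i * power_sum j) = power_sum i * (power_sum j * hh n) -
    power_sum i * hh (n + int j) - power_sum j * hh (n + int i) + hh (n + int i + int j)"
proof -
  have "bernstein k (power_sum j) = power_sum j * hh k - (hh (k + int j) :: 'a symfun)" for k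
    using bernstein_power_sum[OF assms(2), of k 1] by (simp add: bernstein_one)
  then show ?thesis
    by (simp only: bernstein_power_sum[OF assms(1)]) (simp add: algebra_simps)
qed

text \<open>
  The term \<open>B\<^sub>n a\<^sub>t\<close> on the right is the effect of omitting the zero mode \<open>a\<^sub>0\<close>. The cases \<open>u + t = 0\<close> and
  \<open>u + t \<noteq> 0\<close> differ for the same reason: in the former \<open>[a\<^sub>u, V 2 t]\<close> vanishes, but \<open>[a\<^sub>u, a\<^sub>t]\<close> does not.
\<close>
lemma quadratic_bernstein:
  assumes t: "t \<noteq> 0"
  shows "normal_power 2 t (bernstein n f) = bernstein n (normal_power 2 t f) -
    2 * bernstein n (heis t f) + of_int (2 * n + t - 1) * bernstein (n + t) f"
proof -
  let ?X = "\<lambda>n (f :: 'a symfun). normal_power 2 t (bernstein n f) - bernstein n (normal_power 2 t f) +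
    2 * bernstein n (heis t f) - of_int (2 * n + t - 1) * bernstein (n + t) f"
  have "?X n f = 0"
  proof (rule bernstein_family_zero[of ?X "- t"])
    show "lin (?X n)" for n
      by (intro lin_minus lin_plus lin_times lin_comp[of "normal_power 2 t" "bernstein n"]
          lin_comp[of "bernstein n" "normal_power 2 t"] lin_comp[of "bernstein n" "heis t"]
          lin_bernstein lin_normal_power lin_heis)
    show "heis u (?X n f) = ?X n (heis u f) + ?X (n + u) f" if "u \<noteq> 0" for u n and f :: "'a symfun"
    proof (cases "u + t = 0")
      case True
      then have "t = - u" by simp
      then show ?thesis
        by (simp only: lin_diff[OF lin_heis] lin_add[OF lin_heis] lin_of_int[OF lin_heis] lin_numeral[OF lin_heis]
            normal_power_commute heis_bernstein_nonzero[OF that] lin_diff[OF lin_bernstein]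
            lin_of_int[OF lin_bernstein] lin_add[OF lin_normal_power] heis_commute[of u "- u" f])
          (simp add: normal_power_Suc_0 lin_diff[OF lin_bernstein] lin_of_int[OF lin_bernstein]
            lin_zero[OF lin_bernstein], simp add: algebra_simps)
    next
      case False
      then have *: "t + u \<noteq> 0" by simp
      show ?thesis
        by (simp only: lin_diff[OF lin_heis] lin_add[OF lin_heis] lin_of_int[OF lin_heis] lin_numeral[OF lin_heis]
            normal_power_commute heis_bernstein_nonzero[OF that] lin_diff[OF lin_bernstein]
            lin_of_int[OF lin_bernstein] lin_add[OF lin_normal_power] heis_commute[of u t f])
          (simp add: normal_power_Suc_0 heis_bernstein_nonzero[OF *] False lin_zero[OF lin_bernstein],
            simp add: algebra_simps)
    qed
    have pos: "Poly_Mapping.lookup (?X n 1) 0 = 0 \<and> (n < - t \<longrightarrow> ?X n 1 = 0)"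
      if r: "r \<ge> 1" "t = int r" for r n
    proof -
      have "bernstein n (normal_power 2 t 1) = (\<Sum>i\<in>{1..<r}. power_sum i * (power_sum (r - i) * hh n) -
          power_sum i * hh (n + int (r - i)) - power_sum (r - i) * hh (n + int i) +
          (hh (n + int r) :: 'a symfun))"
        unfolding r(2) normal_power_2_one[OF r(1)] lin_sum[OF lin_bernstein]
      proof (rule sum.cong[OF refl])
        fix i assume "i \<in> {1..<r}"
        then have i: "i \<ge> 1" "r - i \<ge> 1" and sum: "n + int i + int (r - i) = n + int r" by auto
        show "bernstein n (power_sum i * power_sum (r - i)) = power_sum i * (power_sum (r - i) * hh n) -
          power_sum i * hh (n + int (r - i)) - power_sum (r - i) * hh (n + int i) +
          (hh (n + int r) :: 'a symfun)"
          unfolding bernstein_power_sum_power_sum[OF i] sum ..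
      qed
      note quad = this
      have lin1: "bernstein n (heis t 1) = power_sum r * hh n - (hh (n + int r) :: 'a symfun)"
        using bernstein_power_sum[OF r(1), of n 1] r by (simp add: heis_int bernstein_one)
      let ?d = "if n + int r = 0 then 1 else (0 :: 'a)"
      have L0: "Poly_Mapping.lookup (normal_power 2 t (hh n :: 'a symfun)) 0 = 0"
        using r by (simp add: lookup_0_normal_power)
      have L1: "Poly_Mapping.lookup (bernstein n (normal_power 2 t (1 :: 'a symfun))) 0 = of_nat (r - 1) * ?d"
      proof -
        have "Poly_Mapping.lookup (bernstein n (normal_power 2 t (1 :: 'a symfun))) 0 = (\<Sum>i\<in>{1..<r}. ?d)"
          unfolding quad lookup_sum
          by (rule sum.cong) (auto simp: lookup_add lookup_minus lookup_0_hh)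
        then show ?thesis by simp
      qed
      have L2: "Poly_Mapping.lookup (bernstein n (heis t (1 :: 'a symfun))) 0 = - ?d"
        unfolding lin1 using r by (simp add: lookup_minus lookup_0_hh)
      have "Poly_Mapping.lookup (?X n 1) 0 =
          0 - of_nat (r - 1) * ?d + 2 * (- ?d) - of_int (2 * n + int r - 1) * ?d"
        by (simp only: lookup_minus lookup_add lookup_of_int_mult lookup_numeral_mult bernstein_one
            L0[unfolded r(2)] L1[unfolded r(2)] L2[unfolded r(2)] lookup_0_hh r(2))
      also have "\<dots> = 0"
      proof (cases "n + int r = 0")
        case True
        then have "n = - int r" by simp
        then show ?thesis using r by (simp add: of_nat_diff)
      qed simp
      finally have "Poly_Mapping.lookup (?X n 1) 0 = 0" .
      moreover have "?X n 1 = 0" if "n < - t"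
        unfolding quad lin1 bernstein_one using r that
        by (simp add: hh_neg lin_zero[OF lin_normal_power])
      ultimately show ?thesis by blast
    qed
    have neg: "Poly_Mapping.lookup (?X n 1) 0 = 0 \<and> (n < - t \<longrightarrow> ?X n 1 = 0)"
      if r: "r \<ge> 1" "t = - int r" for r n
    proof -
      have z: "normal_power 2 t 1 = (0 :: 'a symfun)" "heis t 1 = (0 :: 'a symfun)"
        using r normal_power_negative[OF weight_le.one[of 0], of t 2] by (simp_all add: heis_minus_int)
      have X: "?X n 1 = normal_power 2 t (hh n) - of_int (2 * n + t - 1) * hh (n + t)"
        by (simp add: z bernstein_one lin_zero[OF lin_bernstein])
      have "Poly_Mapping.lookup (?X n 1) 0 = of_nat (r - 1) * (if n - int r = 0 then 1 else 0) -
          of_int (2 * n - int r - 1) * (if n - int r = 0 then 1 else (0 :: 'a))"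
        unfolding X using lookup_0_normal_power_2_hh[OF r(1), of n, where 'a = 'a]
        by (simp only: lookup_minus lookup_of_int_mult lookup_0_hh r(2)) simp
      also have "\<dots> = 0"
        using r by (simp add: of_nat_diff)
      finally have "Poly_Mapping.lookup (?X n 1) 0 = 0" .
      moreover have "?X n 1 = 0" if "n < - t"
        unfolding X using that by (simp add: hh_neg normal_power_hh_negative)
      ultimately show ?thesis by blast
    qed
    from pos neg t show "Poly_Mapping.lookup (?X n 1) 0 = 0" for n
      by (cases t rule: int_cases_signed) blast+
    from pos neg t show "?X n 1 = 0" if "n < - t" for n
      using that by (cases t rule: int_cases_signed) blast+
  qed
  then show ?thesis by (simp add: algebra_simps)
qed

text \<open>
  In terms of \<open>D\<close> and the Euler operator \<open>E\<close> this reads \<open>D B\<^sub>n = B\<^sub>n (D - E) + n (n - 1) / 2 \<cdot> B\<^sub>n\<close>. It reflects how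
  contents change when a row of length \<open>n\<close> is put on top of a diagram: all contents in the diagram drop by
  \<open>1\<close>, and the new row contributes \<open>0 + 1 + \<dots> + (n - 1)\<close>. Commuting the difference with \<open>a\<^sub>u\<close> leads to
  the identity for \<open>V 2 u\<close>.
\<close>
lemma cubic_bernstein:
  "normal_power 3 0 (bernstein n f) = bernstein n (normal_power 3 0 f) -
    3 * bernstein n (normal_power 2 0 f) + of_int (3 * n * (n - 1)) * bernstein n f"
proof -
  let ?X = "\<lambda>n (f :: 'a symfun). normal_power 3 0 (bernstein n f) - bernstein n (normal_power 3 0 f) +
    3 * bernstein n (normal_power 2 0 f) - of_int (3 * n * (n - 1)) * bernstein n f"
  have "?X n f = 0"
  proof (rule bernstein_family_zero[of ?X 0])
    show "lin (?X n)" for n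
      by (intro lin_minus lin_plus lin_times lin_comp[of "normal_power 3 0" "bernstein n"]
          lin_comp[of "bernstein n" "normal_power 3 0"] lin_comp[of "bernstein n" "normal_power 2 0"]
          lin_bernstein lin_normal_power)
    show "heis u (?X n f) = ?X n (heis u f) + ?X (n + u) f" if "u \<noteq> 0" for u n and f :: "'a symfun"
      by (simp only: lin_diff[OF lin_heis] lin_add[OF lin_heis] lin_of_int[OF lin_heis] lin_numeral[OF lin_heis]
          normal_power_commute heis_bernstein_nonzero[OF that] lin_diff[OF lin_bernstein]
          lin_of_int[OF lin_bernstein] lin_add[OF lin_normal_power])
        (simp add: normal_power_Suc_0 quadratic_bernstein[OF that] algebra_simps)
    show "?X n 1 = 0" if "n < 0" for n
      using that by (simp add: bernstein_one normal_power_0_one lin_zero[OF lin_bernstein] hh_neg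
          lin_zero[OF lin_normal_power])
    show "Poly_Mapping.lookup (?X n 1) 0 = 0" for n
      by (simp add: bernstein_one normal_power_0_one lin_zero[OF lin_bernstein] lookup_minus lookup_add
          lookup_0_normal_power lookup_0_hh lookup_of_int_mult del: of_int_mult)
  qed
  then show ?thesis by (simp add: algebra_simps)
qed

subsection \<open>Bernstein operators and complete homogeneous symmetric functions\<close>

text \<open>
  \<open>p\<^sub>k \<mapsto> p\<^sub>k - w\<^sup>k\<close> maps \<open>h\<^sub>k\<close> to \<open>h\<^sub>k - w h\<^sub>k\<^sub>-\<^sub>1\<close>. In the proof by Newton's identity the contributions of
  \<open>w\<^sup>r\<close> telescope.
\<close>
lemma bernstein_hh_mult:
  "bernstein n (hh k * f) = hh k * bernstein n f - hh (k - 1) * bernstein (n + 1) f"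
proof (cases "k < 0")
  case True
  then show ?thesis by (simp add: hh_neg lin_zero[OF lin_bernstein])
next
  case False
  define m where "m = nat k"
  have "bernstein n (hh (int m) * f) = hh (int m) * bernstein n f - hh (int m - 1) * bernstein (n + 1) f"
  proof (induction m arbitrary: n rule: less_induct)
    case (less m)
    show ?case
    proof (cases "m = 0")
      case True
      then show ?thesis by (simp add: hh_neg)
    next
      case m: False
      define G where "G i = hh (int m - int i) * bernstein (n + int i) f" for i
      have 1: "bernstein n (power_sum r * (hh (int m - int r) * f)) =
          power_sum r * hh (int m - int r) * bernstein n f -
          power_sum r * hh (int m - 1 - int r) * bernstein (n + 1) f - (G r - G (Suc r))"
        if r: "r \<in> {1..m}" for r
      proof -
        have IH: "bernstein n' (hh (int m - int r) * f) = hh (int m - int r) * bernstein n' f -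
            hh (int m - 1 - int r) * bernstein (n' + 1) f" for n'
          using less[of "m - r" n'] r m by (simp add: of_nat_diff algebra_simps)
        have "r \<ge> 1" using r by simp
        then show ?thesis unfolding bernstein_power_sum[OF \<open>r \<ge> 1\<close>] IH G_def
          by (simp add: algebra_simps)
      qed
      have tel: "(\<Sum>r=1..m. G r - G (Suc r)) = hh (int m - 1) * bernstein (n + 1) f"
      proof -
        have "(\<Sum>r=1..k. G r - G (Suc r)) = G 1 - G (Suc k)" for k
          by (induction k) simp_all
        then show ?thesis by (simp add: G_def hh_neg)
      qed
      have "of_nat m * bernstein n (hh (int m) * f) = bernstein n ((of_int (int m) * hh (int m)) * f)"
        by (simp add: mult.assoc lin_of_nat[OF lin_bernstein])
      also have "\<dots> = (\<Sum>r=1..m. bernstein n (power_sum r * (hh (int m - int r) * f)))"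
        by (simp only: newton_hh[OF order_refl, symmetric] sum_distrib_right mult.assoc
            lin_sum[OF lin_bernstein])
      also have "\<dots> = (\<Sum>r=1..m. power_sum r * hh (int m - int r)) * bernstein n f -
          (\<Sum>r=1..m. power_sum r * hh (int m - 1 - int r)) * bernstein (n + 1) f -
          (\<Sum>r=1..m. G r - G (Suc r))"
        by (simp only: sum.cong[OF refl 1] sum_subtractf sum_distrib_right)
      also have "\<dots> = of_nat m * (hh (int m) * bernstein n f - hh (int m - 1) * bernstein (n + 1) f)"
        unfolding tel newton_hh[OF order_refl]
        by (subst newton_hh) (simp_all add: algebra_simps)
      finally have "of_nat m * (bernstein n (hh (int m) * f) -
          (hh (int m) * bernstein n f - hh (int m - 1) * bernstein (n + 1) f)) = 0"
        by (simp add: algebra_simps)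
      from of_nat_mult_eq_0D[OF this m] show ?thesis by simp
    qed
  qed
  then show ?thesis using False by (simp add: m_def)
qed

lemma bernstein_hh: "bernstein n (hh k) = hh k * hh n - hh (k - 1) * hh (n + 1)"
  using bernstein_hh_mult[of n k 1] by (simp add: bernstein_one)

text \<open>
  The rule for exchanging two rows in a Jacobi--Trudi determinant, as an identity of operators.
\<close>
lemma bernstein_exchange:
  "bernstein m (bernstein n f) = - bernstein (n - 1) (bernstein (m + 1) f)"
proof -
  have "\<forall>m n. bernstein m (bernstein n f) + bernstein (n - 1) (bernstein (m + 1) f) = 0"
  proof (induction f rule: symfun_induct)
    case one
    show ?case by (simp add: bernstein_one bernstein_hh algebra_simps)
  next
    case (power_sum k f)
    show ?case
    proof (intro allI)
      fix m n
      have "bernstein m (bernstein n (power_sum k * f)) + bernstein (n - 1) (bernstein (m + 1) (power_sum k * f)) =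
         power_sum k * (bernstein m (bernstein n f) + bernstein (n - 1) (bernstein (m + 1) f)) -
         (bernstein (m + int k) (bernstein n f) + bernstein (n - 1) (bernstein (m + int k + 1) f)) -
         (bernstein m (bernstein (n + int k) f) + bernstein (n + int k - 1) (bernstein (m + 1) f))"
        by (simp only: bernstein_power_sum[OF power_sum(1)] lin_diff[OF lin_bernstein])
          (simp add: algebra_simps)
      with power_sum(2) show "bernstein m (bernstein n (power_sum k * f)) +
          bernstein (n - 1) (bernstein (m + 1) (power_sum k * f)) = 0" by simp
    qed
  next
    case (smul c f)
    then show ?case by (simp add: lin_smul[OF lin_bernstein] flip: symfun.scale_right_distrib)
  next
    case (add f g)
    show ?case
    proof (intro allI)
      fix m n
      have "bernstein m (bernstein n (f + g)) + bernstein (n - 1) (bernstein (m + 1) (f + g)) =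
        (bernstein m (bernstein n f) + bernstein (n - 1) (bernstein (m + 1) f)) +
        (bernstein m (bernstein n g) + bernstein (n - 1) (bernstein (m + 1) g))"
        by (simp add: lin_add[OF lin_bernstein])
      with add show "bernstein m (bernstein n (f + g)) + bernstein (n - 1) (bernstein (m + 1) (f + g)) = 0"
        by simp
    qed
  qed
  then show ?thesis by (simp add: eq_neg_iff_add_eq_0)
qed

lemma bernstein_exchange_Suc: "bernstein n (bernstein (n + 1) f) = 0"
proof -
  have "bernstein n (bernstein (n + 1) f) = - bernstein n (bernstein (n + 1) f)"
    using bernstein_exchange[of n "n + 1" f] by simp
  then have "of_nat 2 * bernstein n (bernstein (n + 1) f) = 0"
    by (metis add.right_inverse mult_2 of_nat_numeral)
  from of_nat_mult_eq_0D[OF this] show ?thesis by simp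
qed

section \<open>Schur functions and Bernstein operators\<close>

subsection \<open>The Jacobi--Trudi determinant row by row\<close>

text \<open>
  The linear map \<open>w\<^sup>i \<mapsto> h\<^sub>n\<^sub>+\<^sub>i\<close>. It turns the image of \<open>f\<close> under \<open>p\<^sub>k \<mapsto> p\<^sub>k - w\<^sup>k\<close> into \<open>B\<^sub>n f\<close>; on products
  of complete homogeneous symmetric functions this is \<open>bernstein_prod_hh\<close>.
\<close>
definition poly_act :: "int \<Rightarrow> 'a::field_char_0 symfun poly \<Rightarrow> 'a symfun" where
  "poly_act n P = (\<Sum>i\<le>Polynomial.degree P. Polynomial.coeff P i * hh (n + int i))"

lemma poly_act_eq_sum:
  "Polynomial.degree P \<le> N \<Longrightarrow> poly_act n P = (\<Sum>i\<le>N. Polynomial.coeff P i * hh (n + int i))"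
  unfolding poly_act_def
  by (intro sum.mono_neutral_left) (auto simp: coeff_eq_0)

lemma poly_act_add: "poly_act n (P + Q) = poly_act n P + poly_act n Q"
proof -
  let ?N = "max (Polynomial.degree P) (Polynomial.degree Q)"
  have "Polynomial.degree (P + Q) \<le> ?N" by (rule degree_add_le) simp_all
  then show ?thesis
    by (simp add: poly_act_eq_sum[of _ ?N] distrib_right sum.distrib)
qed

lemma poly_act_0 [simp]: "poly_act n 0 = 0"
  by (simp add: poly_act_def)

lemma poly_act_smult: "poly_act n (smult a P) = a * poly_act n P"
  by (simp add: poly_act_eq_sum[of "smult a P" "Polynomial.degree P"] poly_act_def
      degree_smult_le sum_distrib_left mult.assoc)

lemma poly_act_pCons: "poly_act n (pCons a P) = a * hh n + poly_act (n + 1) P"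
proof -
  have "poly_act n (pCons a P) =
      (\<Sum>i\<le>Suc (Polynomial.degree P). Polynomial.coeff (pCons a P) i * hh (n + int i))"
    by (rule poly_act_eq_sum) (simp add: degree_pCons_le)
  also have "\<dots> = a * hh n + poly_act (n + 1) P"
    by (subst sum.atMost_Suc_shift) (simp add: poly_act_def add.commute add.left_commute)
  finally show ?thesis .
qed

lemma poly_act_sum: "poly_act n (\<Sum>i\<in>I. P i) = (\<Sum>i\<in>I. poly_act n (P i))"
  by (induction I rule: infinite_finite_induct) (simp_all add: poly_act_add)

lemma poly_act_linear_factor: "poly_act n ([:a, b:] * P) = a * poly_act n P + b * poly_act (n + 1) P"
  by (simp add: mult_pCons_left poly_act_add poly_act_smult poly_act_pCons)

lemma poly_act_monom: "poly_act n (Polynomial.monom a j) = a * hh (n + int j)"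
  by (induction j arbitrary: n) (simp_all add: monom_0 monom_Suc poly_act_pCons add.assoc)

lemma poly_act_of_int: "poly_act n (of_int c * P) = of_int c * poly_act n P"
  by (simp add: of_int_poly poly_act_smult)

lemma bernstein_prod_hh:
  "finite I \<Longrightarrow> bernstein n (\<Prod>i\<in>I. hh (k i)) = poly_act n (\<Prod>i\<in>I. [:hh (k i), - hh (k i - 1):])"
proof (induction I arbitrary: n rule: finite_induct)
  case empty
  show ?case using poly_act_monom[of n 1 0, symmetric] by (simp add: bernstein_one monom_0 one_pCons)
next
  case (insert i I)
  show ?case
    unfolding prod.insert[OF insert.hyps] bernstein_hh_mult poly_act_linear_factor insert.IH by simp
qed

lemma bernstein_det_hh:
  "bernstein n (det (mat r r (\<lambda>(i, j). hh (k i j)))) =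
    poly_act n (det (mat r r (\<lambda>(i, j). [:hh (k i j), - hh (k i j - 1):])))"
proof -
  have perm: "p i < r" if "p permutes {0..<r}" "i < r" for p i
    using permutes_in_image[OF that(1), of i] that(2) by simp
  have "bernstein n (det (mat r r (\<lambda>(i, j). hh (k i j)))) =
      (\<Sum>p | p permutes {0..<r}. signof p * bernstein n (\<Prod>i = 0..<r. hh (k i (p i))))"
    using perm by (simp add: det_def'[OF mat_carrier] lin_sum[OF lin_bernstein] lin_of_int[OF lin_bernstein])
  also have "\<dots> = (\<Sum>p | p permutes {0..<r}.
      signof p * poly_act n (\<Prod>i = 0..<r. [:hh (k i (p i)), - hh (k i (p i) - 1):]))"
    by (simp add: bernstein_prod_hh)
  also have "\<dots> = poly_act n (det (mat r r (\<lambda>(i, j). [:hh (k i j), - hh (k i j - 1):])))"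
    using perm by (simp add: det_def'[OF mat_carrier] poly_act_sum poly_act_of_int)
  finally show ?thesis .
qed

lemma coeff_lift_hom: "comm_ring_hom (\<lambda>a :: 'a::comm_ring_1. [:a:])"
  by unfold_locales (simp_all add: one_pCons)

text \<open>
  Both sides are the determinant of the matrix with first row \<open>1, w, w\<^sup>2, \<dots>\<close> and the rows of \<open>x\<close> below.
  The right-hand side is the expansion along that row. For the left-hand side, subtract \<open>w\<close> times
  each column from the next one, which turns the first row into \<open>1, 0, 0, \<dots>\<close>.
\<close>
lemma det_linear_entries_eq_sum_cofactors:
  fixes x :: "nat \<Rightarrow> nat \<Rightarrow> 'a::comm_ring_1" and v :: "nat \<Rightarrow> 'a" and r :: nat
  defines "S \<equiv> mat (Suc r) (Suc r) (\<lambda>(i, j). case i of 0 \<Rightarrow> v j | Suc i \<Rightarrow> x i j)"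
  shows "det (mat r r (\<lambda>(i, j). [:x i (Suc j), - x i j:])) =
    (\<Sum>j<Suc r. Polynomial.monom (cofactor S 0 j) j)"
proof -
  let ?n = "Suc r"
  define M where "M = mat ?n ?n (\<lambda>(i, j). case i of 0 \<Rightarrow> Polynomial.monom (1 :: 'a) j | Suc i \<Rightarrow> [:x i j:])"
  \<comment> \<open>Multiplication by \<open>T\<close> from the right performs the column operations.\<close>
  define T where "T = mat ?n ?n (\<lambda>(i, j). if i = j then 1 else if j = Suc i then [:0, - 1 :: 'a:] else 0)"
  have M: "M \<in> carrier_mat ?n ?n" and T: "T \<in> carrier_mat ?n ?n" by (auto simp: M_def T_def)
  have MT: "M * T \<in> carrier_mat ?n ?n" using M T by simp
  have M0: "M $$ (0, l) = Polynomial.monom 1 l" if "l < ?n" for l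
    using that by (simp add: M_def)
  have MS: "M $$ (Suc i, l) = [:x i l:]" if "i < r" "l < ?n" for i l
    using that by (simp add: M_def)
  have entry: "(M * T) $$ (i, j) = M $$ (i, j) + (if j = 0 then 0 else M $$ (i, j - 1) * [:0, - 1:])"
    if "i < ?n" "j < ?n" for i j
  proof -
    have "(M * T) $$ (i, j) = (\<Sum>l = 0..<?n. M $$ (i, l) * T $$ (l, j))"
      using that M T by (simp add: scalar_prod_def)
    also have "\<dots> = (\<Sum>l = 0..<?n. (if l = j then M $$ (i, j) else 0) +
        (if l = j - 1 \<and> j \<noteq> 0 then M $$ (i, j - 1) * [:0, - 1:] else 0))"
      using that by (intro sum.cong) (auto simp: T_def)
    also have "\<dots> = M $$ (i, j) + (if j = 0 then 0 else M $$ (i, j - 1) * [:0, - 1:])"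
      unfolding sum.distrib using that by auto
    finally show ?thesis .
  qed
  have detT: "det T = 1"
  proof -
    have "upper_triangular T" by (auto simp: T_def)
    then have "det T = prod_list (diag_mat T)" using T by (rule det_upper_triangular)
    also have "diag_mat T = map (\<lambda>i. 1) [0..<?n]"
      unfolding diag_mat_def by (auto simp: T_def)
    finally show ?thesis by (simp add: map_replicate_const)
  qed
  have "det (M * T) = (\<Sum>j<?n. (M * T) $$ (0, j) * cofactor (M * T) 0 j)"
    by (rule laplace_expansion_row[OF MT]) simp
  also have "\<dots> = (\<Sum>j<?n. if j = 0 then cofactor (M * T) 0 0 else 0)"
  proof (rule sum.cong[OF refl])
    fix j assume "j \<in> {..<?n}"
    then show "(M * T) $$ (0, j) * cofactor (M * T) 0 j = (if j = 0 then cofactor (M * T) 0 0 else 0)"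
      by (cases j) (auto simp: entry M0 monom_0 one_pCons monom_Suc)
  qed
  also have "\<dots> = det (mat_delete (M * T) 0 0)" by (simp add: cofactor_def)
  also have "mat_delete (M * T) 0 0 = mat r r (\<lambda>(i, j). [:x i (Suc j), - x i j:])"
    by (intro eq_matI) (auto simp: mat_delete_def entry MS carrier_matD[OF MT] carrier_matD[OF M] carrier_matD[OF T]
        simp del: index_mult_mat(1))
  finally have 1: "det (mat r r (\<lambda>(i, j). [:x i (Suc j), - x i j:])) = det M"
    using det_mult[OF M T] detT by simp
  have "det M = (\<Sum>j<?n. M $$ (0, j) * cofactor M 0 j)"
    by (rule laplace_expansion_row[OF M]) simp
  also have "\<dots> = (\<Sum>j<?n. Polynomial.monom (cofactor S 0 j) j)"
  proof (rule sum.cong[OF refl])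
    fix j assume j: "j \<in> {..<?n}"
    have "mat_delete M 0 j = map_mat (\<lambda>a. [:a:]) (mat_delete S 0 j)"
      by (rule eq_matI) (auto simp: mat_delete_def M_def S_def)
    then have "det (mat_delete M 0 j) = [:det (mat_delete S 0 j):]"
      by (simp add: comm_ring_hom.hom_det[OF coeff_lift_hom])
    then have "cofactor M 0 j = [:cofactor S 0 j:]"
      by (cases "even j") (simp_all add: cofactor_def)
    with j show "M $$ (0, j) * cofactor M 0 j = Polynomial.monom (cofactor S 0 j) j"
      by (simp add: M_def mult.commute[of "Polynomial.monom 1 j"] smult_monom)
  qed
  finally show ?thesis using 1 by simp
qed

lemma schur_Nil [simp]: "schur [] = 1"
  by (simp add: schur_def)

text \<open>
  \<open>B\<^sub>n s\<^sub>\<lambda>\<close> is obtained from the determinant of \<open>s\<^sub>\<lambda>\<close> by replacing each entry \<open>h\<^sub>m\<close> with \<open>h\<^sub>m - w h\<^sub>m\<^sub>-\<^sub>1\<close> and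
  then \<open>w\<^sup>i\<close> with \<open>h\<^sub>n\<^sub>+\<^sub>i\<close>. By \<open>det_linear_entries_eq_sum_cofactors\<close> this is the expansion of the
  larger determinant along its first row.
\<close>
lemma schur_Cons: "schur (n # la) = (bernstein (int n) (schur la) :: 'a::field_char_0 symfun)"
proof -
  let ?r = "length la"
  define x :: "nat \<Rightarrow> nat \<Rightarrow> 'a symfun" where "x = (\<lambda>i j. hh (int (la ! i) - int (Suc i) + int j))"
  define S where "S = mat (Suc ?r) (Suc ?r)
    (\<lambda>(i, j). case i of 0 \<Rightarrow> hh (int n + int j) | Suc i \<Rightarrow> x i j)"
  have "schur la = det (mat ?r ?r (\<lambda>(i, j). hh (int (la ! i) - int i + int j)) :: 'a symfun mat)"
    by (simp add: schur_def)
  then have "bernstein (int n) (schur la :: 'a symfun) = poly_act (int n) (det (mat ?r ?r (\<lambda>(i, j).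
      [:hh (int (la ! i) - int i + int j), - hh (int (la ! i) - int i + int j - 1):])) )"
    by (simp only: bernstein_det_hh[where k = "\<lambda>i j. int (la ! i) - int i + int j"])
  also have "mat ?r ?r (\<lambda>(i, j).
      [:hh (int (la ! i) - int i + int j), - hh (int (la ! i) - int i + int j - 1):]) =
      mat ?r ?r (\<lambda>(i, j). [:x i (Suc j), - x i j:])"
    by (rule eq_matI) (simp_all add: x_def algebra_simps)
  also have "poly_act (int n) (det (mat ?r ?r (\<lambda>(i, j). [:x i (Suc j), - x i j:]))) =
      (\<Sum>j<Suc ?r. S $$ (0, j) * cofactor S 0 j)"
    unfolding det_linear_entries_eq_sum_cofactors[where v = "\<lambda>j. hh (int n + int j)", folded S_def] poly_act_sum poly_act_monom
    by (intro sum.cong refl) (simp add: S_def mult.commute)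
  also have "\<dots> = det S"
    by (rule laplace_expansion_row[symmetric]) (simp_all add: S_def)
  also have "S = mat (length (n # la)) (length (n # la))
      (\<lambda>(i, j). hh (int ((n # la) ! i) - int i + int j))"
    by (rule eq_matI) (auto simp: S_def x_def split: nat.splits)
  finally show ?thesis by (simp add: schur_def)
qed

subsection \<open>Schur functions span\<close>

definition bern_list :: "int list \<Rightarrow> 'a::field_char_0 symfun" where
  "bern_list ls = foldr bernstein ls 1"

lemma bern_list_simps [simp]:
  "bern_list [] = 1" "bern_list (n # ls) = bernstein n (bern_list ls)"
  by (simp_all add: bern_list_def)

lemma bern_list_eq_schur: "bern_list (map int la) = schur la"
  by (induction la) (simp_all add: schur_Cons)

lemma bern_list_snoc: "bern_list (ls @ [n]) = foldr bernstein ls (hh n)"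
  by (simp add: bern_list_def bernstein_one)

text \<open>
  One step of insertion sort by the exchange rule. The bound on the head of the result makes sure that
  the row put in front of it afterwards keeps the list sorted.
\<close>
lemma bernstein_straighten:
  assumes "sorted_wrt (\<ge>) ls"
  shows "\<exists>mu. sorted_wrt (\<ge>) mu \<and> mu \<noteq> [] \<and> hd mu \<le> (if ls = [] then n else max n (hd ls - 1)) \<and>
    bernstein n (bern_list ls) \<in> {bern_list mu, - bern_list mu, 0 :: 'a::field_char_0 symfun}"
  using assms
proof (induction ls arbitrary: n)
  case Nil
  show ?case by (intro exI[of _ "[n]"]) simp
next
  case (Cons l ls)
  consider "n \<ge> l" | "n = l - 1" | "n < l - 1" by linarith
  then show ?case
  proof cases
    case 1
    then show ?thesis using Cons.prems by (intro exI[of _ "n # l # ls"]) auto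
  next
    case 2
    then have "bernstein n (bern_list (l # ls)) = (0 :: 'a symfun)"
      using bernstein_exchange_Suc[of n] by simp
    then show ?thesis by (intro exI[of _ "[n]"]) simp
  next
    case 3
    from Cons have "sorted_wrt (\<ge>) ls" by simp
    from Cons.IH[OF this, of "n + 1"] obtain mu where mu: "sorted_wrt (\<ge>) mu" "mu \<noteq> []"
      "hd mu \<le> (if ls = [] then n + 1 else max (n + 1) (hd ls - 1))"
      "bernstein (n + 1) (bern_list ls) \<in> {bern_list mu, - bern_list mu, 0 :: 'a symfun}" by blast
    have hd: "hd mu \<le> l - 1"
      using mu(3) 3 Cons.prems by (cases ls) auto
    have "sorted_wrt (\<ge>) ((l - 1) # mu)"
      using mu(1,2) hd by (cases mu) auto
    moreover have "bernstein n (bern_list (l # ls)) \<in>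
        {bern_list ((l - 1) # mu), - bern_list ((l - 1) # mu), 0 :: 'a symfun}"
      using mu(4) bernstein_exchange[of n l "bern_list ls :: 'a symfun"]
      by (auto simp: lin_uminus[OF lin_bernstein] lin_zero[OF lin_bernstein])
    ultimately show ?thesis using 3 by (intro exI[of _ "(l - 1) # mu"]) auto
  qed
qed

lemma bern_list_sorted:
  assumes "sorted_wrt (\<ge>) mu"
  shows "bern_list mu = (0 :: 'a::field_char_0 symfun) \<or> (\<exists>la. is_partition la \<and> bern_list mu = (schur la :: 'a symfun))"
  using assms
proof (induction mu rule: rev_induct)
  case Nil
  show ?case by (intro disjI2 exI[of _ "[]"]) (simp add: is_partition_def)
next
  case (snoc n mu)
  have zero: "foldr bernstein mu 0 = (0 :: 'a symfun)"
    by (induction mu) (simp_all add: lin_zero[OF lin_bernstein])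
  consider "n < 0" | "n = 0" | "n > 0" by linarith
  then show ?case
  proof cases
    case 1
    then show ?thesis by (simp add: bern_list_snoc hh_neg zero)
  next
    case 2
    then show ?thesis using snoc by (simp add: bern_list_snoc sorted_wrt_append) (simp add: bern_list_def)
  next
    case 3
    define la where "la = map nat (mu @ [n])"
    have pos: "\<forall>x\<in>set (mu @ [n]). x > 0" using 3 snoc.prems by (auto simp: sorted_wrt_append)
    then have "map int la = mu @ [n]" by (auto simp: la_def intro!: map_idI)
    moreover have "is_partition la"
      using snoc.prems pos by (auto simp: la_def is_partition_def sorted_wrt_append sorted_wrt_map
          intro: sorted_wrt_mono_rel[rotated])
    ultimately show ?thesis by (metis bern_list_eq_schur)
  qed
qed

abbreviation schur_span :: "'a::field_char_0 symfun set" where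
  "schur_span \<equiv> symfun.span (schur ` {la. is_partition la})"

lemma bern_list_straighten:
  "\<exists>mu. sorted_wrt (\<ge>) mu \<and> bern_list ls \<in> {bern_list mu, - bern_list mu, 0 :: 'a::field_char_0 symfun}"
proof (induction ls)
  case Nil
  show ?case by (intro exI[of _ "[]"]) simp
next
  case (Cons n ls)
  then obtain mu where mu: "sorted_wrt (\<ge>) mu"
    "bern_list ls \<in> {bern_list mu, - bern_list mu, 0 :: 'a symfun}" by blast
  from bernstein_straighten[OF mu(1), of n, where 'a = 'a] obtain nu where "sorted_wrt (\<ge>) nu"
    "bernstein n (bern_list mu) \<in> {bern_list nu, - bern_list nu, 0 :: 'a symfun}" by blast
  with mu(2) show ?case
    by (intro exI[of _ nu]) (auto simp: lin_uminus[OF lin_bernstein] lin_zero[OF lin_bernstein])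
qed

lemma bern_list_in_schur_span: "bern_list ls \<in> schur_span"
proof -
  obtain mu where mu: "sorted_wrt (\<ge>) mu"
    "bern_list ls \<in> {bern_list mu, - bern_list mu, 0 :: 'a symfun}"
    using bern_list_straighten[of ls, where 'a = 'a] by blast
  have "bern_list mu \<in> (schur_span :: 'a symfun set)"
    using bern_list_sorted[OF mu(1), where 'a = 'a]
    by (auto intro: symfun.span_zero symfun.span_base)
  with mu(2) show ?thesis by (auto intro: symfun.span_zero symfun.span_neg)
qed

abbreviation bern_span :: "'a::field_char_0 symfun set" where
  "bern_span \<equiv> symfun.span (range bern_list)"

lemma lin_span_closed:
  assumes "lin T" "\<And>x. x \<in> S \<Longrightarrow> T x \<in> symfun.span S'" "f \<in> symfun.span S"
  shows "T f \<in> symfun.span S'"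
  using assms(3)
proof (induction rule: symfun.span_induct_alt)
  case base
  then show ?case by (simp add: lin_zero[OF assms(1)] symfun.span_zero)
next
  case (step c x y)
  then show ?case
    by (simp add: lin_add[OF assms(1)] lin_smul[OF assms(1)] assms(2) symfun.span_add symfun.span_scale)
qed

lemma bern_span_bernstein: "f \<in> bern_span \<Longrightarrow> bernstein n f \<in> bern_span"
proof (rule lin_span_closed[OF lin_bernstein])
  show "bernstein n x \<in> bern_span" if "x \<in> range bern_list" for x :: "'a symfun"
    using that by (metis bern_list_simps(2) imageE rangeI symfun.span_base)
qed

lemma bern_span_perp:
  assumes "k \<ge> 1" shows "f \<in> bern_span \<Longrightarrow> power_sum_perp k f \<in> bern_span"
proof (rule lin_span_closed[OF lin_power_sum_perp])
  fix x :: "'a symfun" assume "x \<in> range bern_list"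
  then obtain ls where x: "x = bern_list ls" by blast
  have "power_sum_perp k (bern_list ls) \<in> (bern_span :: 'a symfun set)"
  proof (induction ls)
    case Nil
    then show ?case by (simp add: symfun.span_zero)
  next
    case (Cons n ls)
    have "bern_list ls \<in> (bern_span :: 'a symfun set)" by (simp add: symfun.span_base)
    with Cons show ?case
      by (simp add: bernstein_perp[OF assms] bern_span_bernstein symfun.span_add)
  qed
  then show "power_sum_perp k x \<in> bern_span" by (simp add: x)
qed

lemma bern_span_elem_perp: "f \<in> bern_span \<Longrightarrow> elem_perp n f \<in> bern_span"
proof (induction n arbitrary: f rule: less_induct)
  case (less n)
  show ?case
  proof (cases n)
    case (Suc m)
    have "elem_perp (m - i) (power_sum_perp (Suc i) f) \<in> bern_span" for i
      by (intro less.IH bern_span_perp less.prems) (simp_all add: Suc)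
    then show ?thesis
      by (auto simp: Suc intro!: symfun.span_neg symfun.span_scale symfun.span_sum)
  qed (simp add: less.prems)
qed

text \<open>
  \<open>h\<^sub>n f\<close> is the first summand of \<open>B\<^sub>n f\<close>, and the others involve arguments of smaller degree.
\<close>
lemma bern_span_hh:
  assumes "weight_le d f" "f \<in> bern_span" shows "hh n * f \<in> bern_span"
  using assms
proof (induction d arbitrary: f n rule: less_induct)
  case (less d)
  have "bernstein n f = hh n * f + (\<Sum>i\<in>{1..d}. hh (n + int i) * elem_perp i f)"
    by (simp add: bernstein_eq_sum[OF less.prems(1) order_refl] atMost_atLeast0 sum.atLeast_Suc_atMost)
  then have "hh n * f = bernstein n f - (\<Sum>i\<in>{1..d}. hh (n + int i) * elem_perp i f)" by simp
  moreover have "hh (n + int i) * elem_perp i f \<in> bern_span" if "i \<in> {1..d}" for i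
  proof (rule less.IH)
    show "d - i < d" using that by auto
    show "weight_le (d - i) (elem_perp i f)"
      using weight_le_elem_perp[OF less.prems(1), of i] that by auto
    show "elem_perp i f \<in> bern_span" by (rule bern_span_elem_perp[OF less.prems(2)])
  qed
  ultimately show ?case
    using less.prems(2) by (auto intro!: symfun.span_diff symfun.span_sum bern_span_bernstein)
qed

lemma bern_span_power_sum:
  assumes "k \<ge> 1" "f \<in> bern_span" shows "power_sum k * f \<in> bern_span"
  using assms
proof (induction k arbitrary: f rule: less_induct)
  case (less k)
  have hh: "hh n * g \<in> bern_span" if "g \<in> bern_span" for n and g :: "'a symfun"
    using bern_span_hh that weight_le_exists by blast
  have "of_int (int k) * hh (int k) = (\<Sum>r=1..k. power_sum r * (hh (int k - int r) :: 'a symfun))"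
    by (rule newton_hh[symmetric]) simp
  also have "{1..k} = insert k {1..<k}" using less.prems(1) by auto
  finally have "power_sum k = of_int (int k) * hh (int k) -
      (\<Sum>r\<in>{1..<k}. power_sum r * (hh (int k - int r) :: 'a symfun))" by simp
  then have "power_sum k * f = smul (of_int (int k)) (hh (int k) * f) -
      (\<Sum>r\<in>{1..<k}. power_sum r * (hh (int k - int r) * f))"
    by (simp only: smul_of_int left_diff_distrib sum_distrib_right mult.assoc)
  then show ?case
    using less hh by (auto intro!: symfun.span_diff symfun.span_scale symfun.span_sum)
qed

text \<open>
  The span contains \<open>1\<close> and is an ideal: being closed under multiplication by the \<open>h\<^sub>n\<close>, it is closed under
  multiplication by the \<open>p\<^sub>k\<close>, by Newton's identity.
\<close>
lemma bern_span_UNIV: "f \<in> bern_span"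
proof (induction f rule: symfun_induct)
  case one
  have "bern_list [] \<in> (bern_span :: 'a symfun set)" by (intro symfun.span_base rangeI)
  then show ?case by simp
qed (auto intro: bern_span_power_sum symfun.span_scale symfun.span_add)

lemma schur_span_UNIV: "f \<in> schur_span"
  using lin_span_closed[OF lin_ident, of "range bern_list" "schur ` {la. is_partition la}" f]
    bern_span_UNIV bern_list_in_schur_span by blast

lemma lin_eq_on_schur:
  assumes "lin S" "lin T" "\<And>la. is_partition la \<Longrightarrow> S (schur la) = T (schur la)"
  shows "S = T"
proof
  fix f :: "'a symfun"
  have "f \<in> schur_span" by (rule schur_span_UNIV)
  then show "S f = T f"
  proof (induction rule: symfun.span_induct_alt)
    case base
    then show ?case by (simp add: lin_zero[OF assms(1)] lin_zero[OF assms(2)])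
  next
    case (step c x y)
    then show ?case
      by (auto simp: lin_add[OF assms(1)] lin_add[OF assms(2)] lin_smul[OF assms(1)]
          lin_smul[OF assms(2)] assms(3))
  qed
qed

section \<open>Contents and the operators \<open>U\<^sub>k\<close>\<close>

lemma is_partition_Cons: "is_partition (x # xs) \<longleftrightarrow> x > 0 \<and> (\<forall>y\<in>set xs. y \<le> x) \<and> is_partition xs"
  by (auto simp: is_partition_def)

lemma is_partition_Nil [simp]: "is_partition []"
  by (simp add: is_partition_def)

lemma diagram_Nil [simp]: "diagram [] = {}"
  and diagram_Cons_0 [simp]: "(0, j) \<in> diagram (x # xs) \<longleftrightarrow> j < x"
  and diagram_Cons_Suc [simp]: "(Suc i, j) \<in> diagram (x # xs) \<longleftrightarrow> (i, j) \<in> diagram xs"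
  by (auto simp: diagram_def)

lemma diagram_Cons: "diagram (x # xs) = Pair 0 ` {..<x} \<union> apfst Suc ` diagram xs"
proof (rule Set.set_eqI)
  fix b :: "nat \<times> nat"
  obtain i j where b: "b = (i, j)" by (cases b)
  show "b \<in> diagram (x # xs) \<longleftrightarrow> b \<in> Pair 0 ` {..<x} \<union> apfst Suc ` diagram xs"
    unfolding b by (cases i) (auto simp: image_iff apfst_def map_prod_def intro: rev_bexI)
qed

lemma finite_diagram: "finite (diagram la)"
  by (induction la) (simp_all add: diagram_Cons)

lemma diagram_inject:
  assumes "is_partition xs" "is_partition ys" "diagram xs = diagram ys"
  shows "xs = ys"
  using assms
proof (induction xs arbitrary: ys)
  case Nil
  then show ?case by (cases ys) (auto simp: is_partition_Cons diagram_Cons lessThan_empty_iff)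
next
  case (Cons x xs)
  have "(0, 0) \<in> diagram ys" using Cons.prems by (auto simp: is_partition_Cons simp flip: Cons.prems(3))
  then obtain y zs where ys: "ys = y # zs" by (cases ys) auto
  have rows: "(0, j) \<in> diagram (x # xs) \<longleftrightarrow> (0, j) \<in> diagram ys"
    "(Suc i, j) \<in> diagram (x # xs) \<longleftrightarrow> (Suc i, j) \<in> diagram ys" for i j
    by (simp_all only: Cons.prems(3))
  have "x = y"
    using rows(1)[of x] rows(1)[of y] by (simp add: ys)
  moreover have "diagram xs = diagram zs"
    using rows(2) by (auto simp: ys)
  ultimately show ?case using Cons by (auto simp: ys is_partition_Cons)
qed

lemma adds_cell_Nil: "adds_cell [] b mu \<longleftrightarrow> b = (0, 0) \<and> mu = [1]"
proof
  have d1: "diagram [1] = {(0, 0)}" by (auto simp: diagram_def)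
  show "adds_cell [] b mu" if "b = (0, 0) \<and> mu = [1]"
    using that d1 by (auto simp: adds_cell_def is_partition_Cons)
  assume a: "adds_cell [] b mu"
  then have mu: "is_partition mu" "diagram mu = {b}" by (auto simp: adds_cell_def)
  then obtain y ys where ys: "mu = y # ys" by (cases mu) auto
  with mu(1) have "(0, 0) \<in> diagram mu" by (auto simp: is_partition_Cons)
  with mu(2) have b: "b = (0, 0)" by auto
  with mu d1 diagram_inject[of mu "[1]"] show "b = (0, 0) \<and> mu = [1]" by (simp add: is_partition_Cons)
qed

text \<open>
  The new cell lies either in the first row or below it. Both sides being sets of pairs allows sums over
  all added cells to be split.
\<close>
lemma adds_cell_Cons:
  assumes la: "is_partition (x # xs)"
  shows "{(b, mu). adds_cell (x # xs) b mu} = insert ((0, x), Suc x # xs)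
    ((\<lambda>(b, mu). (apfst Suc b, x # mu)) ` {(b, mu). adds_cell xs b mu \<and> (\<forall>y\<in>set mu. y \<le> x)})"
    (is "?L = insert ?a ?R")
proof (intro equalityI subsetI)
  fix p assume "p \<in> ?L"
  then obtain i j mu where p: "p = ((i, j), mu)" and a: "adds_cell (x # xs) (i, j) mu"
    by (cases p) auto
  then have mu: "is_partition mu" "(i, j) \<notin> diagram (x # xs)"
    "diagram mu = insert (i, j) (diagram (x # xs))" by (auto simp: adds_cell_def)
  have "(i, j) \<in> diagram mu" using mu(3) by simp
  then obtain y ys where ys: "mu = y # ys" by (cases mu) auto
  have rows: "(i', j') \<in> diagram mu \<longleftrightarrow> (i', j') = (i, j) \<or> (i', j') \<in> diagram (x # xs)" for i' j'
    by (simp add: mu(3))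
  show "p \<in> insert ?a ?R"
  proof (cases i)
    case 0
    have r0: "j' < y \<longleftrightarrow> j' = j \<or> j' < x" for j'
      using rows[of 0 j'] by (auto simp: ys 0)
    have "j \<ge> x" using mu(2) by (simp add: 0)
    then have "y = Suc x \<and> j = x"
      using r0[of j] r0[of x] r0[of "Suc x"] r0[of y] by linarith
    moreover have "diagram ys = diagram xs"
      using rows[of "Suc _"] by (auto simp: ys 0)
    then have "ys = xs" using diagram_inject[of ys xs] mu(1) la by (auto simp: ys is_partition_Cons)
    ultimately show ?thesis by (simp add: p 0 ys)
  next
    case (Suc i')
    have r0: "j' < y \<longleftrightarrow> j' < x" for j'
      using rows[of 0 j'] by (auto simp: ys Suc)
    have "y = x" using r0[of x] r0[of y] by linarith
    moreover have "diagram ys = insert (i', j) (diagram xs)"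
      using rows[of "Suc _"] by (auto simp: ys Suc)
    ultimately have "adds_cell xs (i', j) ys \<and> (\<forall>z\<in>set ys. z \<le> x)"
      using mu la by (auto simp: adds_cell_def ys Suc is_partition_Cons)
    then show ?thesis using \<open>y = x\<close> by (force simp: p Suc ys)
  qed
next
  fix p assume "p \<in> insert ?a ?R"
  then consider "p = ?a" | b mu where "adds_cell xs b mu" "\<forall>y\<in>set mu. y \<le> x" "p = (apfst Suc b, x # mu)"
    by auto
  then show "p \<in> ?L"
  proof cases
    case 1
    have "diagram (Suc x # xs) = insert (0, x) (diagram (x # xs))"
      by (auto simp: diagram_Cons lessThan_Suc)
    with la show ?thesis by (auto simp: 1 adds_cell_def is_partition_Cons)
  next
    case 2
    obtain i j where b: "b = (i, j)" by (cases b)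
    have "diagram (x # mu) = insert (Suc i, j) (diagram (x # xs))"
      using 2(1) by (auto simp: adds_cell_def diagram_Cons b)
    with la 2 show ?thesis by (auto simp: adds_cell_def is_partition_Cons b)
  qed
qed

lemma finite_adds_cell: "is_partition la \<Longrightarrow> finite {(b, mu). adds_cell la b mu}"
proof (induction la)
  case Nil
  have "{(b, mu). adds_cell [] b mu} = {((0, 0), [1])}" by (auto simp: adds_cell_Nil)
  then show ?case by simp
next
  case (Cons x xs)
  have "finite {(b, mu). adds_cell xs b mu}" using Cons by (simp add: is_partition_Cons)
  then have "finite {(b, mu). adds_cell xs b mu \<and> (\<forall>y\<in>set mu. y \<le> x)}"
    by (rule rev_finite_subset) auto
  then show ?case unfolding adds_cell_Cons[OF Cons.prems] by simp
qed

text \<open>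
  A cell added below the first row breaks the partition shape only if it makes the second row longer
  than the first by one, and then the exchange rule gives zero. Hence the terms missing in
  \<open>adds_cell_Cons\<close> do not contribute to Pieri's rule.
\<close>
lemma bernstein_schur_unbounded:
  assumes la: "is_partition (x # xs)" and a: "adds_cell xs b mu" and big: "\<not> (\<forall>y\<in>set mu. y \<le> x)"
  shows "bernstein (int x) (schur mu) = 0"
proof -
  have "\<exists>zs. mu = Suc x # zs"
  proof (cases xs)
    case Nil
    with a big la show ?thesis by (auto simp: adds_cell_Nil is_partition_Cons)
  next
    case (Cons z zs)
    from la Cons have z: "is_partition (z # zs)" "z \<le> x" by (auto simp: is_partition_Cons)
    have "(b, mu) \<in> {(b, mu). adds_cell (z # zs) b mu}" using a Cons by simp
    then consider "mu = Suc z # zs" | mu' where "mu = z # mu'"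
      unfolding adds_cell_Cons[OF z(1)] by auto
    then show ?thesis
    proof cases
      case 1
      have "\<forall>y\<in>set zs. y \<le> x" using z by (auto simp: is_partition_Cons)
      with 1 big z(2) have "z = x" by auto
      with 1 show ?thesis by simp
    next
      case 2
      have "is_partition mu" using a by (simp add: adds_cell_def)
      with 2 z(2) big show ?thesis by (auto simp: is_partition_Cons)
    qed
  qed
  then obtain zs where "mu = Suc x # zs" ..
  then show ?thesis using bernstein_exchange_Suc[of "int x" "schur zs"]
    by (simp add: schur_Cons add.commute)
qed

lemma pieri:
  assumes "is_partition la"
  shows "heis 1 (schur la) = (\<Sum>(b, mu)\<in>{(b, mu). adds_cell la b mu}. schur mu)"
  using assms
proof (induction la)
  case Nil
  have "{(b, mu). adds_cell [] b mu} = {((0, 0), [1])}" by (auto simp: adds_cell_Nil)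
  moreover have "heis 1 1 = (power_sum 1 :: 'a symfun)" using heis_int[of 1 1] by simp
  ultimately show ?case by (simp add: schur_Cons bernstein_one hh_1)
next
  case (Cons x xs)
  let ?A = "{(b, mu). adds_cell xs b mu}"
  let ?B = "{(b, mu). adds_cell xs b mu \<and> (\<forall>y\<in>set mu. y \<le> x)}"
  let ?g = "\<lambda>(b, mu). (apfst Suc b, x # mu)"
  have xs: "is_partition xs" using Cons.prems by (simp add: is_partition_Cons)
  have finA: "finite ?A" by (rule finite_adds_cell[OF xs])
  then have finB: "finite ?B" by (rule rev_finite_subset) auto
  have inj: "inj_on ?g ?B" by (auto simp: inj_on_def apfst_def map_prod_def)
  have notin: "((0, x), Suc x # xs) \<notin> ?g ` ?B" by auto
  have "heis 1 (schur (x # xs)) = bernstein (int x) (\<Sum>(b, mu)\<in>?A. schur mu) + (schur (Suc x # xs) :: 'a symfun)"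
    using Cons.IH[OF xs] by (simp add: schur_Cons heis_bernstein add.commute)
  also have "bernstein (int x) (\<Sum>(b, mu)\<in>?A. schur mu) = (\<Sum>(b, mu)\<in>?A. bernstein (int x) (schur mu :: 'a symfun))"
    by (simp add: lin_sum[OF lin_bernstein] case_prod_unfold)
  also have "\<dots> = (\<Sum>(b, mu)\<in>?B. schur (x # mu))"
  proof (rule sum.mono_neutral_cong_right[OF finA])
    show "?B \<subseteq> ?A" by auto
    show "\<forall>p\<in>?A - ?B. (case p of (b, mu) \<Rightarrow> bernstein (int x) (schur mu :: 'a symfun)) = 0"
      using bernstein_schur_unbounded[OF Cons.prems] by auto
  qed (auto simp: schur_Cons)
  also have "\<dots> = (\<Sum>(b, mu)\<in>?g ` ?B. schur mu)"
    unfolding sum.reindex[OF inj] by (intro sum.cong refl) auto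
  finally show ?case
    unfolding adds_cell_Cons[OF Cons.prems]
    using notin finB by (subst sum.insert) (auto simp: add.commute)
qed

definition content_sum :: "nat list \<Rightarrow> int" where
  "content_sum la = (\<Sum>b\<in>diagram la. content b)"

lemma content_sum_Nil: "content_sum [] = 0"
  by (simp add: content_sum_def)

lemma card_diagram: "card (diagram la) = sum_list la"
proof (induction la)
  case (Cons x xs)
  have inj: "inj_on (apfst Suc) (diagram xs)" "inj_on (Pair (0::nat)) {..<x}"
    by (auto simp: inj_on_def apfst_def map_prod_def prod_eq_iff)
  have "card (diagram (x # xs)) = card (Pair (0::nat) ` {..<x}) + card (apfst Suc ` diagram xs)"
    unfolding diagram_Cons by (rule card_Un_disjoint) (auto simp: finite_diagram)
  also have "\<dots> = x + card (diagram xs)"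
    by (simp add: card_image[OF inj(1)] card_image[OF inj(2)])
  finally show ?case using Cons by simp
qed simp

text \<open>
  Doubling avoids division. The sum of the parts is the number of cells that move down by one row.
\<close>
lemma content_sum_Cons:
  "2 * content_sum (x # xs) = int x * (int x - 1) + 2 * content_sum xs - 2 * int (sum_list xs)"
proof -
  have inj: "inj_on (apfst Suc) (diagram xs)" "inj_on (Pair (0::nat)) {..<x}"
    by (auto simp: inj_on_def apfst_def map_prod_def prod_eq_iff)
  have "content_sum (x # xs) = (\<Sum>b\<in>Pair 0 ` {..<x}. content b) + (\<Sum>b\<in>apfst Suc ` diagram xs. content b)"
    unfolding content_sum_def diagram_Cons by (rule sum.union_disjoint) (auto simp: finite_diagram)
  also have "\<dots> = (\<Sum>j<x. int j) + (\<Sum>b\<in>diagram xs. content b - 1)"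
    by (simp add: sum.reindex[OF inj(1)] sum.reindex[OF inj(2)] content_def algebra_simps)
  also have "(\<Sum>b\<in>diagram xs. content b - 1) = content_sum xs - int (sum_list xs)"
    by (simp add: sum_subtractf content_sum_def card_diagram)
  finally have "content_sum (x # xs) = (\<Sum>j<x. int j) + (content_sum xs - int (sum_list xs))" .
  moreover have "2 * (\<Sum>j<x. int j) = int x * (int x - 1)"
    by (induction x) (simp_all add: algebra_simps)
  ultimately show ?thesis by simp
qed

lemma content_sum_adds_cell: "adds_cell la b mu \<Longrightarrow> content_sum mu = content_sum la + content b"
  by (simp add: content_sum_def adds_cell_def finite_diagram)

lemma euler_schur: "normal_power 2 0 (schur la) = of_int (2 * int (sum_list la)) * schur la"
proof (induction la)
  case (Cons x xs)
  then show ?case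
    by (simp only: schur_Cons euler_bernstein lin_of_int[OF lin_bernstein]) (simp add: algebra_simps)
qed (simp add: normal_power_0_one)

lemma cubic_schur: "normal_power 3 0 (schur la) = of_int (6 * content_sum la) * schur la"
proof (induction la)
  case (Cons x xs)
  have "6 * content_sum (x # xs) = 6 * content_sum xs - 3 * (2 * int (sum_list xs)) + 3 * int x * (int x - 1)"
    using content_sum_Cons[of x xs] by simp
  moreover have "normal_power 3 0 (schur (x # xs)) = of_int (6 * content_sum xs - 3 * (2 * int (sum_list xs)) +
      3 * int x * (int x - 1)) * (schur (x # xs) :: 'a symfun)"
    by (simp only: schur_Cons cubic_bernstein Cons euler_schur lin_of_int[OF lin_bernstein])
      (simp add: algebra_simps)
  ultimately show ?case by simp
qed (simp add: normal_power_0_one content_sum_Nil)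

lemma cut_join_schur: "cut_join (schur la) = smul (of_int (content_sum la)) (schur la)"
  unfolding cut_join_def cubic_schur smul_of_int[symmetric] symfun.scale_scale by simp

text \<open>
  The commutator with \<open>D\<close> multiplies the coefficient of \<open>s\<^sub>\<mu>\<close> by the difference of the eigenvalues for \<open>\<mu>\<close> and
  \<open>\<lambda>\<close>, which is the content of the added cell.
\<close>
lemma ad_cut_join_schur:
  assumes la: "is_partition la"
  shows "ad_cut_join k (schur la) =
    (\<Sum>(b, mu)\<in>{(b, mu). adds_cell la b mu}. smul (of_int (content b) ^ k) (schur mu))"
proof (induction k)
  case 0
  show ?case using pieri[OF la] by (simp add: ad_cut_join_0)
next
  case (Suc k)
  let ?A = "{(b, mu). adds_cell la b mu}"
  have "ad_cut_join (Suc k) (schur la) =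
      (\<Sum>(b, mu)\<in>?A. cut_join (smul (of_int (content b) ^ k) (schur mu))) -
      smul (of_int (content_sum la)) (\<Sum>(b, mu)\<in>?A. smul (of_int (content b) ^ k) (schur mu :: 'a symfun))"
    by (simp add: ad_cut_join_Suc commutator_def Suc lin_sum[OF lin_cut_join] cut_join_schur
        lin_smul[OF lin_ad_cut_join] case_prod_unfold)
  also have "\<dots> = (\<Sum>(b, mu)\<in>?A. smul (of_int (content b) ^ Suc k) (schur mu))"
    unfolding symfun.scale_sum_right sum_subtractf[symmetric]
  proof (rule sum.cong[OF refl], clarify)
    fix i j mu assume "adds_cell la (i, j) mu"
    then have c: "content (i, j) = content_sum mu - content_sum la" by (simp add: content_sum_adds_cell)
    show "cut_join (smul (of_int (content (i, j)) ^ k) (schur mu)) -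
        smul (of_int (content_sum la)) (smul (of_int (content (i, j)) ^ k) (schur mu)) =
        smul (of_int (content (i, j)) ^ Suc k) (schur mu :: 'a symfun)"
      unfolding lin_smul[OF lin_cut_join] cut_join_schur symfun.scale_scale c
      by (simp add: algebra_simps flip: symfun.scale_left_diff_distrib)
  qed
  finally show ?case .
qed

lemma U_op_eq: "U_op k = ad_cut_join k"
  unfolding U_op_def
proof (rule the_equality)
  show "lin (ad_cut_join k) \<and> (\<forall>la. is_partition la \<longrightarrow> ad_cut_join k (schur la) =
      (\<Sum>(b, mu)\<in>{(b, mu). adds_cell la b mu}. smul (of_int (content b) ^ k) (schur mu)))"
    using lin_ad_cut_join ad_cut_join_schur by blast
next
  fix T :: "'a symfun \<Rightarrow> 'a symfun"
  assume T: "lin T \<and> (\<forall>la. is_partition la \<longrightarrow> T (schur la) =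
      (\<Sum>(b, mu)\<in>{(b, mu). adds_cell la b mu}. smul (of_int (content b) ^ k) (schur mu)))"
  show "T = ad_cut_join k"
    by (rule lin_eq_on_schur) (use T lin_ad_cut_join in \<open>auto simp: ad_cut_join_schur\<close>)
qed

lemma U_part_0: "U_part k 0 = (\<lambda>f. smul (1 / of_nat (Suc k)) (normal_power (Suc k) 1 f))"
  unfolding U_part_def U_op_eq
  using op_sum_normal_coeffs_leading[OF lin_ad_cut_join ad_cut_join_leading_term[of k]] by simp

text \<open>
  Among the binomial terms of \<open>V (k + 1) 1\<close>, those for \<open>j = 0\<close> and \<open>j = k + 1\<close> are empty sums: the former since a
  sum of parts is not negative, the latter since \<open>k + 1 \<ge> 2\<close> positive parts do not sum to \<open>1\<close>.
\<close>
lemma normal_power_inner_sum: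
  assumes "k \<ge> 1"
  shows "normal_power (k + 1) 1 f = (\<Sum>j=1..k. of_nat ((k + 1) choose j) *
    op_sum (\<lambda>(as, bs) g. power_sums as * power_sums_perp bs g)
      {(as, bs). length as = j \<and> length bs = k + 1 - j \<and> (\<forall>a\<in>set as. a \<ge> 1) \<and>
        (\<forall>b\<in>set bs. b \<ge> 1) \<and> sum_list as = sum_list bs + 1} f)"
proof -
  let ?S = "\<lambda>j. op_sum (\<lambda>(as, bs) g. power_sums as * power_sums_perp bs g)
      {(as, bs). length as = j \<and> length bs = k + 1 - j \<and> (\<forall>a\<in>set as. a \<ge> 1) \<and>
        (\<forall>b\<in>set bs. b \<ge> 1) \<and> sum_list as = sum_list bs + 1} f"
  have S: "normal_sum j (k + 1 - j) 1 f = ?S j" for j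
  proof -
    have "int m = int n + 1 \<longleftrightarrow> m = n + 1" for m n by linarith
    then show ?thesis by (simp add: normal_sum_def)
  qed
  have length_le: "length xs \<le> sum_list xs" if "\<forall>a\<in>set xs. a \<ge> 1" for xs :: "nat list"
    using that by (induction xs) auto
  have S0: "normal_sum 0 (k + 1) 1 f = 0"
    by (rule normal_sum_0_left) simp_all
  have "{(as, bs). length as = k + 1 \<and> length bs = 0 \<and> (\<forall>a\<in>set as. a \<ge> 1) \<and> (\<forall>b\<in>set bs. b \<ge> 1) \<and>
      int (sum_list as) = int (sum_list bs) + 1} = {}"
    using length_le assms by fastforce
  note empty = this
  have Sk: "normal_sum (k + 1) 0 1 f = 0"
    unfolding normal_sum_def op_sum_def empty by simp
  have "normal_power (k + 1) 1 f = (\<Sum>j\<in>{1..k}. of_nat ((k + 1) choose j) * normal_sum j (k + 1 - j) 1 f)"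
    unfolding normal_power_def
  proof (rule sum.mono_neutral_right)
    show "\<forall>j\<in>{..k + 1} - {1..k}. of_nat ((k + 1) choose j) * normal_sum j (k + 1 - j) 1 f = 0"
    proof
      fix j assume "j \<in> {..k + 1} - {1..k}"
      then have "j = 0 \<or> j = k + 1" by auto
      then show "of_nat ((k + 1) choose j) * normal_sum j (k + 1 - j) 1 f = 0"
        using S0 Sk by auto
    qed
  qed auto
  then show ?thesis unfolding S .
qed

theorem corollary5p6:
  shows "U_part 0 0 = (\<lambda>f :: 'a::field_char_0 symfun. power_sum 1 * f) \<and>
    (\<forall>k\<ge>1. U_part k 0 = (\<lambda>f :: 'a symfun.
       \<Sum>j=1..k. smul (1 / of_nat (k + 1) * of_nat ((k + 1) choose j))
         (op_sum (\<lambda>(as, bs) g. power_sums as * power_sums_perp bs g)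
            {(as, bs). length as = j \<and> length bs = k + 1 - j \<and>
               (\<forall>a\<in>set as. a \<ge> 1) \<and> (\<forall>b\<in>set bs. b \<ge> 1) \<and>
               sum_list as = sum_list bs + 1} f)))"
proof (intro conjI allI impI)
  show "U_part 0 0 = (\<lambda>f :: 'a symfun. power_sum 1 * f)"
    by (simp add: U_part_0 normal_power_Suc_0 fun_eq_iff heis_def)
next
  fix k :: nat
  assume k: "k \<ge> 1"
  show "U_part k 0 = (\<lambda>f :: 'a symfun.
       \<Sum>j=1..k. smul (1 / of_nat (k + 1) * of_nat ((k + 1) choose j))
         (op_sum (\<lambda>(as, bs) g. power_sums as * power_sums_perp bs g)
            {(as, bs). length as = j \<and> length bs = k + 1 - j \<and>
               (\<forall>a\<in>set as. a \<ge> 1) \<and> (\<forall>b\<in>set bs. b \<ge> 1) \<and>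
               sum_list as = sum_list bs + 1} f))"
  proof
    fix f :: "'a symfun"
    have Suc: "Suc k = k + 1" by simp
    show "U_part k 0 f =
       (\<Sum>j=1..k. smul (1 / of_nat (k + 1) * of_nat ((k + 1) choose j))
         (op_sum (\<lambda>(as, bs) g. power_sums as * power_sums_perp bs g)
            {(as, bs). length as = j \<and> length bs = k + 1 - j \<and>
               (\<forall>a\<in>set as. a \<ge> 1) \<and> (\<forall>b\<in>set bs. b \<ge> 1) \<and>
               sum_list as = sum_list bs + 1} f))"
      unfolding U_part_0 Suc normal_power_inner_sum[OF k] symfun.scale_sum_right
        smul_of_nat[symmetric] symfun.scale_scale ..
  qed
qed

end
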